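(* Let $n$ be a positive integer. (a) For every $T \subseteq [n-1]$, the polynomial $A^T_n(x)$ has only real roots. (b) Let $P$ be a Cohen--Macaulay (over some field) simplicial poset of rank $n$. Then for every $T \subseteq [n]$, the rank-selected subposet $\hat{P}_T$ of $\hat{P}$ has a real-rooted chain polynomial. Moreover, $h(\Delta(\hat{P}_T),x)$ is interlaced by $A^T_n(x)$ for every $T \subseteq [n]$.
   Context: $[m]=\{1,\dots,m\}$ and $\mathfrak{S}_n$ is the symmetric group on $[n]$. For $w\in\mathfrak{S}_n$, $\mathrm{Des}(w)=\{i\in[n-1]: w(i)>w(i+1)\}$ and $\mathrm{des}(w)=|\mathrm{Des}(w)|$. For any set $T$ of integers, $A^T_n(x)=\sum_{w\in\mathfrak{S}_n:\ \mathrm{Des}(w)\subseteq T} x^{\mathrm{des}(w)}$ (so $A^T_n=A^{T\cap[n-1]}_n$). A finite poset $P$ with minimum element $\hat 0$ is simplicial if every interval $[\hat 0,y]$, $y\in P$, is isomorphic to a Boolean lattice. For a finite graded poset $P$ of rank $n$ with minimum $\hat 0$ and rank function $\rho$, $\hat P$ is obtained from $P$ by adjoining a new maximum element $\hat 1$, and for $T\subseteq[n]$ the rank-selected subposet is $\hat P_T=\{y\in P:\rho(y)\in T\}\cup\{\hat 0,\hat 1\}$. For a finite poset $Q$, the order complex $\Delta(Q)$ is the simplicial complex of chains of $Q$; the chain polynomial is $f_Q(x)=\sum_{i=0}^m f_{i-1}(\Delta(Q))x^i$, where $f_{i-1}(\Delta(Q))$ is the number of $i$-element chains of $Q$ (including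 the empty chain for $i=0$) and $m$ is the largest size of a chain; the $h$-polynomial is $h(\Delta(Q),x)=\sum_{i=0}^m f_{i-1}(\Delta(Q))x^i(1-x)^{m-i}$. A polynomial is real-rooted if all its roots are real or it is identically zero. For real-rooted $p$ with roots $\alpha_1\ge\alpha_2\ge\cdots$ and $q$ with roots $\beta_1\ge\beta_2\ge\cdots$, $p$ interlaces $q$ (written $p\preceq q$) if $\cdots\le\alpha_2\le\beta_2\le\alpha_1\le\beta_1$; by convention the zero polynomial interlaces and is interlaced by every real-rooted polynomial, and nonzero constants interlace every polynomial of degree at most one. *)

theory Defs
  imports
    "HOL-Computational_Algebra.Polynomial"
    "HOL-Combinatorics.Permutations"
    Complex_Main
begin

section \<open>Real-rootedness and interlacing\<close>

definition real_rooted :: "real poly \<Rightarrow> bool" where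
  "real_rooted p \<longleftrightarrow>
     p = 0 \<or> (\<forall>z::complex. poly (map_poly of_real p) z = 0 \<longrightarrow> z \<in> \<real>)"

text \<open>Real roots with multiplicity, in weakly decreasing order; empty for the zero polynomial.\<close>
definition root_list :: "real poly \<Rightarrow> real list" where
  "root_list p = rev (sorted_list_of_multiset (proots p))"

text \<open>
  \<open>interlaces p q\<close> reads: \<open>p\<close> interlaces \<open>q\<close>, i.e. \<open>\<dots> \<le> \<alpha>\<^sub>2 \<le> \<beta>\<^sub>2 \<le> \<alpha>\<^sub>1 \<le> \<beta>\<^sub>1\<close>
  for the roots \<open>\<alpha>\<close> of \<open>p\<close> and \<open>\<beta>\<close> of \<open>q\<close>. The weave of the two root lists forces \<open>q\<close>
  to have as many roots as \<open>p\<close>, or exactly one more. Indices below start at 0.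
\<close>
definition interlaces :: "real poly \<Rightarrow> real poly \<Rightarrow> bool" where
  "interlaces p q \<longleftrightarrow> real_rooted p \<and> real_rooted q \<and>
     (p = 0 \<or> q = 0 \<or>
      (let \<alpha> = root_list p; \<beta> = root_list q in
         (length \<beta> = length \<alpha> \<or> length \<beta> = length \<alpha> + 1) \<and>
         (\<forall>i < length \<alpha>. \<alpha> ! i \<le> \<beta> ! i) \<and>
         (\<forall>i. i + 1 < length \<beta> \<longrightarrow> \<beta> ! (i + 1) \<le> \<alpha> ! i)))"


section \<open>Descents and restricted Eulerian polynomials\<close>

definition Des :: "nat \<Rightarrow> (nat \<Rightarrow> nat) \<Rightarrow> nat set" where
  "Des n w = {i \<in> {1..n - 1}. w i > w (i + 1)}"

definition des :: "nat \<Rightarrow> (nat \<Rightarrow> nat) \<Rightarrow> nat" where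
  "des n w = card (Des n w)"

definition eulerian_poly :: "nat \<Rightarrow> nat set \<Rightarrow> real poly" where
  "eulerian_poly n T =
     (\<Sum>w \<in> {w. w permutes {1..n} \<and> Des n w \<subseteq> T}. monom 1 (des n w))"


section \<open>Simplicial complexes\<close>

text \<open>
  A finite simplicial complex is given by its finite set of faces, which includes the empty face.
\<close>

definition max_face_size :: "'a set set \<Rightarrow> nat" where
  "max_face_size K = Max (card ` K)"

definition face_count :: "'a set set \<Rightarrow> nat \<Rightarrow> nat" where
  "face_count K i = card {F \<in> K. card F = i}"

definition f_poly :: "'a set set \<Rightarrow> real poly" where
  "f_poly K = (\<Sum>i \<le> max_face_size K. monom (of_nat (face_count K i)) i)"

definition h_poly :: "'a set set \<Rightarrow> real poly" where
  "h_poly K = (\<Sum>i \<le> max_face_size K.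
     monom (of_nat (face_count K i)) i * [:1, -1:] ^ (max_face_size K - i))"

definition complex_dim :: "'a set set \<Rightarrow> int" where
  "complex_dim K = int (max_face_size K) - 1"

definition link :: "'a set set \<Rightarrow> 'a set \<Rightarrow> 'a set set" where
  "link K F = {G \<in> K. G \<inter> F = {} \<and> G \<union> F \<in> K}"

text \<open>
  Reduced simplicial homology with coefficients in a field. The simplices are oriented by a
  relation \<open>r\<close> that is assumed to order every face linearly. A chain is its coefficient
  function. The augmented chain complex has the empty face in degree \<open>-1\<close>.
\<close>

definition simplicial_chains :: "'a set set \<Rightarrow> int \<Rightarrow> ('a set \<Rightarrow> 'k::field) set" where
  "simplicial_chains K i = {c. \<forall>F. c F \<noteq> 0 \<longrightarrow> F \<in> K \<and> int (card F) = i + 1}"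

text \<open>
  \<open>\<partial>[v\<^sub>0,\<dots>,v\<^sub>i] = \<Sum>\<^sub>j (-1)\<^sup>j [v\<^sub>0,\<dots>,v\<^sub>i without v\<^sub>j]\<close>; the position \<open>j\<close> of a vertex is the number
  of vertices of the face strictly below it.
\<close>
definition boundary ::
  "'a rel \<Rightarrow> 'a set set \<Rightarrow> ('a set \<Rightarrow> 'k::field) \<Rightarrow> 'a set \<Rightarrow> 'k" where
  "boundary r K c G = (\<Sum>F\<in>K. \<Sum>v\<in>F.
     if F - {v} = G then (-1) ^ card {u \<in> F. u \<noteq> v \<and> (u, v) \<in> r} * c F else 0)"

text \<open>The \<open>i\<close>-th reduced homology group is zero: every cycle is a boundary.\<close>
definition reduced_homology_zero ::
  "'k::field itself \<Rightarrow> 'a rel \<Rightarrow> 'a set set \<Rightarrow> int \<Rightarrow> bool" where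
  "reduced_homology_zero k r K i \<longleftrightarrow>
     {c \<in> simplicial_chains K i. boundary r K c = (\<lambda>_. 0)}
       \<subseteq> boundary r K ` (simplicial_chains K (i + 1) :: ('a set \<Rightarrow> 'k) set)"

definition cohen_macaulay_complex ::
  "'k::field itself \<Rightarrow> 'a rel \<Rightarrow> 'a set set \<Rightarrow> bool" where
  "cohen_macaulay_complex k r K \<longleftrightarrow>
     (\<forall>F \<in> K. \<forall>i < complex_dim (link K F). reduced_homology_zero k r (link K F) i)"


section \<open>Posets\<close>

text \<open>A poset is a carrier \<open>P\<close> with its weak order relation \<open>r\<close>.\<close>

definition order_complex :: "'a set \<Rightarrow> 'a rel \<Rightarrow> 'a set set" where
  "order_complex Q r = {C \<in> Chains r. C \<subseteq> Q}"

definition chain_poly :: "'a set \<Rightarrow> 'a rel \<Rightarrow> real poly" where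
  "chain_poly Q r = f_poly (order_complex Q r)"

text \<open>Every face of the order complex is a chain, so the order itself orients the simplices.\<close>
definition cohen_macaulay_poset :: "'k::field itself \<Rightarrow> 'a set \<Rightarrow> 'a rel \<Rightarrow> bool" where
  "cohen_macaulay_poset k P r \<longleftrightarrow> cohen_macaulay_complex k r (order_complex P r)"

definition is_minimum :: "'a set \<Rightarrow> 'a rel \<Rightarrow> 'a \<Rightarrow> bool" where
  "is_minimum P r z \<longleftrightarrow> z \<in> P \<and> (\<forall>y \<in> P. (z, y) \<in> r)"

definition interval :: "'a set \<Rightarrow> 'a rel \<Rightarrow> 'a \<Rightarrow> 'a \<Rightarrow> 'a set" where
  "interval P r x y = {u \<in> P. (x, u) \<in> r \<and> (u, y) \<in> r}"

definition poset_isomorphic :: "'a set \<Rightarrow> 'a rel \<Rightarrow> 'b set \<Rightarrow> 'b rel \<Rightarrow> bool" where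
  "poset_isomorphic P r Q s \<longleftrightarrow>
     (\<exists>f. bij_betw f P Q \<and> (\<forall>x \<in> P. \<forall>y \<in> P. (x, y) \<in> r \<longleftrightarrow> (f x, f y) \<in> s))"

definition simplicial_poset :: "'a set \<Rightarrow> 'a rel \<Rightarrow> 'a \<Rightarrow> bool" where
  "simplicial_poset P r z \<longleftrightarrow> finite P \<and> partial_order_on P r \<and> is_minimum P r z \<and>
     (\<forall>y \<in> P. \<exists>k::nat. poset_isomorphic (interval P r z y) r (Pow {1..k}) {(A, B). A \<subseteq> B})"

definition graded_of_rank :: "'a set \<Rightarrow> 'a rel \<Rightarrow> nat \<Rightarrow> bool" where
  "graded_of_rank P r n \<longleftrightarrow>
     (\<forall>C \<in> order_complex P r.
        (\<forall>D \<in> order_complex P r. C \<subseteq> D \<longrightarrow> D = C) \<longrightarrow> card C = n + 1)"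

text \<open>
  In a graded poset with minimum \<open>z\<close>, all maximal chains of \<open>[z, y]\<close> have the same length, and this
  is the rank of \<open>y\<close>.
\<close>
definition rank_of :: "'a set \<Rightarrow> 'a rel \<Rightarrow> 'a \<Rightarrow> 'a \<Rightarrow> nat" where
  "rank_of P r z y = Max (card ` order_complex (interval P r z y) r) - 1"

text \<open>
  Adjoining a new maximum: the old elements are \<open>Some y\<close> and the new maximum is \<open>None\<close> (the order
  on \<open>'a option\<close> from the library puts \<open>None\<close> at the bottom and is not used here).
\<close>
definition hat_rel :: "'a set \<Rightarrow> 'a rel \<Rightarrow> 'a option rel" where
  "hat_rel P r = {(Some x, Some y) | x y. (x, y) \<in> r} \<union> {(u, None) | u. u \<in> insert None (Some ` P)}"

definition rank_selected :: "'a set \<Rightarrow> 'a rel \<Rightarrow> 'a \<Rightarrow> nat set \<Rightarrow> 'a option set" where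
  "rank_selected P r z T = Some ` {y \<in> P. rank_of P r z y \<in> T} \<union> {Some z, None}"

end

theory Submission
  imports
    Defs
    "HOL-Library.Function_Algebras"
    "HOL-Library.Multiset"
    "HOL-Computational_Algebra.Formal_Laurent_Series"
    "HOL-Computational_Algebra.Fundamental_Theorem_Algebra"
    "HOL-Real_Asymp.Real_Asymp"
begin

text \<open>
  Let \<open>p\<^sub>k\<close> enumerate by descents the permutations \<open>w\<close> of \<open>{1..n+1}\<close> with descents in \<open>T\<close>
  and last letter \<open>n + 1 - k\<close>, so that \<open>p\<^sub>0\<close> is the polynomial of part (a). Splitting the chains by their
  top element gives \<open>h(\<Delta>, x) = \<Sum>k. h\<^sub>k p\<^sub>k(x)\<close>, where \<open>(h\<^sub>k)\<close> is the h-vector of the simplicial poset.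

  At a point of the upper half plane, interlacing becomes a pair of inequalities that are additive in
  both polynomials. Deleting the last letter yields a recursion for the \<open>p\<^sub>k\<close> that preserves these
  inequalities. Hence nonnegative combinations of the \<open>p\<^sub>k\<close> are real-rooted and interlaced by \<open>p\<^sub>0\<close>.

  That \<open>h\<^sub>k \<ge> 0\<close> is Reisner's argument without local cohomology. After enlarging the field, the linear
  forms \<open>\<theta>\<^sub>s = \<Sum>v. c(v)\<^sup>s x\<^sub>v\<close> with distinct \<open>c(v)\<close> restrict to a regular sequence on the polynomial ring of
  every face. By the Cohen--Macaulay property the direct sums over the faces of rank \<open>p\<close> of these
  polynomial rings form a complex that is exact for \<open>p < n\<close>. Thus \<open>\<theta>\<^sub>0, \<dots>, \<theta>\<^bsub>n-1\<^esub>\<close> is a regular sequence on the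
  kernel in rank \<open>n\<close>, and \<open>h\<^bsub>n-d\<^esub>\<close> is the dimension of the degree \<open>d\<close> part of the quotient.
\<close>

text \<open>Different faces of a simplicial poset may have the same vertices, so its face ring need
  not be a quotient of a polynomial ring in the vertices. No ring is formed: the complex used is the
  dualizing complex, whose terms are polynomial rings of single faces, and its kernel in rank
  \<open>n\<close> plays the part of the canonical module. This duality is why degree
  \<open>d\<close> yields the entry \<open>n - d\<close>. The first \<open>p\<close> forms are
  independent on a face of rank \<open>p\<close> because the numbers attached to its vertices are
  distinct; a finite field may have too few numbers, and the powers of \<open>X\<close> in Laurent
  series supply them. The Cohen--Macaulay hypothesis concerns chains, the resolution concerns faces.
  Barycentric subdivision followed by the last vertex map is the identity, which makes the cellular
  complex a direct summand of the simplicial one, so exactness descends without a chain homotopy. On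
  the analytic side some of the polynomials vanish identically and roots may coincide; weak
  inequalities at single points of the upper half plane absorb these cases. Two inequalities are
  carried because the recursion multiplies only some of its summands by \<open>x\<close>.\<close>

section \<open>Regular sequences along an exact complex\<close>

text \<open>For commuting operators \<open>\<theta> 0, \<theta> 1, \<dots>\<close> this is the degree \<open>d + 1\<close> part of the submodule
  \<open>(\<theta> 0, \<dots>, \<theta> (r - 1)) M\<close> when \<open>X\<close> is the degree \<open>d\<close> part of a graded module \<open>M\<close>.\<close>

primrec opsum :: "(nat \<Rightarrow> 'm::ab_group_add \<Rightarrow> 'm) \<Rightarrow> 'm set \<Rightarrow> nat \<Rightarrow> 'm set" where
  "opsum \<theta> X 0 = {0}"
| "opsum \<theta> X (Suc r) = {a + \<theta> r g | a g. a \<in> opsum \<theta> X r \<and> g \<in> X}"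

lemma opsum_SucI: "a \<in> opsum \<theta> X r \<Longrightarrow> g \<in> X \<Longrightarrow> a + \<theta> r g \<in> opsum \<theta> X (Suc r)"
  by auto

lemma opsum_SucE:
  assumes "x \<in> opsum \<theta> X (Suc r)"
  obtains a g where "x = a + \<theta> r g" "a \<in> opsum \<theta> X r" "g \<in> X"
  using assms by auto

definition add_subgroup :: "'m::ab_group_add set \<Rightarrow> bool" where
  "add_subgroup X \<longleftrightarrow> 0 \<in> X \<and> (\<forall>x\<in>X. \<forall>y\<in>X. x - y \<in> X)"

lemma add_subgroup_closed:
  assumes "add_subgroup X"
  shows "0 \<in> X" "x \<in> X \<Longrightarrow> y \<in> X \<Longrightarrow> x - y \<in> X" "x \<in> X \<Longrightarrow> - x \<in> X"
    "x \<in> X \<Longrightarrow> y \<in> X \<Longrightarrow> x + y \<in> X"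
proof -
  show z: "0 \<in> X" and m: "\<And>x y. x \<in> X \<Longrightarrow> y \<in> X \<Longrightarrow> x - y \<in> X"
    using assms by (auto simp: add_subgroup_def)
  show n: "\<And>x. x \<in> X \<Longrightarrow> - x \<in> X"
    using m[OF z] by simp
  show "\<And>x y. x \<in> X \<Longrightarrow> y \<in> X \<Longrightarrow> x + y \<in> X"
    using m n by (metis diff_minus_eq_add)
qed

lemma opsum_mono: "X \<subseteq> Y \<Longrightarrow> opsum \<theta> X r \<subseteq> opsum \<theta> Y r"
  by (induction r) auto

lemma additive_diff:
  fixes f :: "'m::ab_group_add \<Rightarrow> 'n::ab_group_add"
  assumes "\<And>x y. f (x + y) = f x + f y"
  shows "f 0 = 0" "f (x - y) = f x - f y"
proof -
  show "f 0 = 0"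
    using assms[of 0 0] by simp
  show "f (x - y) = f x - f y"
    using assms[of "x - y" y] by (simp add: algebra_simps)
qed

lemma opsum_subgroup:
  assumes "add_subgroup X" and add: "\<And>r x y. \<theta> r (x + y) = \<theta> r x + \<theta> r y"
  shows "add_subgroup (opsum \<theta> X r)"
proof (induction r)
  case 0
  show ?case by (simp add: add_subgroup_def)
next
  case (Suc r)
  have t: "\<theta> r 0 = 0" "\<And>x y. \<theta> r (x - y) = \<theta> r x - \<theta> r y"
    using additive_diff[of "\<theta> r", OF add] by auto
  have "0 \<in> opsum \<theta> X (Suc r)"
    using add_subgroup_closed(1)[OF Suc] add_subgroup_closed(1)[OF assms(1)] t(1) by force
  moreover have "x - y \<in> opsum \<theta> X (Suc r)"
    if xy: "x \<in> opsum \<theta> X (Suc r)" "y \<in> opsum \<theta> X (Suc r)" for x y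
  proof -
    obtain a g b h where *: "x = a + \<theta> r g" "y = b + \<theta> r h"
      "a \<in> opsum \<theta> X r" "b \<in> opsum \<theta> X r" "g \<in> X" "h \<in> X"
      using xy by auto
    have "x - y = (a - b) + \<theta> r (g - h)"
      by (simp add: * t)
    then show ?thesis
      using add_subgroup_closed(2)[OF Suc *(3,4)] add_subgroup_closed(2)[OF assms(1) *(5,6)] by auto
  qed
  ultimately show ?case
    by (simp only: add_subgroup_def) blast
qed

lemma opsum_image:
  assumes add: "\<And>x y. f (x + y) = f x + f y"
    and comm: "\<And>r x. f (\<theta> r x) = \<theta> r (f x)"
    and X: "f ` X \<subseteq> Y"
    and x: "x \<in> opsum \<theta> X r"
  shows "f x \<in> opsum \<theta> Y r"
  using x
proof (induction r arbitrary: x)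
  case 0
  then show ?case using additive_diff(1)[of f, OF add] by simp
next
  case (Suc r)
  then obtain a g where "x = a + \<theta> r g" "a \<in> opsum \<theta> X r" "g \<in> X" by auto
  with Suc.IH[of a] X show ?case
    by (auto simp: add comm)
qed

lemma opsum_lift:
  assumes add: "\<And>x y. f (x + y) = f x + f y"
    and comm: "\<And>r x. f (\<theta> r x) = \<theta> r (f x)"
    and X: "Y \<subseteq> f ` X"
    and y: "y \<in> opsum \<theta> Y r"
  shows "\<exists>x \<in> opsum \<theta> X r. f x = y"
  using y
proof (induction r arbitrary: y)
  case 0
  then show ?case using additive_diff(1)[of f, OF add] by simp
next
  case (Suc r)
  then obtain a g where *: "y = a + \<theta> r g" "a \<in> opsum \<theta> Y r" "g \<in> Y" by auto
  from Suc.IH[OF *(2)] obtain a' where a': "a' \<in> opsum \<theta> X r" "f a' = a" by auto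
  from *(3) X obtain g' where g': "g' \<in> X" "f g' = g" by auto
  have "f (a' + \<theta> r g') = y" by (simp add: add comm a' g' *)
  then show ?case using a' g' by auto
qed

text \<open>A complex \<open>D n \<rightarrow> \<dots> \<rightarrow> D 1 \<rightarrow> D 0\<close> of graded modules, exact except at \<open>D n\<close>, such that the first
  \<open>p\<close> operators form a regular sequence on \<open>D p\<close>. Then they also do so on the kernel of \<open>bd\<close> in \<open>D p\<close>,
  for \<open>p \<le> n\<close>.\<close>

locale regular_resolution =
  fixes \<theta> :: "nat \<Rightarrow> 'm::ab_group_add \<Rightarrow> 'm" and bd :: "'m \<Rightarrow> 'm"
    and D :: "nat \<Rightarrow> int \<Rightarrow> 'm set" and n :: nat
  assumes theta_add: "\<theta> r (x + y) = \<theta> r x + \<theta> r y"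
    and theta_comm: "\<theta> r (\<theta> s x) = \<theta> s (\<theta> r x)"
    and bd_add: "bd (x + y) = bd x + bd y"
    and bd_theta: "bd (\<theta> r x) = \<theta> r (bd x)"
    and D_subgroup: "add_subgroup (D p d)"
    and theta_D: "x \<in> D p d \<Longrightarrow> \<theta> r x \<in> D p (d + 1)"
    and bd_D: "x \<in> D (Suc p) d \<Longrightarrow> bd x \<in> D p d"
    and bd_bd: "x \<in> D p d \<Longrightarrow> bd (bd x) = 0"
    and exact: "p < n \<Longrightarrow> x \<in> D p d \<Longrightarrow> bd x = 0 \<Longrightarrow> \<exists>b \<in> D (Suc p) d. bd b = x"
    and regular_D: "r < p \<Longrightarrow> x \<in> D p d \<Longrightarrow> \<theta> r x \<in> opsum \<theta> (D p d) r \<Longrightarrow>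
      x \<in> opsum \<theta> (D p (d - 1)) r"
begin

definition Z :: "nat \<Rightarrow> int \<Rightarrow> 'm set" where
  "Z p d = {x \<in> D p d. bd x = 0}"

lemma bd_diff: "bd 0 = 0" "bd (x - y) = bd x - bd y"
  using additive_diff[of bd] bd_add by auto

lemma theta_diff: "\<theta> r 0 = 0" "\<theta> r (x - y) = \<theta> r x - \<theta> r y"
  using additive_diff[of "\<theta> r"] theta_add by auto

lemma Z_subgroup: "add_subgroup (Z p d)"
  using D_subgroup[of p d] by (auto simp: add_subgroup_def Z_def bd_diff)

lemma opsum_Z_subgroup: "add_subgroup (opsum \<theta> (Z p d) r)"
  by (rule opsum_subgroup[OF Z_subgroup]) (rule theta_add)

lemma theta_Z: "x \<in> Z p d \<Longrightarrow> \<theta> r x \<in> Z p (d + 1)"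
  by (auto simp: Z_def theta_D bd_theta theta_diff)

lemma opsum_Z: "opsum \<theta> (Z p (d - 1)) r \<subseteq> Z p d"
proof (induction r)
  case 0
  show ?case using add_subgroup_closed(1)[OF Z_subgroup] by simp
next
  case (Suc r)
  show ?case
    using Suc theta_Z[of _ p "d - 1"] by (auto intro!: add_subgroup_closed(4)[OF Z_subgroup])
qed

lemma Z_eq_bd: "p < n \<Longrightarrow> Z p d = bd ` D (Suc p) d"
  using exact bd_D bd_bd by (fastforce simp: Z_def)

text \<open>For the exact sequence \<open>0 -> Z p -> D p -> Z (p - 1) -> 0\<close> this is the
  vanishing of a Tor obstruction. A relation with coefficients in \<open>D p\<close> maps to a
  relation on \<open>Z (p - 1)\<close>, where regularity puts its last coefficient into the ideal of
  the earlier forms. Lifting that element corrects the last coefficient to a cycle, and induction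
  treats the others.\<close>

lemma opsum_D_inter_Z:
  assumes p: "p \<le> n"
    and regular: "\<And>s d x. Suc s < p \<Longrightarrow> x \<in> Z (p - 1) d \<Longrightarrow> \<theta> s x \<in> opsum \<theta> (Z (p - 1) d) s \<Longrightarrow>
      x \<in> opsum \<theta> (Z (p - 1) (d - 1)) s"
    and "r < p" and x: "x \<in> opsum \<theta> (D p d) r" "bd x = 0"
  shows "x \<in> opsum \<theta> (Z p d) r"
  using \<open>r < p\<close> x
proof (induction r arbitrary: x)
  case 0
  then show ?case by simp
next
  case (Suc r)
  define X where "X = opsum \<theta> (D p d) r"
  have X: "add_subgroup X"
    unfolding X_def by (rule opsum_subgroup[OF D_subgroup]) (rule theta_add)
  obtain a g where ag: "x = a + \<theta> r g" "a \<in> X" "g \<in> D p d"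
    using Suc.prems by (auto simp: X_def)
  have p': "p - 1 < n" "Suc (p - 1) = p" using p Suc.prems by auto
  have imD: "bd ` D p d \<subseteq> Z (p - 1) d" "bd ` D p (d - 1) = Z (p - 1) (d - 1)"
    using Z_eq_bd[OF p'(1)] p'(2) by auto
  have "\<theta> r (bd g) = - bd a"
    using Suc.prems(3) by (simp add: ag bd_add bd_theta eq_neg_iff_add_eq_0 add.commute)
  moreover have "bd a \<in> opsum \<theta> (Z (p - 1) d) r"
    using opsum_image[of bd \<theta> "D p d" "Z (p - 1) d", OF bd_add bd_theta imD(1)] ag(2)
    by (simp add: X_def)
  ultimately have "\<theta> r (bd g) \<in> opsum \<theta> (Z (p - 1) d) r"
    using add_subgroup_closed(3)[OF opsum_Z_subgroup] by simp
  then have "bd g \<in> opsum \<theta> (Z (p - 1) (d - 1)) r"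
    using regular[of r] Suc.prems(1) imD(1) ag(3) by blast
  \<comment> \<open>\<open>h\<close> differs from \<open>g\<close> by a cycle and lies in the ideal
    of the first \<open>r\<close> forms, so \<open>\<theta> r h\<close> can be moved into the part
    \<open>a\<close>.\<close>
  then obtain h where h: "h \<in> opsum \<theta> (D p (d - 1)) r" "bd h = bd g"
    using opsum_lift[of bd \<theta> "Z (p - 1) (d - 1)" "D p (d - 1)", OF bd_add bd_theta] imD(2)
    by blast
  have hD: "h \<in> D p d"
    using h(1)
  proof (induction r arbitrary: h)
    case 0
    then show ?case using add_subgroup_closed(1)[OF D_subgroup] by simp
  next
    case (Suc r)
    then show ?case
      using theta_D[of _ p "d - 1"] by (auto intro!: add_subgroup_closed(4)[OF D_subgroup])
  qed
  have "\<theta> r h \<in> X"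
    unfolding X_def
  proof (rule opsum_image[OF theta_add theta_comm _ h(1)])
    show "\<theta> r ` D p (d - 1) \<subseteq> D p d"
      using theta_D[of _ p "d - 1" r] by auto
  qed
  then have "a + \<theta> r h \<in> X"
    using ag(2) add_subgroup_closed(4)[OF X] by blast
  moreover have "bd (a + \<theta> r h) = 0"
    using Suc.prems(3) by (simp add: ag bd_add bd_theta h(2))
  ultimately have "a + \<theta> r h \<in> opsum \<theta> (Z p d) r"
    using Suc.IH Suc.prems(1) by (simp add: X_def)
  moreover have "g - h \<in> Z p d"
    using ag(3) hD add_subgroup_closed(2)[OF D_subgroup] h(2) by (simp add: Z_def bd_diff)
  moreover have "x = (a + \<theta> r h) + \<theta> r (g - h)"
    by (simp add: ag theta_diff)
  ultimately show ?case by auto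
qed

text \<open>Regularity on \<open>D p\<close> writes \<open>x\<close> with coefficients in
  \<open>D p\<close>, and \<open>opsum_D_inter_Z\<close> turns them into cycles. That lemma asks on
  \<open>Z (p - 1)\<close> only for regularity of the first \<open>p - 1\<close> forms, which is the
  induction hypothesis.\<close>

theorem regular_Z:
  assumes "r < p" "p \<le> n" "x \<in> Z p d" "\<theta> r x \<in> opsum \<theta> (Z p d) r"
  shows "x \<in> opsum \<theta> (Z p (d - 1)) r"
  using assms
proof (induction p arbitrary: r x d)
  case 0
  then show ?case by simp
next
  case (Suc p)
  have "\<theta> r x \<in> opsum \<theta> (D (Suc p) d) r"
    using Suc.prems opsum_mono[of "Z (Suc p) d" "D (Suc p) d"] by (auto simp: Z_def)
  then have x: "x \<in> opsum \<theta> (D (Suc p) (d - 1)) r"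
    using regular_D Suc.prems by (auto simp: Z_def)
  show ?case
  proof (rule opsum_D_inter_Z[OF _ _ _ x])
    show "bd x = 0" using Suc.prems by (simp add: Z_def)
    fix s d x assume "Suc s < Suc p" "x \<in> Z (Suc p - 1) d"
      "\<theta> s x \<in> opsum \<theta> (Z (Suc p - 1) d) s"
    then show "x \<in> opsum \<theta> (Z (Suc p - 1) (d - 1)) s"
      using Suc.IH[of s x d] Suc.prems by simp
  qed (use Suc.prems in auto)
qed

end

section \<open>Regular sequences of linear forms\<close>

text \<open>A homogeneous polynomial of degree \<open>d\<close> in the variables \<open>A\<close> is its coefficient function; the
  monomials are multisets of variables. Degrees are integers, so that there is no truncation in
  \<open>d - 1\<close>.\<close>

definition forms :: "'v set \<Rightarrow> int \<Rightarrow> ('v multiset \<Rightarrow> 'k::field) set" where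
  "forms A d = {m. \<forall>a. m a \<noteq> 0 \<longrightarrow> set_mset a \<subseteq> A \<and> int (size a) = d}"

text \<open>Multiplication by the linear form with coefficients \<open>w\<close> in the polynomial
  ring on \<open>A\<close>. A monomial receives one term for each variable dividing it, whatever the
  multiplicity of that variable.\<close>

definition lin_mult :: "'v set \<Rightarrow> ('v \<Rightarrow> 'k::field) \<Rightarrow> ('v multiset \<Rightarrow> 'k) \<Rightarrow> 'v multiset \<Rightarrow> 'k" where
  "lin_mult A w m b = (if set_mset b \<subseteq> A then \<Sum>v\<in>set_mset b. w v * m (b - {#v#}) else 0)"

lemma forms_iff: "m \<in> forms A d \<longleftrightarrow> (\<forall>a. \<not> (set_mset a \<subseteq> A \<and> int (size a) = d) \<longrightarrow> m a = 0)"
  unfolding forms_def by blast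

lemma formsD: "m \<in> forms A d \<Longrightarrow> \<not> (set_mset a \<subseteq> A \<and> int (size a) = d) \<Longrightarrow> m a = 0"
  unfolding forms_def by blast

lemma forms_subgroup: "add_subgroup (forms A d)"
  by (simp add: add_subgroup_def forms_iff)

lemma lin_mult_add: "lin_mult A w (x + y) = lin_mult A w x + lin_mult A w y"
  by (auto simp: lin_mult_def fun_eq_iff algebra_simps sum.distrib)

lemma lin_mult_add_weight: "lin_mult A (\<lambda>v. w v + w' v) x = lin_mult A w x + lin_mult A w' x"
  by (auto simp: lin_mult_def fun_eq_iff algebra_simps sum.distrib)

lemma lin_mult_scale: "lin_mult A w (\<lambda>a. c * x a) = (\<lambda>a. c * lin_mult A w x a)"
  by (auto simp: lin_mult_def fun_eq_iff sum_distrib_left mult_ac)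

lemma lin_mult_scale_weight: "lin_mult A (\<lambda>v. c * w v) x = (\<lambda>a. c * lin_mult A w x a)"
  by (auto simp: lin_mult_def fun_eq_iff sum_distrib_left mult_ac)

text \<open>Both sides are sums over the ordered pairs of variables whose product divides the
  monomial, and this set of pairs is symmetric.\<close>

lemma lin_mult_comm: "lin_mult A w (lin_mult A w' x) = lin_mult A w' (lin_mult A w x)"
proof
  fix b
  show "lin_mult A w (lin_mult A w' x) b = lin_mult A w' (lin_mult A w x) b"
  proof (cases "set_mset b \<subseteq> A")
    case True
    have sub: "set_mset (b - {#v#}) \<subseteq> A" for v
      using True by (meson in_diffD subset_eq)
    define S where "S = {(v, u). v \<in># b \<and> u \<in># b - {#v#}}"
    have fin: "finite S"
    proof (rule finite_subset)
      show "S \<subseteq> set_mset b \<times> set_mset b" by (auto simp: S_def dest: in_diffD)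
    qed auto
    have *: "lin_mult A w (lin_mult A w' x) b
        = (\<Sum>(v, u)\<in>S. w v * w' u * x (b - {#v#} - {#u#}))" for w w' :: "_ \<Rightarrow> 'b"
    proof -
      have "lin_mult A w (lin_mult A w' x) b =
          (\<Sum>v\<in>set_mset b. \<Sum>u\<in>set_mset (b - {#v#}). w v * w' u * x (b - {#v#} - {#u#}))"
        using True sub by (simp add: lin_mult_def sum_distrib_left mult.assoc)
      also have "\<dots> = (\<Sum>(v, u)\<in>Sigma (set_mset b) (\<lambda>v. set_mset (b - {#v#})).
          w v * w' u * x (b - {#v#} - {#u#}))"
        by (rule sum.Sigma) auto
      also have "Sigma (set_mset b) (\<lambda>v. set_mset (b - {#v#})) = S"
        by (auto simp: S_def)
      finally show ?thesis .
    qed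
    have sw: "(v, u) \<in> S \<longleftrightarrow> (u, v) \<in> S" for u v
    proof -
      have "(v, u) \<in> S \<longleftrightarrow> {#v, u#} \<subseteq># b" for u v
        by (auto simp: S_def insert_subset_eq_iff)
      moreover have "{#v, u#} = {#u, v#}" by simp
      ultimately show ?thesis by metis
    qed
    have "(\<Sum>(v, u)\<in>S. w v * w' u * x (b - {#v#} - {#u#}))
        = (\<Sum>(v, u)\<in>S. w' v * w u * x (b - {#v#} - {#u#}))"
      by (rule sum.reindex_bij_witness[of _ "\<lambda>(v, u). (u, v)" "\<lambda>(v, u). (u, v)"])
        (use sw in \<open>auto simp: mult_ac add_mset_commute\<close>)
    then show ?thesis by (simp only: *)
  qed (simp add: lin_mult_def)
qed

lemma lin_mult_forms: "m \<in> forms A d \<Longrightarrow> lin_mult A w m \<in> forms A (d + 1)"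
proof -
  assume m: "m \<in> forms A d"
  show ?thesis
    unfolding forms_def mem_Collect_eq
  proof (intro allI impI)
    fix b assume "lin_mult A w m b \<noteq> 0"
    then have b: "set_mset b \<subseteq> A" and nz: "(\<Sum>v\<in>set_mset b. w v * m (b - {#v#})) \<noteq> 0"
      unfolding lin_mult_def by presburger+
    obtain v where v: "v \<in># b" "m (b - {#v#}) \<noteq> 0"
      using sum.not_neutral_contains_not_neutral[OF nz] by force
    then have "int (size (b - {#v#})) = d" using m by (auto simp: forms_def)
    moreover have "size b = Suc (size (b - {#v#}))"
      using v(1) by (metis insert_DiffM size_add_mset)
    ultimately show "set_mset b \<subseteq> A \<and> int (size b) = d + 1" using b by simp
  qed
qed

lemma forms_mono: "A \<subseteq> B \<Longrightarrow> forms A d \<subseteq> forms B d"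
  by (auto simp: forms_def)

lemma forms_scale: "m \<in> forms A d \<Longrightarrow> (\<lambda>a. c * m a) \<in> forms A d"
  by (auto simp: forms_def)

text \<open>A linear form in which a variable \<open>p\<close> occurs can be used to eliminate \<open>p\<close>.\<close>

lemma eliminate_exists:
  assumes p: "p \<notin> A" "w p \<noteq> 0" and m: "m \<in> forms (insert p A) d"
  shows "\<exists>q \<in> forms (insert p A) (d - 1). \<exists>e \<in> forms A d. m = lin_mult (insert p A) w q + e"
proof -
  \<comment> \<open>Induction on a bound \<open>k\<close> for the exponents of \<open>p\<close> in
    \<open>m\<close>: each division by the form lowers this bound.\<close>
  have "\<exists>q \<in> forms (insert p A) (d - 1). \<exists>e \<in> forms A d. m = lin_mult (insert p A) w q + e"
    if "m \<in> forms (insert p A) d" "\<And>a. m a \<noteq> 0 \<Longrightarrow> count a p < k" for k m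
    using that
  proof (induction k arbitrary: m)
    case 0
    then have "m = lin_mult (insert p A) w 0 + 0"
      by (auto simp: lin_mult_def fun_eq_iff)
    then show ?case
      using add_subgroup_closed(1)[OF forms_subgroup] by blast
  next
    case (Suc k)
    show ?case
    proof (cases k)
      case 0
      have "m \<in> forms A d"
        unfolding forms_def mem_Collect_eq
      proof (intro allI impI)
        fix a assume a: "m a \<noteq> 0"
        then have "p \<notin># a" using Suc.prems(2)[OF a] 0 by (simp add: not_in_iff)
        then show "set_mset a \<subseteq> A \<and> int (size a) = d"
          using Suc.prems(1) a by (auto simp: forms_def)
      qed
      moreover have "m = lin_mult (insert p A) w 0 + m"
        by (auto simp: lin_mult_def fun_eq_iff)
      ultimately show ?thesis
        using add_subgroup_closed(1)[OF forms_subgroup] by blast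
    next
      case (Suc k')
      \<comment> \<open>The term of the product at \<open>p\<close> reproduces the part of
        \<open>m\<close> with the highest exponent \<open>k\<close> of \<open>p\<close>; the terms
        at the other variables have exponent \<open>k'\<close> in \<open>p\<close>.\<close>
      define q where "q = (\<lambda>a. if count a p = k' then m (add_mset p a) / w p else 0)"
      have q: "q \<in> forms (insert p A) (d - 1)"
        unfolding forms_def mem_Collect_eq
      proof (intro allI impI)
        fix a assume "q a \<noteq> 0"
        then have "m (add_mset p a) \<noteq> 0" by (auto simp: q_def split: if_splits)
        then show "set_mset a \<subseteq> insert p A \<and> int (size a) = d - 1"
          using Suc.prems(1) by (force simp: forms_def)
      qed
      define m' where "m' = m - lin_mult (insert p A) w q"
      have m': "m' \<in> forms (insert p A) d"
        unfolding m'_def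
        using lin_mult_forms[OF q, of w] by (intro add_subgroup_closed(2)[OF forms_subgroup Suc.prems(1)]) simp
      have "count b p < k" if b: "m' b \<noteq> 0" for b
      proof (rule ccontr)
        assume ge: "\<not> count b p < k"
        have sb: "set_mset b \<subseteq> insert p A" using m' b by (auto simp: forms_def)
        have zero: "q (b - {#v#}) = 0" if "v \<noteq> p" for v
          using ge that Suc by (auto simp: q_def)
        have pb: "p \<in># b" using ge Suc by (metis count_greater_zero_iff gr0I less_Suc_eq_0_disj)
        have "lin_mult (insert p A) w q b = (\<Sum>v\<in>set_mset b. w v * q (b - {#v#}))"
          using sb by (simp add: lin_mult_def)
        also have "\<dots> = (\<Sum>v\<in>{p}. w v * q (b - {#v#}))"
          by (rule sum.mono_neutral_right) (use pb zero in auto)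
        also have "\<dots> = w p * q (b - {#p#})" by simp
        also have "\<dots> = (if count b p = k then m b else 0)"
          using p(2) pb Suc by (auto simp: q_def)
        finally have L: "lin_mult (insert p A) w q b = (if count b p = k then m b else 0)" .
        have "m b = 0" if "count b p \<noteq> k"
          using Suc.prems(2)[of b] ge that by (metis less_SucE)
        then have "m' b = 0" using L by (auto simp: m'_def)
        with b show False by simp
      qed
      from Suc.IH[OF m' this] obtain q' e where
        q': "q' \<in> forms (insert p A) (d - 1)" "e \<in> forms A d" "m' = lin_mult (insert p A) w q' + e"
        by blast
      have "m = lin_mult (insert p A) w (q + q') + e"
        using q'(3) by (simp add: m'_def lin_mult_add algebra_simps)
      with q'(2) add_subgroup_closed(4)[OF forms_subgroup q q'(1)] show ?thesis
        by blast
    qed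
  qed
  moreover have "count a p < Suc (nat d)" if "m a \<noteq> 0" for a
    using m that count_le_size[of a p] by (fastforce simp: forms_def)
  ultimately show ?thesis using m by blast
qed

text \<open>A monomial of \<open>q\<close> with maximal exponent of \<open>p\<close>, multiplied by
  \<open>p\<close>, meets no other term of the product, so it survives and the product involves
  \<open>p\<close>.\<close>

lemma eliminate_unique:
  assumes p: "p \<notin> A" "w p \<noteq> 0" and q: "q \<in> forms (insert p A) d"
    and "lin_mult (insert p A) w q \<in> forms A d'"
  shows "q = 0"
proof (rule ccontr)
  assume "q \<noteq> 0"
  then obtain a0 where a0: "q a0 \<noteq> 0" by (auto simp: fun_eq_iff)
  have bnd: "\<forall>a. q a \<noteq> 0 \<longrightarrow> count a p < Suc (nat d)"
  proof (intro allI impI)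
    fix a assume "q a \<noteq> 0"
    then have "int (size a) = d" using q by (auto simp: forms_def)
    then show "count a p < Suc (nat d)" using count_le_size[of a p] by linarith
  qed
  obtain a where a: "q a \<noteq> 0" "\<And>b. q b \<noteq> 0 \<Longrightarrow> count b p \<le> count a p"
    using ex_has_greatest_nat[of "\<lambda>a. q a \<noteq> 0" a0 "\<lambda>a. count a p", OF a0 bnd] by blast
  define b where "b = add_mset p a"
  have sb: "set_mset b \<subseteq> insert p A" using q a(1) by (auto simp: forms_def b_def)
  have zero: "q (b - {#v#}) = 0" if "v \<noteq> p" for v
    using a(2)[of "b - {#v#}"] that by (auto simp: b_def)
  have "lin_mult (insert p A) w q b = (\<Sum>v\<in>set_mset b. w v * q (b - {#v#}))"
    using sb by (simp add: lin_mult_def)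
  also have "\<dots> = (\<Sum>v\<in>{p}. w v * q (b - {#v#}))"
    by (rule sum.mono_neutral_right) (use zero in \<open>auto simp: b_def\<close>)
  also have "\<dots> = w p * q a" by (simp add: b_def)
  finally have "lin_mult (insert p A) w q b \<noteq> 0" using p a by simp
  then have "set_mset b \<subseteq> A" using assms(4) by (auto simp: forms_def)
  then show False using p by (simp add: b_def)
qed

lemma opsum_subset_forms:
  "opsum (\<lambda>s. lin_mult A (w s)) (forms A (d - 1)) r \<subseteq> forms A d"
proof (induction r)
  case 0
  show ?case using add_subgroup_closed(1)[OF forms_subgroup] by simp
next
  case (Suc r)
  show ?case
    using Suc lin_mult_forms[of _ A "d - 1"]
    by (auto intro!: add_subgroup_closed(4)[OF forms_subgroup])
qed

lemma opsum_forms_subgroup: "add_subgroup (opsum (\<lambda>s. lin_mult A (w s)) (forms A d) r)"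
  by (rule opsum_subgroup[OF forms_subgroup]) (rule lin_mult_add)

lemma opsum_forms_scale:
  "x \<in> opsum (\<lambda>s. lin_mult A (w s)) (forms A d) r \<Longrightarrow>
   (\<lambda>a. c * x a) \<in> opsum (\<lambda>s. lin_mult A (w s)) (forms A d) r"
proof (induction r arbitrary: x)
  case 0
  then show ?case by (simp add: fun_eq_iff)
next
  case (Suc r)
  then obtain a g where *: "x = a + lin_mult A (w r) g"
    "a \<in> opsum (\<lambda>s. lin_mult A (w s)) (forms A d) r" "g \<in> forms A d" by auto
  have "(\<lambda>b. c * x b) = (\<lambda>b. c * a b) + lin_mult A (w r) (\<lambda>b. c * g b)"
    by (auto simp: * lin_mult_scale fun_eq_iff algebra_simps)
  then show ?case using Suc.IH[OF *(2)] forms_scale[OF *(3)] by auto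
qed

text \<open>Multiplication by \<open>\<Sum>v\<in>A. w v c(v)\<^sup>s x\<^sub>v\<close>. The weights \<open>w\<close> are needed only because eliminating a
  variable \<open>p\<close> multiplies them by \<open>c v - c p\<close>.\<close>

definition vform :: "'v set \<Rightarrow> ('v \<Rightarrow> 'k::field) \<Rightarrow> ('v \<Rightarrow> 'k) \<Rightarrow> nat \<Rightarrow> ('v multiset \<Rightarrow> 'k) \<Rightarrow> 'v multiset \<Rightarrow> 'k"
  where "vform A w c s = lin_mult A (\<lambda>v. w v * c v ^ s)"

lemma vform_Suc:
  "vform A w c (Suc s) x = (\<lambda>b. c0 * vform A w c s x b) + vform A (\<lambda>v. w v * (c v - c0)) c s x"
proof -
  have "(\<lambda>v. w v * c v ^ Suc s) = (\<lambda>v. c0 * (w v * c v ^ s) + w v * (c v - c0) * c v ^ s)"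
    by (auto simp: algebra_simps)
  then show ?thesis
    by (simp add: vform_def lin_mult_add_weight lin_mult_scale_weight)
qed

lemmas vform_facts =
  lin_mult_add[of A "\<lambda>v. w v * c v ^ s" for A w c s, folded vform_def]
  lin_mult_forms[of _ A _ "\<lambda>v. w v * c v ^ s" for A w c s, folded vform_def]
  opsum_forms_subgroup[of A "\<lambda>s v. w v * c v ^ s" for A w c, folded vform_def]
  opsum_forms_scale[of _ A "\<lambda>s v. w v * c v ^ s" for A w c, folded vform_def]
  opsum_subset_forms[of A "\<lambda>s v. w v * c v ^ s" for A w c, folded vform_def]

lemma vform_zero: "vform A w c s 0 = 0"
  by (rule additive_diff(1)[of "vform A w c s", OF vform_facts(1)])

lemma vform_diff: "vform A w c s (x - y) = vform A w c s x - vform A w c s y"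
  by (rule additive_diff(2)[of "vform A w c s", OF vform_facts(1)])

text \<open>Replacing each form by its combination with the previous one that no longer involves a
  chosen variable changes no ideal.\<close>

lemma opsum_vform_Suc:
  fixes c0 :: "'k::field" and A :: "'v set" and w c :: "'v \<Rightarrow> 'k"
  defines "\<theta> \<equiv> vform A w c" and "\<psi> \<equiv> vform A (\<lambda>v. w v * (c v - c0)) c"
  shows "opsum \<theta> (forms A d) (Suc r) = {\<theta> 0 g + a | g a. g \<in> forms A d \<and> a \<in> opsum \<psi> (forms A d) r}"
proof (induction r)
  case 0
  show ?case by simp
next
  case (Suc r)
  let ?X = "forms A d"
  have sub: "add_subgroup (opsum \<theta> ?X s)" for s
    unfolding \<theta>_def by (rule vform_facts(3))
  have cr: "(\<lambda>b. c0 * \<theta> r g b) \<in> opsum \<theta> ?X (Suc r)" if "g \<in> ?X" for g c0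
  proof -
    have "(\<lambda>b. c0 * \<theta> r g b) = 0 + \<theta> r (\<lambda>b. c0 * g b)"
      by (simp add: \<theta>_def vform_def lin_mult_scale)
    then show ?thesis
      by (simp only: opsum_SucI[OF add_subgroup_closed(1)[OF sub] forms_scale[OF that]])
  qed
  have step: "\<theta> (Suc r) g = (\<lambda>b. c0 * \<theta> r g b) + \<psi> r g" for g
    unfolding \<theta>_def \<psi>_def by (rule vform_Suc)
  show ?case
  proof (intro set_eqI iffI)
    fix x assume "x \<in> opsum \<theta> ?X (Suc (Suc r))"
    then obtain a g where x: "x = a + \<theta> (Suc r) g" "a \<in> opsum \<theta> ?X (Suc r)" "g \<in> ?X"
      by (rule opsum_SucE)
    have "a + (\<lambda>b. c0 * \<theta> r g b) \<in> opsum \<theta> ?X (Suc r)"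
      by (rule add_subgroup_closed(4)[OF sub x(2) cr[OF x(3)]])
    then obtain h b where hb: "a + (\<lambda>b. c0 * \<theta> r g b) = \<theta> 0 h + b" "h \<in> ?X" "b \<in> opsum \<psi> ?X r"
      unfolding Suc mem_Collect_eq by (elim exE conjE)
    have "x = (a + (\<lambda>b. c0 * \<theta> r g b)) + \<psi> r g" by (simp only: x step add.assoc)
    also have "\<dots> = \<theta> 0 h + (b + \<psi> r g)" by (simp only: hb add.assoc)
    finally show "x \<in> {\<theta> 0 g + a | g a. g \<in> ?X \<and> a \<in> opsum \<psi> ?X (Suc r)}"
      using hb(2) opsum_SucI[OF hb(3) x(3)] by blast
  next
    fix x assume "x \<in> {\<theta> 0 g + a | g a. g \<in> ?X \<and> a \<in> opsum \<psi> ?X (Suc r)}"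
    then obtain h a where x: "x = \<theta> 0 h + a" "h \<in> ?X" "a \<in> opsum \<psi> ?X (Suc r)" by blast
    from x(3) obtain b g where b: "a = b + \<psi> r g" "b \<in> opsum \<psi> ?X r" "g \<in> ?X"
      by (rule opsum_SucE)
    have "\<theta> 0 h + b \<in> opsum \<theta> ?X (Suc r)"
      unfolding Suc mem_Collect_eq by (intro exI[of _ h] exI[of _ b] conjI refl x(2) b(2))
    then have "\<theta> 0 h + b - (\<lambda>b. c0 * \<theta> r g b) \<in> opsum \<theta> ?X (Suc r)"
      by (rule add_subgroup_closed(2)[OF sub _ cr[OF b(3)]])
    moreover have "x = (\<theta> 0 h + b - (\<lambda>b. c0 * \<theta> r g b)) + \<theta> (Suc r) g"
      by (simp only: x b step) (simp only: algebra_simps)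
    ultimately show "x \<in> opsum \<theta> ?X (Suc (Suc r))"
      by (simp only: opsum_SucI[OF _ b(3)])
  qed
qed

lemma vform_restrict:
  assumes "p \<notin> A" "w p = 0" "m \<in> forms A d"
  shows "vform (insert p A) w c s m = vform A w c s m"
proof
  fix b
  show "vform (insert p A) w c s m b = vform A w c s m b"
  proof (cases "p \<in># b")
    case True
    have "w v * c v ^ s * m (b - {#v#}) = 0" if "v \<in># b" for v
    proof (cases "v = p")
      case False
      then have "p \<in># b - {#v#}" using True by (simp add: in_diff_count)
      then have "m (b - {#v#}) = 0" using assms formsD[OF assms(3)] by blast
      then show ?thesis by simp
    qed (use assms in simp)
    then have z: "(\<Sum>v\<in>set_mset b. w v * c v ^ s * m (b - {#v#})) = 0"
      by (intro sum.neutral) blast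
    have "\<not> set_mset b \<subseteq> A" using True assms by auto
    with z show ?thesis by (simp add: vform_def lin_mult_def)
  next
    case False
    then have "set_mset b \<subseteq> insert p A \<longleftrightarrow> set_mset b \<subseteq> A" by auto
    then show ?thesis by (simp add: vform_def lin_mult_def)
  qed
qed

lemma opsum_restrict:
  assumes "\<And>s x. x \<in> X \<Longrightarrow> \<theta> s x = \<theta>' s x"
  shows "opsum \<theta> X r = opsum \<theta>' X r"
proof (induction r)
  case (Suc r)
  have "(\<exists>a g. x = a + \<theta> r g \<and> a \<in> opsum \<theta>' X r \<and> g \<in> X) \<longleftrightarrow>
      (\<exists>a g. x = a + \<theta>' r g \<and> a \<in> opsum \<theta>' X r \<and> g \<in> X)" for x
    using assms by metis
  then show ?case by (simp only: opsum.simps Suc)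
qed simp

text \<open>Independence of the forms would be a Vandermonde determinant; regularity is obtained by
  elimination instead. Modulo form 0 the polynomial ring on \<open>insert p A\<close> becomes the
  one on \<open>A\<close>, and the forms 1, 2, ... become the forms 0, 1, ... with weights
  \<open>w v * (c v - c p)\<close>, which are nonzero as \<open>c\<close> is injective. The
  induction lowers \<open>A\<close> and \<open>r\<close> together.\<close>

theorem vform_regular:
  assumes "finite A" "\<And>v. v \<in> A \<Longrightarrow> w v \<noteq> 0" "inj_on c A" "r < card A"
    "m \<in> forms A d" "vform A w c r m \<in> opsum (vform A w c) (forms A d) r"
  shows "m \<in> opsum (vform A w c) (forms A (d - 1)) r"
  using assms
proof (induction A arbitrary: w r m d rule: finite_induct)
  case empty
  then show ?case by simp
next
  case (insert p A)
  let ?A = "insert p A"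
  have wp: "w p \<noteq> 0" using insert.prems by simp
  have p0: "p \<notin> A" "w p * c p ^ 0 \<noteq> 0" using insert.hyps wp by auto
  note elim = eliminate_exists[where w = "\<lambda>v. w v * c v ^ 0", OF p0, folded vform_def] eliminate_unique[where w = "\<lambda>v. w v * c v ^ 0", OF p0, folded vform_def]
  show ?case
  proof (cases r)
    case 0
    then have "vform ?A w c 0 m = 0" using insert.prems by simp
    then have "m = 0"
      using elim(2)[of m d 0] insert.prems(4) add_subgroup_closed(1)[OF forms_subgroup]
      by (auto simp: vform_def)
    then show ?thesis using 0 by (simp add: zero_fun_def)
  next
    case (Suc r')
    define w' where "w' = (\<lambda>v. w v * (c v - c p))"
    let ?\<theta> = "vform ?A w c" and ?\<psi> = "vform ?A w' c"
    note eqS = opsum_vform_Suc[of ?A w c _ _ "c p", folded w'_def]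
    have \<psi>A: "vform ?A w' c s x = vform A w' c s x" if "x \<in> forms A d" for s x d
      by (rule vform_restrict[OF insert.hyps(2) _ that]) (simp add: w'_def)
    have sub: "add_subgroup (opsum (vform B v c) (forms B e) s)" for B s v e
      by (rule vform_facts(3))
    have "?\<theta> r m \<in> opsum ?\<theta> (forms ?A d) (Suc r')"
      using insert.prems Suc by simp
    moreover have "(\<lambda>b. c p * ?\<theta> r' m b) \<in> opsum ?\<theta> (forms ?A d) (Suc r')"
    proof -
      have "(\<lambda>b. c p * ?\<theta> r' m b) = 0 + ?\<theta> r' (\<lambda>b. c p * m b)"
        by (simp add: vform_def lin_mult_scale)
      then show ?thesis
        by (simp only: opsum_SucI[OF add_subgroup_closed(1)[OF sub] forms_scale[OF insert.prems(4)]])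
    qed
    ultimately have "?\<theta> r m - (\<lambda>b. c p * ?\<theta> r' m b) \<in> opsum ?\<theta> (forms ?A d) (Suc r')"
      by (rule add_subgroup_closed(2)[OF sub])
    also have "?\<theta> r m - (\<lambda>b. c p * ?\<theta> r' m b) = ?\<psi> r' m"
      using vform_Suc[of ?A w c r' m "c p"] Suc by (simp add: w'_def)
    finally obtain g a where ga: "?\<psi> r' m = ?\<theta> 0 g + a" "g \<in> forms ?A d"
      "a \<in> opsum ?\<psi> (forms ?A d) r'"
      by (auto simp only: eqS)
    \<comment> \<open>Eliminating \<open>p\<close> from each coefficient by form 0 leaves
      coefficients on \<open>A\<close>; the multiples of form 0 can be collected because
      multiplications commute.\<close>
    have dec: "\<exists>g. g \<in> forms ?A d \<and> (\<exists>e \<in> opsum ?\<psi> (forms A d) s. a = ?\<theta> 0 g + e)"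
      if "a \<in> opsum ?\<psi> (forms ?A d) s" for s a d
      using that
    proof (induction s arbitrary: a)
      case 0
      then have "a = ?\<theta> 0 0 + 0"
        by (simp add: vform_zero)
      then show ?case using add_subgroup_closed(1)[OF forms_subgroup] by auto
    next
      case (Suc s)
      then obtain b h where bh: "a = b + ?\<psi> s h" "b \<in> opsum ?\<psi> (forms ?A d) s" "h \<in> forms ?A d"
        by auto
      from Suc.IH[OF bh(2)] obtain g e where
        ge: "g \<in> forms ?A d" "e \<in> opsum ?\<psi> (forms A d) s" "b = ?\<theta> 0 g + e" by blast
      from elim(1)[OF bh(3)] obtain q f where
        qf: "q \<in> forms ?A (d - 1)" "f \<in> forms A d" "h = ?\<theta> 0 q + f"
        by blast
      have "a = ?\<theta> 0 (g + ?\<psi> s q) + (e + ?\<psi> s f)"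
        using lin_mult_comm[of ?A _ _ q]
        by (simp only: bh(1) ge(3) qf(3) vform_facts(1)) (simp add: vform_def algebra_simps)
      moreover have "g + ?\<psi> s q \<in> forms ?A d"
        by (intro add_subgroup_closed(4)[OF forms_subgroup] ge(1))
          (use vform_facts(2)[OF qf(1)] in \<open>simp only: diff_add_cancel\<close>)
      moreover have "e + ?\<psi> s f \<in> opsum ?\<psi> (forms A d) (Suc s)"
        by (rule opsum_SucI[OF ge(2) qf(2)])
      ultimately show ?case by blast
    qed
    from dec[OF ga(3)] obtain g' e where
      ge: "g' \<in> forms ?A d" "e \<in> opsum ?\<psi> (forms A d) r'" "a = ?\<theta> 0 g' + e" by blast
    from elim(1)[OF insert.prems(4)] obtain q f where
      qf: "q \<in> forms ?A (d - 1)" "f \<in> forms A d" "m = ?\<theta> 0 q + f"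
      by blast
    define G where "G = g + g' - ?\<psi> r' q"
    have G: "G \<in> forms ?A d"
      unfolding G_def
      by (intro add_subgroup_closed(2,4)[OF forms_subgroup] ga(2) ge(1))
        (use vform_facts(2)[OF qf(1)] in \<open>simp only: diff_add_cancel\<close>)
    have "?\<theta> 0 (?\<psi> r' q) = ?\<psi> r' (?\<theta> 0 q)"
      by (simp add: vform_def lin_mult_comm)
    then have eq: "?\<psi> r' f = ?\<theta> 0 G + e"
      using ga(1) unfolding G_def ge(3) qf(3)
      by (simp only: vform_facts(1) vform_diff) (simp only: algebra_simps)
    have opA: "opsum ?\<psi> (forms A d) s = opsum (vform A w' c) (forms A d) s" for d s
      by (rule opsum_restrict) (rule \<psi>A)
    have "e \<in> forms A (d + 1)"
      using ge(2) vform_facts(5)[of A w' c "d + 1" r'] by (auto simp only: opA add_diff_cancel_right')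
    moreover have "?\<psi> r' f \<in> forms A (d + 1)"
      unfolding \<psi>A[OF qf(2)] by (rule vform_facts(2)[OF qf(2)])
    ultimately have "?\<theta> 0 G \<in> forms A (d + 1)"
      using add_subgroup_closed(2)[OF forms_subgroup] eq by (metis add_diff_cancel_right')
    \<comment> \<open>By \<open>eq\<close>, the multiple of form 0 is a difference of elements free
      of \<open>p\<close>, and a nonzero multiple of form 0 involves \<open>p\<close>.\<close>
    then have "G = 0" by (rule elim(2)[OF G])
    then have "vform A w' c r' f \<in> opsum (vform A w' c) (forms A d) r'"
      using eq ge(2) by (simp only: opA vform_zero add_0_left \<psi>A[OF qf(2)])
    moreover have w': "w' v \<noteq> 0" if "v \<in> A" for v
      using insert.prems insert.hyps that by (auto simp: w'_def inj_on_def)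
    ultimately have "f \<in> opsum (vform A w' c) (forms A (d - 1)) r'"
      by (intro insert.IH[OF w' _ _ qf(2)]) (use insert.prems insert.hyps Suc in auto)
    then have "f \<in> opsum ?\<psi> (forms ?A (d - 1)) r'"
      unfolding opA[symmetric] by (rule subsetD[OF opsum_mono[OF forms_mono[OF subset_insertI]]])
    with qf(1,3) show ?thesis
      unfolding Suc eqS mem_Collect_eq by (intro exI[of _ q] exI[of _ f] conjI)
  qed
qed

section \<open>Dimensions of spaces of functions\<close>

locale vect = vector_space scale for scale :: "'k::field \<Rightarrow> 'b::ab_group_add \<Rightarrow> 'b"
begin

text \<open>The ambient space of all families of forms is infinite-dimensional, so finiteness is
  recorded for each subset; without it \<open>dim\<close> need not be monotone.\<close>

definition fin_dim :: "'b set \<Rightarrow> bool" where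
  "fin_dim V \<longleftrightarrow> (\<exists>B. finite B \<and> V \<subseteq> span B)"

lemma fin_dim_subset: "fin_dim V \<Longrightarrow> U \<subseteq> V \<Longrightarrow> fin_dim U"
  by (auto simp: fin_dim_def)

lemma fin_dim_basis:
  assumes "fin_dim V" "S \<subseteq> V" "independent S"
  obtains B where "S \<subseteq> B" "B \<subseteq> V" "independent B" "V \<subseteq> span B" "finite B" "card B = dim V"
proof -
  obtain B where B: "S \<subseteq> B" "B \<subseteq> V" "independent B" "V \<subseteq> span B"
    using maximal_independent_subset_extend[OF assms(2,3)] by blast
  obtain F where "finite F" "V \<subseteq> span F" using assms(1) by (auto simp: fin_dim_def)
  then have "finite B" using independent_span_bound[of F B] B by auto
  moreover have "card B = dim V" using basis_card_eq_dim B by blast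
  ultimately show ?thesis using B that by blast
qed

lemma dim_mono_fin:
  assumes "fin_dim V" "U \<subseteq> V"
  shows "dim U \<le> dim V"
proof -
  obtain B where B: "B \<subseteq> U" "independent B" "card B = dim U"
    by (rule fin_dim_basis[OF fin_dim_subset[OF assms], of "{}"]) (auto simp: independent_empty)
  have "B \<subseteq> V" using B assms by blast
  then obtain B' where "B \<subseteq> B'" "finite B'" "card B' = dim V"
    by (rule fin_dim_basis[OF assms(1) _ B(2)])
  then show ?thesis using B card_mono by metis
qed

text \<open>\<open>T\<close> is injective on \<open>span C\<close> modulo \<open>W\<close>: a vector
  of \<open>span (BK \<union> C)\<close> sent into \<open>W\<close> lies in \<open>span BK\<close>,
  which meets \<open>span C\<close> only in 0. Hence the images of \<open>C\<close> can be adjoined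
  to the basis of \<open>W\<close> one by one.\<close>

lemma linear_image_add_span_bases:
  assumes lin: "Vector_Spaces.linear scale scale T" and W: "subspace W" "BW \<subseteq> W" "independent BW" "finite BW"
    and K: "\<And>u. u \<in> span (BK \<union> C) \<Longrightarrow> T u \<in> W \<Longrightarrow> u \<in> span BK"
    and C: "finite C" "independent (BK \<union> C)" "BK \<inter> C = {}"
  shows "independent (BW \<union> T ` C) \<and> card (BW \<union> T ` C) = card BW + card C"
  using C K
proof (induction C rule: finite_induct)
  case empty
  then show ?case using W by simp
next
  case (insert c C)
  interpret T: Vector_Spaces.linear scale scale T by (rule lin)
  have IH: "independent (BW \<union> T ` C) \<and> card (BW \<union> T ` C) = card BW + card C"
  proof (rule insert.IH)
    show "independent (BK \<union> C)"
      by (rule independent_mono[OF insert.prems(1)]) auto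
    show "\<And>u. u \<in> span (BK \<union> C) \<Longrightarrow> T u \<in> W \<Longrightarrow> u \<in> span BK"
      using insert.prems(3) span_mono[of "BK \<union> C" "BK \<union> insert c C"] by blast
  qed (use insert.prems in auto)
  have "T c \<notin> span (BW \<union> T ` C)"
  proof
    assume "T c \<in> span (BW \<union> T ` C)"
    then obtain x y where xy: "T c = x + y" "x \<in> span BW" "y \<in> span (T ` C)"
      by (auto simp: span_Un)
    then obtain u where u: "u \<in> span C" "y = T u" by (auto simp: T.span_image)
    have x: "x \<in> W" using xy(2) W span_minimal by blast
    have "T (c - u) \<in> W" using xy(1) u(2) x by (simp add: T.diff)
    moreover have "c - u \<in> span (BK \<union> insert c C)"
      using u(1) span_mono[of C "BK \<union> insert c C"] by (intro span_diff span_base[of c]) blast+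
    ultimately have "c - u \<in> span BK" by (intro insert.prems(3))
    then have "c - u + u \<in> span (BK \<union> C)"
      using u(1) span_mono[of C "BK \<union> C"] span_mono[of BK "BK \<union> C"] by (intro span_add) blast+
    then have "c \<in> span (BK \<union> C)" by simp
    moreover have "c \<notin> BK \<union> C" using insert.hyps insert.prems(2) by auto
    moreover have "independent (insert c (BK \<union> C))" using insert.prems(1) by simp
    ultimately show False by (simp add: independent_insert)
  qed
  then show ?case
    using IH insert.hyps W(4) span_base[of "T c" "BW \<union> T ` C"]
    by (auto simp: independent_insert)
qed

text \<open>Rank-nullity for the map from \<open>U\<close> to the quotient by \<open>W\<close>,
  stated without quotient spaces. It later gives the effect of one more regular element on a Hilbert
  function.\<close>

lemma dim_image_add:
  assumes lin: "Vector_Spaces.linear scale scale T" and U: "subspace U" "fin_dim U" and W: "subspace W" "fin_dim W"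
  shows "dim {T u + w | u w. u \<in> U \<and> w \<in> W} + dim {u \<in> U. T u \<in> W} = dim U + dim W"
proof -
  interpret T: Vector_Spaces.linear scale scale T by (rule lin)
  define K where "K = {u \<in> U. T u \<in> W}"
  have "K \<subseteq> U" by (auto simp: K_def)
  have K: "subspace K"
    using U(1) W(1) by (auto simp: subspace_def K_def T.add T.scale)
  obtain BK where BK: "BK \<subseteq> K" "independent BK" "K \<subseteq> span BK" "card BK = dim K"
    by (rule fin_dim_basis[OF fin_dim_subset[OF U(2) \<open>K \<subseteq> U\<close>], of "{}"]) (auto simp: independent_empty)
  have "BK \<subseteq> U" using BK \<open>K \<subseteq> U\<close> by blast
  then obtain BU where BU: "BK \<subseteq> BU" "BU \<subseteq> U" "independent BU" "U \<subseteq> span BU" "finite BU"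
    "card BU = dim U"
    by (rule fin_dim_basis[OF U(2) _ BK(2)])
  obtain BW where BW: "BW \<subseteq> W" "independent BW" "W \<subseteq> span BW" "finite BW" "card BW = dim W"
    by (rule fin_dim_basis[OF W(2), of "{}"]) (auto simp: independent_empty)
  define C where "C = BU - BK"
  have un: "BK \<union> C = BU" using BU by (auto simp: C_def)
  have main: "independent (BW \<union> T ` C) \<and> card (BW \<union> T ` C) = card BW + card C"
  proof (rule linear_image_add_span_bases[OF lin W(1) BW(1,2,4)])
    show "u \<in> span BK" if "u \<in> span (BK \<union> C)" "T u \<in> W" for u
    proof -
      have "u \<in> U" using that(1) span_minimal[OF BU(2) U(1)] by (auto simp: un)
      then show ?thesis using that(2) BK(3) by (auto simp: K_def)
    qed
  qed (use BU in \<open>auto simp: un, auto simp: C_def\<close>)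
  let ?S = "{T u + w | u w. u \<in> U \<and> w \<in> W}"
  have "card (BW \<union> T ` C) = dim ?S"
  proof (rule basis_card_eq_dim)
    show "BW \<union> T ` C \<subseteq> ?S"
    proof
      fix x assume "x \<in> BW \<union> T ` C"
      then consider "x \<in> W" | u where "u \<in> U" "x = T u" using BW(1) BU(2) by (auto simp: C_def)
      then show "x \<in> ?S"
      proof cases
        case 1
        moreover have "x = T 0 + x" by (simp add: T.zero)
        ultimately show ?thesis using subspace_0[OF U(1)] by blast
      next
        case 2
        moreover have "x = T u + 0" using 2 by simp
        ultimately show ?thesis using subspace_0[OF W(1)] by blast
      qed
    qed
    show "?S \<subseteq> span (BW \<union> T ` C)"
    proof
      fix x assume "x \<in> ?S"
      then obtain u w where x: "x = T u + w" "u \<in> U" "w \<in> W" by auto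
      have "u \<in> span (BK \<union> C)" using x BU by (auto simp: un)
      then obtain a b where ab: "u = a + b" "a \<in> span BK" "b \<in> span C" by (auto simp: span_Un)
      have "a \<in> K" using ab(2) span_minimal[OF BK(1) K] by auto
      then have "T a + w \<in> W" using x W(1) by (auto simp: K_def subspace_add)
      then have "T a + w \<in> span (BW \<union> T ` C)"
        using BW(3) span_mono[of BW "BW \<union> T ` C"] by blast
      moreover have "T b \<in> span (BW \<union> T ` C)"
        using ab(3) span_mono[of "T ` C" "BW \<union> T ` C"] by (auto simp: T.span_image)
      ultimately have "(T a + w) + T b \<in> span (BW \<union> T ` C)" by (rule span_add)
      then show "x \<in> span (BW \<union> T ` C)" by (simp add: x ab T.add algebra_simps)
    qed
  qed (use main in auto)
  moreover have "card BU = card BK + card C"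
    using BU(1,5) by (simp add: C_def card_Diff_subset finite_subset card_mono)
  ultimately show ?thesis
    using main BK BU BW by (simp add: K_def)
qed

lemma dim_kernel_image:
  assumes "Vector_Spaces.linear scale scale T" "subspace U" "fin_dim U"
  shows "dim (T ` U) + dim {u \<in> U. T u = 0} = dim U"
proof -
  have "{T u + w | u w. u \<in> U \<and> w \<in> {0}} = T ` U" by auto
  moreover have "fin_dim {0}" "subspace {0}" by (auto simp: fin_dim_def intro!: exI[of _ "{}"])
  moreover have "dim {0} = 0" using dim_le_card[of "{0}" "{}"] by simp
  ultimately show ?thesis
    using dim_image_add[OF assms, of "{0}"] by simp
qed

end

definition fscale :: "'k::field \<Rightarrow> ('x \<Rightarrow> 'y \<Rightarrow> 'k) \<Rightarrow> 'x \<Rightarrow> 'y \<Rightarrow> 'k" where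
  "fscale c f = (\<lambda>x y. c * f x y)"

interpretation fv: vect fscale
  by unfold_locales (auto simp: fscale_def fun_eq_iff algebra_simps)

definition supported :: "('x \<times> 'y) set \<Rightarrow> ('x \<Rightarrow> 'y \<Rightarrow> 'k::field) set" where
  "supported S = {f. \<forall>x y. f x y \<noteq> 0 \<longrightarrow> (x, y) \<in> S}"

lemma supported_subspace: "fv.subspace (supported S)"
  by (auto simp: fv.subspace_def supported_def fscale_def) (metis add.right_neutral)

lemma supported_dim:
  assumes "finite S"
  shows "fv.fin_dim (supported S :: ('x \<Rightarrow> 'y \<Rightarrow> 'k::field) set) \<and>
    fv.dim (supported S :: ('x \<Rightarrow> 'y \<Rightarrow> 'k) set) = card S"
proof -
  define e :: "'x \<times> 'y \<Rightarrow> 'x \<Rightarrow> 'y \<Rightarrow> 'k" where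
    "e = (\<lambda>s x y. if s = (x, y) then 1 else 0)"
  have inj: "inj e"
  proof (rule injI)
    fix s t assume "e s = e t"
    then have "e s (fst s) (snd s) = e t (fst s) (snd s)" by simp
    then show "s = t" by (auto simp: e_def split: if_splits)
  qed
  have span: "supported S \<subseteq> fv.span (e ` S)"
  proof
    fix f :: "'x \<Rightarrow> 'y \<Rightarrow> 'k" assume f: "f \<in> supported S"
    have "(\<Sum>s\<in>S. fscale (f (fst s) (snd s)) (e s)) \<in> fv.span (e ` S)"
      by (intro fv.span_sum fv.span_scale fv.span_base) auto
    moreover have "(\<Sum>s\<in>S. fscale (f (fst s) (snd s)) (e s)) = f"
    proof (intro ext)
      fix x y
      have ap: "(\<Sum>s\<in>R. g s) x y = (\<Sum>s\<in>R. g s x y)" for R :: "('x \<times> 'y) set" and g :: "_ \<Rightarrow> 'x \<Rightarrow> 'y \<Rightarrow> 'k"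
        by (induction R rule: infinite_finite_induct) auto
      have "(\<Sum>s\<in>S. fscale (f (fst s) (snd s)) (e s)) x y
          = (\<Sum>s\<in>S. if s = (x, y) then f x y else 0)"
        unfolding ap by (intro sum.cong) (auto simp: fscale_def e_def)
      also have "\<dots> = f x y" using f assms by (auto simp: supported_def)
      finally show "(\<Sum>s\<in>S. fscale (f (fst s) (snd s)) (e s)) x y = f x y" .
    qed
    ultimately show "f \<in> fv.span (e ` S)" by simp
  qed
  have sub: "e ` S \<subseteq> supported S" by (auto simp: e_def supported_def split: if_splits)
  have indep: "fv.independent (e ` S)"
  proof (subst fv.dependent_def, safe)
    fix s assume s: "s \<in> S" "e s \<in> fv.span (e ` S - {e s})"
    have "e ` S - {e s} \<subseteq> supported (S - {s})"
      by (auto simp: e_def supported_def split: if_splits)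
    then have "fv.span (e ` S - {e s}) \<subseteq> supported (S - {s})"
      by (rule fv.span_minimal[OF _ supported_subspace])
    then have "e s \<in> supported (S - {s})" using s by blast
    then have "e s (fst s) (snd s) \<noteq> 0 \<longrightarrow> (fst s, snd s) \<in> S - {s}"
      unfolding supported_def by blast
    then show False by (simp add: e_def)
  qed
  have "card (e ` S) = fv.dim (supported S :: ('x \<Rightarrow> 'y \<Rightarrow> 'k) set)"
    by (rule fv.basis_card_eq_dim[OF sub span indep])
  moreover have "card (e ` S) = card S" by (intro card_image inj_on_subset[OF inj]) auto
  moreover have "fv.fin_dim (supported S :: ('x \<Rightarrow> 'y \<Rightarrow> 'k) set)"
    unfolding fv.fin_dim_def using span assms by blast
  ultimately show ?thesis by simp
qed

section \<open>The face ring complex of a simplicial poset\<close>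

definition below_sign :: "nat set \<Rightarrow> nat \<Rightarrow> 'k::field" where
  "below_sign S v = (- 1) ^ card {u \<in> S. u < v}"

lemma below_sign_insert:
  assumes "finite S" "u \<notin> S"
  shows "below_sign (insert u S) v = (if u < v then - below_sign S v else below_sign S v)"
proof -
  have "{w \<in> insert u S. w < v} = (if u < v then insert u {w \<in> S. w < v} else {w \<in> S. w < v})"
    by auto
  then show ?thesis using assms by (simp add: below_sign_def)
qed

lemma below_sign_square [simp]: "below_sign S v * below_sign S v = 1"
  by (simp add: below_sign_def flip: power_mult_distrib)

text \<open>A simplicial poset whose vertices carry distinct numbers: \<open>N y\<close> is the vertex set of the face \<open>y\<close>,
  so the rank of \<open>y\<close> is \<open>card (N y)\<close>. Different faces may have the same vertices.\<close>

locale labelled_poset =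
  fixes P :: "'a set" and le :: "'a \<Rightarrow> 'a \<Rightarrow> bool" (infix \<open>\<sqsubseteq>\<close> 50) and N :: "'a \<Rightarrow> nat set"
  assumes finite_P: "finite P"
    and le_refl: "x \<in> P \<Longrightarrow> x \<sqsubseteq> x"
    and le_antisym: "x \<in> P \<Longrightarrow> y \<in> P \<Longrightarrow> x \<sqsubseteq> y \<Longrightarrow> y \<sqsubseteq> x \<Longrightarrow> x = y"
    and le_trans: "x \<in> P \<Longrightarrow> y \<in> P \<Longrightarrow> z \<in> P \<Longrightarrow> x \<sqsubseteq> y \<Longrightarrow> y \<sqsubseteq> z \<Longrightarrow> x \<sqsubseteq> z"
    and finite_N: "y \<in> P \<Longrightarrow> finite (N y)"
    and N_mono: "x \<in> P \<Longrightarrow> y \<in> P \<Longrightarrow> x \<sqsubseteq> y \<Longrightarrow> N x \<subseteq> N y"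
    and face_ex1: "y \<in> P \<Longrightarrow> S \<subseteq> N y \<Longrightarrow> \<exists>!x. x \<in> P \<and> x \<sqsubseteq> y \<and> N x = S"
begin

definition face :: "'a \<Rightarrow> nat set \<Rightarrow> 'a" where
  "face y S = (THE x. x \<in> P \<and> x \<sqsubseteq> y \<and> N x = S)"

lemma face:
  assumes "y \<in> P" "S \<subseteq> N y"
  shows "face y S \<in> P" "face y S \<sqsubseteq> y" "N (face y S) = S"
  using theI'[OF face_ex1[OF assms]] by (auto simp: face_def)

lemma face_unique: "y \<in> P \<Longrightarrow> x \<in> P \<Longrightarrow> x \<sqsubseteq> y \<Longrightarrow> face y (N x) = x"
  using face_ex1[of y "N x"] face[of y "N x"] N_mono[of x y] by blast

lemma face_face: "y \<in> P \<Longrightarrow> x \<in> P \<Longrightarrow> x \<sqsubseteq> y \<Longrightarrow> S \<subseteq> N x \<Longrightarrow> face y S = face x S"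
  using face_unique[of y "face x S"] face[of x S] le_trans[of "face x S" x y] by auto

text \<open>The interval below the common upper bound \<open>y\<close> is Boolean, so the order on
  it can be read off the labels. Without such a \<open>y\<close> even equal labels do not identify a
  face.\<close>

lemma le_of_labels:
  assumes "x \<in> P" "x' \<in> P" "y \<in> P" "x \<sqsubseteq> y" "x' \<sqsubseteq> y" "N x \<subseteq> N x'"
  shows "x \<sqsubseteq> x'"
proof -
  have "face x' (N x) = x"
    using face_face[OF assms(3,2,5,6)] face_unique[OF assms(3,1,4)] by simp
  then show ?thesis using face(2)[OF assms(2,6)] by simp
qed

lemma eq_of_labels: "x \<in> P \<Longrightarrow> y \<in> P \<Longrightarrow> x \<sqsubseteq> y \<Longrightarrow> N x = N y \<Longrightarrow> x = y"
  by (metis face_unique le_refl)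

lemma eq_of_card: "x \<in> P \<Longrightarrow> y \<in> P \<Longrightarrow> x \<sqsubseteq> y \<Longrightarrow> card (N y) \<le> card (N x) \<Longrightarrow> x = y"
  by (rule eq_of_labels) (simp_all add: N_mono card_seteq finite_N)

definition covers :: "'a \<Rightarrow> 'a set" where
  "covers x = {y \<in> P. x \<sqsubseteq> y \<and> card (N y) = Suc (card (N x))}"

lemma finite_covers [simp]: "finite (covers x)"
  using finite_P by (auto simp: covers_def)

lemma covers_label:
  assumes "x \<in> P" "y \<in> covers x"
  obtains v where "v \<notin> N x" "N y = insert v (N x)"
proof -
  have y: "y \<in> P" "x \<sqsubseteq> y" "card (N y) = Suc (card (N x))" using assms by (auto simp: covers_def)
  have sub: "N x \<subseteq> N y" using N_mono assms y by auto
  have "card (N y - N x) = 1"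
    using y sub finite_N[OF assms(1)] by (simp add: card_Diff_subset)
  then obtain v where "N y - N x = {v}" by (auto simp: card_1_singleton_iff)
  then show ?thesis using sub that[of v] by blast
qed

lemma covers_face:
  assumes "y \<in> P" "v \<notin> S" "insert v S = N y"
  shows "y \<in> covers (face y S)"
proof -
  have S: "S \<subseteq> N y" using assms(3) by blast
  then have "finite S" using finite_N[OF assms(1)] by (rule finite_subset)
  then have "card (N y) = Suc (card S)" using assms(2) by (simp flip: assms(3))
  then show ?thesis
    using face[OF assms(1) S] assms(1) by (simp add: covers_def)
qed

section \<open>Incidence numbers and the cellular boundary\<close>

definition incidence :: "'a \<Rightarrow> 'a \<Rightarrow> 'k::field" where
  "incidence y x = below_sign (N y) (the_elem (N y - N x))"

lemma incidence_eq:
  assumes "x \<in> P" "v \<notin> N x" "N y = insert v (N x)"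
  shows "incidence y x = below_sign (N x) v"
proof -
  have "N y - N x = {v}" using assms by auto
  then show ?thesis
    using below_sign_insert[OF finite_N[OF assms(1)] assms(2), of v] assms
    by (simp add: incidence_def)
qed

text \<open>The coefficient at \<open>x\<close> of the cellular boundary of the chain
  \<open>c\<close>, collected from the faces that have \<open>x\<close> as a facet.\<close>

definition cbd :: "('a \<Rightarrow> 'k::field) \<Rightarrow> 'a \<Rightarrow> 'k" where
  "cbd c x = (\<Sum>y\<in>covers x. incidence y x * c y)"

text \<open>The two faces between \<open>x\<close> and a face \<open>z\<close> with two more vertices contribute opposite signs.\<close>

lemma cbd_cbd:
  assumes x: "x \<in> P"
  shows "cbd (cbd c) x = (0::'k::field)"
proof -
  let ?I = "\<lambda>y x. incidence y x :: 'k"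
  have "cbd (cbd c) x = (\<Sum>y\<in>covers x. \<Sum>z\<in>covers y. ?I y x * ?I z y * c z)"
    by (simp add: cbd_def sum_distrib_left mult.assoc)
  also have "\<dots> = (\<Sum>y\<in>covers x. \<Sum>z\<in>P. if z \<in> covers y then ?I y x * ?I z y * c z else 0)"
    by (intro sum.cong refl sum.mono_neutral_cong_left) (auto simp: finite_P covers_def)
  also have "\<dots> = (\<Sum>z\<in>P. \<Sum>y\<in>covers x. if z \<in> covers y then ?I y x * ?I z y * c z else 0)"
    by (rule sum.swap)
  also have "\<dots> = (\<Sum>z\<in>P. 0)"
  proof (intro sum.cong refl)
    fix z assume z: "z \<in> P"
    let ?Y = "{y \<in> covers x. z \<in> covers y}"
    have eq: "(\<Sum>y\<in>covers x. if z \<in> covers y then ?I y x * ?I z y * c z else 0)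
      = (\<Sum>y\<in>?Y. ?I y x * ?I z y) * c z"
      by (auto simp: sum_distrib_right sum.inter_filter intro!: sum.cong)
    have "(\<Sum>y\<in>?Y. ?I y x * ?I z y) = 0"
    proof (cases "?Y = {}")
      case True
      then show ?thesis by (simp only: sum.empty)
    next
      case False
      then obtain y0 where y0: "y0 \<in> covers x" "z \<in> covers y0" by blast
      have y0P: "y0 \<in> P" "x \<sqsubseteq> y0" "y0 \<sqsubseteq> z" using y0 by (auto simp: covers_def)
      obtain u where u: "u \<notin> N x" "N y0 = insert u (N x)" by (rule covers_label[OF x y0(1)])
      obtain v where v: "v \<notin> N y0" "N z = insert v (N y0)" by (rule covers_label[OF y0P(1) y0(2)])
      have Nz: "N z = insert u (insert v (N x))" and uv: "u \<noteq> v" "v \<notin> N x" using u v by auto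
      have xz: "x \<sqsubseteq> z" using le_trans x y0P z by blast
      define f where "f = (\<lambda>w. face z (insert w (N x)))"
      have f: "f w \<in> covers x" "z \<in> covers (f w)" "N (f w) = insert w (N x)" "f w \<in> P"
        if "w \<in> {u, v}" for w
      proof -
        have sub: "insert w (N x) \<subseteq> N z" using that Nz by auto
        show N: "N (f w) = insert w (N x)" and P: "f w \<in> P"
          using face[OF z sub] by (auto simp: f_def)
        have "x \<sqsubseteq> f w"
          using face[OF z sub] by (intro le_of_labels[OF x P z xz]) (auto simp: f_def)
        then show "f w \<in> covers x"
          using P N that u uv finite_N[OF x] by (auto simp: covers_def)
        show "z \<in> covers (f w)"
          using face[OF z sub] N z Nz that u uv finite_N[OF x] by (auto simp: covers_def f_def)
      qed
      have "?Y = {f u, f v}"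
      proof (intro set_eqI iffI)
        fix y assume y: "y \<in> ?Y"
        then have yP: "y \<in> P" "y \<sqsubseteq> z" by (auto simp: covers_def)
        obtain w where w: "w \<notin> N x" "N y = insert w (N x)" using covers_label[OF x, of y] y by auto
        have "w \<in> {u, v}" using N_mono[OF yP(1) z yP(2)] w Nz by auto
        moreover have "y = f w" using face_unique[OF z yP] w by (simp add: f_def)
        ultimately show "y \<in> {f u, f v}" by auto
      next
        fix y assume "y \<in> {f u, f v}"
        then show "y \<in> ?Y" using f by auto
      qed
      moreover have "f u \<noteq> f v" using f(3)[of u] f(3)[of v] uv u by auto
      moreover have "?I (f u) x = below_sign (N x) u" "?I (f v) x = below_sign (N x) v"
        using incidence_eq[OF x] f(3) u uv by auto
      moreover have "?I z (f u) = below_sign (insert u (N x)) v" "?I z (f v) = below_sign (insert v (N x)) u"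
        using incidence_eq[OF f(4)[of u], of v z] incidence_eq[OF f(4)[of v], of u z]
          f(3)[of u] f(3)[of v] u uv Nz by auto
      moreover have "below_sign (N x) u * below_sign (insert u (N x)) v
          + below_sign (N x) v * (below_sign (insert v (N x)) u :: 'k) = 0"
        using below_sign_insert[OF finite_N[OF x] u(1), of v, where ?'a = 'k]
          below_sign_insert[OF finite_N[OF x] uv(2), of u, where ?'a = 'k] uv(1)
        by (cases "u < v") (auto simp: mult.commute)
      ultimately show ?thesis by simp
    qed
    then show "(\<Sum>y\<in>covers x. if z \<in> covers y then ?I y x * ?I z y * c z else 0) = 0"
      by (simp only: eq) simp
  qed
  finally show ?thesis by simp
qed

text \<open>Exactness, at the faces of rank \<open>p\<close>, of the cellular chain complex of the faces above \<open>z\<close>.\<close>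

definition cell_exact :: "'k::field itself \<Rightarrow> 'a \<Rightarrow> nat \<Rightarrow> bool" where
  "cell_exact k z p \<longleftrightarrow> (\<forall>c :: 'a \<Rightarrow> 'k.
     (\<forall>y. c y \<noteq> 0 \<longrightarrow> y \<in> P \<and> z \<sqsubseteq> y \<and> card (N y) = p) \<longrightarrow>
     (\<forall>x\<in>P. z \<sqsubseteq> x \<longrightarrow> cbd c x = 0) \<longrightarrow>
     (\<exists>b. (\<forall>y. b y \<noteq> 0 \<longrightarrow> y \<in> P \<and> z \<sqsubseteq> y \<and> card (N y) = Suc p) \<and>
       (\<forall>x\<in>P. z \<sqsubseteq> x \<longrightarrow> cbd b x = c x)))"

text \<open>Families of forms, one for each face of rank \<open>p\<close>, in the vertices of that face. For a fixed
  monomial \<open>a\<close> the complex of these families splits into the cellular complexes above the faces with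
  vertex set \<open>set_mset a\<close>.\<close>

definition rank_forms :: "nat \<Rightarrow> int \<Rightarrow> ('a \<Rightarrow> nat multiset \<Rightarrow> 'k::field) set" where
  "rank_forms p d = {f. \<forall>y. f y \<in> (if y \<in> P \<and> card (N y) = p then forms (N y) d else {0})}"

definition theta :: "(nat \<Rightarrow> 'k::field) \<Rightarrow> nat \<Rightarrow> ('a \<Rightarrow> nat multiset \<Rightarrow> 'k) \<Rightarrow> 'a \<Rightarrow> nat multiset \<Rightarrow> 'k" where
  "theta c s f y = vform (N y) (\<lambda>_. 1) c s (f y)"

text \<open>The condition on \<open>set_mset a\<close> is the restriction map between the polynomial
  rings of two faces: the vertex that is lost is set to 0.\<close>

definition bd :: "('a \<Rightarrow> nat multiset \<Rightarrow> 'k::field) \<Rightarrow> 'a \<Rightarrow> nat multiset \<Rightarrow> 'k" where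
  "bd f x a = (if x \<in> P \<and> set_mset a \<subseteq> N x then cbd (\<lambda>y. f y a) x else 0)"

lemma cbd_cong: "(\<And>y. y \<in> P \<Longrightarrow> x \<sqsubseteq> y \<Longrightarrow> c y = c' y) \<Longrightarrow> cbd c x = cbd c' x"
  by (auto simp: cbd_def covers_def intro!: sum.cong)

lemma covers_N_mono: "x \<in> P \<Longrightarrow> y \<in> covers x \<Longrightarrow> N x \<subseteq> N y"
  using N_mono by (auto simp: covers_def)

lemma rank_forms_subgroup: "add_subgroup (rank_forms p d)"
  using forms_subgroup by (auto simp: add_subgroup_def rank_forms_def)

text \<open>The module is a direct sum over faces on which every form acts componentwise, so
  coefficients chosen face by face assemble to one family.\<close>

lemma opsum_theta_iff:
  "x \<in> opsum (theta c) (rank_forms p d) r \<longleftrightarrow>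
     (\<forall>y. x y \<in> (if y \<in> P \<and> card (N y) = p then opsum (vform (N y) (\<lambda>_. 1) c) (forms (N y) d) r else {0}))"
proof (induction r arbitrary: x)
  case 0
  show ?case by (auto simp: fun_eq_iff)
next
  case (Suc r)
  let ?O = "\<lambda>y r. opsum (vform (N y) (\<lambda>_. 1) c) (forms (N y) d) r"
  show ?case
  proof
    assume "x \<in> opsum (theta c) (rank_forms p d) (Suc r)"
    then obtain a g where ag: "x = a + theta c r g" "a \<in> opsum (theta c) (rank_forms p d) r"
      "g \<in> rank_forms p d"
      by (rule opsum_SucE)
    show "\<forall>y. x y \<in> (if y \<in> P \<and> card (N y) = p then ?O y (Suc r) else {0})"
    proof
      fix y
      have "a y \<in> (if y \<in> P \<and> card (N y) = p then ?O y r else {0})"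
        using ag(2) unfolding Suc by blast
      moreover have "g y \<in> (if y \<in> P \<and> card (N y) = p then forms (N y) d else {0})"
        using ag(3) unfolding rank_forms_def by blast
      ultimately show "x y \<in> (if y \<in> P \<and> card (N y) = p then ?O y (Suc r) else {0})"
        by (auto simp: ag(1) theta_def vform_zero simp del: opsum.simps intro!: opsum_SucI)
    qed
  next
    assume x: "\<forall>y. x y \<in> (if y \<in> P \<and> card (N y) = p then ?O y (Suc r) else {0})"
    have "\<exists>a g. x y = a + vform (N y) (\<lambda>_. 1) c r g \<and>
        a \<in> (if y \<in> P \<and> card (N y) = p then ?O y r else {0}) \<and>
        g \<in> (if y \<in> P \<and> card (N y) = p then forms (N y) d else {0})" for y
    proof (cases "y \<in> P \<and> card (N y) = p")
      case True
      then have "x y \<in> ?O y (Suc r)" using x by metis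
      then obtain a g where "x y = a + vform (N y) (\<lambda>_. 1) c r g" "a \<in> ?O y r" "g \<in> forms (N y) d"
        by (rule opsum_SucE)
      then show ?thesis using True by auto
    next
      case False
      then have "x y = 0" using x by (metis singletonD)
      then show ?thesis using False by (auto simp: vform_zero)
    qed
    then obtain a g where ag: "\<And>y. x y = a y + vform (N y) (\<lambda>_. 1) c r (g y)"
      "\<And>y. a y \<in> (if y \<in> P \<and> card (N y) = p then ?O y r else {0})"
      "\<And>y. g y \<in> (if y \<in> P \<and> card (N y) = p then forms (N y) d else {0})"
      by metis
    have "a \<in> opsum (theta c) (rank_forms p d) r" unfolding Suc using ag(2) by blast
    moreover have "g \<in> rank_forms p d" unfolding rank_forms_def using ag(3) by blast
    moreover have "x = a + theta c r g" by (rule ext) (simp add: ag(1) theta_def)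
    ultimately show "x \<in> opsum (theta c) (rank_forms p d) (Suc r)"
      by (simp only: opsum_SucI)
  qed
qed

lemma regular_resolution_rank_forms:
  fixes c :: "nat \<Rightarrow> 'k::field"
  assumes c: "inj c"
    and exact: "\<And>z p. z \<in> P \<Longrightarrow> p < n \<Longrightarrow> cell_exact TYPE('k) z p"
  shows "regular_resolution (theta c) bd rank_forms n"
proof
  fix r s p :: nat and d :: int and x y :: "'a \<Rightarrow> nat multiset \<Rightarrow> 'k"
  show "theta c r (x + y) = theta c r x + theta c r y"
    by (simp add: fun_eq_iff theta_def vform_facts(1))
  show "theta c r (theta c s x) = theta c s (theta c r x)"
    by (simp add: fun_eq_iff theta_def vform_def lin_mult_comm)
  show "bd (x + y) = bd x + bd y"
    by (auto simp: fun_eq_iff bd_def cbd_def algebra_simps sum.distrib)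
  show "bd (theta c r x) = theta c r (bd x)"
  proof (intro ext)
    fix u a
    show "bd (theta c r x) u a = theta c r (bd x) u a"
    proof (cases "u \<in> P \<and> set_mset a \<subseteq> N u")
      case True
      have sub: "set_mset (a - {#v#}) \<subseteq> N u" for v
        using True by (meson in_diffD subset_eq)
      have cov: "set_mset a \<subseteq> N y" if "y \<in> covers u" for y
        using True covers_N_mono[of u y] that by blast
      have "bd (theta c r x) u a
          = (\<Sum>y\<in>covers u. incidence y u * (\<Sum>v\<in>set_mset a. c v ^ r * x y (a - {#v#})))"
        using True cov by (simp add: bd_def cbd_def theta_def vform_def lin_mult_def)
      also have "\<dots> = (\<Sum>v\<in>set_mset a. \<Sum>y\<in>covers u. incidence y u * (c v ^ r * x y (a - {#v#})))"
        by (simp add: sum_distrib_left) (rule sum.swap)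
      also have "\<dots> = theta c r (bd x) u a"
        using True sub
        by (simp add: bd_def cbd_def theta_def vform_def lin_mult_def sum_distrib_left mult_ac)
      finally show ?thesis .
    next
      case False
      then show ?thesis
        by (auto simp: bd_def theta_def vform_def lin_mult_def intro!: sum.neutral)
    qed
  qed
  show "add_subgroup (rank_forms p d)"
    by (rule rank_forms_subgroup)
  show "theta c r x \<in> rank_forms p (d + 1)" if "x \<in> rank_forms p d"
    unfolding rank_forms_def mem_Collect_eq
  proof
    fix y
    have "x y \<in> (if y \<in> P \<and> card (N y) = p then forms (N y) d else {0})"
      using that unfolding rank_forms_def by blast
    then show "theta c r x y \<in> (if y \<in> P \<and> card (N y) = p then forms (N y) (d + 1) else {0})"
      by (auto simp: theta_def vform_zero intro: vform_facts(2))
  qed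
  show "bd x \<in> rank_forms p d" if x: "x \<in> rank_forms (Suc p) d"
    unfolding rank_forms_def mem_Collect_eq
  proof
    fix u
    have nz: "card (N u) = p \<and> int (size a) = d \<and> set_mset a \<subseteq> N u \<and> u \<in> P" if "bd x u a \<noteq> 0" for a
    proof -
      have u: "u \<in> P" "set_mset a \<subseteq> N u" "cbd (\<lambda>y. x y a) u \<noteq> 0"
        using that by (auto simp: bd_def split: if_splits)
      then obtain y where y: "y \<in> covers u" "x y a \<noteq> 0"
        using sum.not_neutral_contains_not_neutral[OF u(3)[unfolded cbd_def]] by force
      have "x y \<in> (if y \<in> P \<and> card (N y) = Suc p then forms (N y) d else {0})"
        using x unfolding rank_forms_def by blast
      then have "card (N y) = Suc p" "x y \<in> forms (N y) d"
        using y(2) by (auto split: if_splits)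
      then show ?thesis using u y by (auto simp: covers_def forms_def)
    qed
    show "bd x u \<in> (if u \<in> P \<and> card (N u) = p then forms (N u) d else {0})"
    proof (cases "u \<in> P \<and> card (N u) = p")
      case True
      then show ?thesis using nz by (auto simp: forms_def)
    next
      case False
      then have "bd x u a = 0" for a using nz[of a] by blast
      then have "bd x u = 0" by (simp add: fun_eq_iff)
      then show ?thesis using False by (simp only: if_False singleton_iff)
    qed
  qed
  show "bd (bd x) = 0"
  proof (intro ext)
    fix u a
    show "bd (bd x) u a = 0 u a"
    proof (cases "u \<in> P \<and> set_mset a \<subseteq> N u")
      case True
      have "bd (bd x) u a = cbd (cbd (\<lambda>y. x y a)) u"
        using True subset_trans[OF _ N_mono[of u], of "set_mset a"]
        by (simp add: bd_def) (intro cbd_cong, simp)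
      then show ?thesis using True by (simp add: cbd_cbd)
    qed (auto simp: bd_def)
  qed
  show "x \<in> opsum (theta c) (rank_forms p (d - 1)) r"
    if "r < p" "x \<in> rank_forms p d" "theta c r x \<in> opsum (theta c) (rank_forms p d) r"
    unfolding opsum_theta_iff
  proof
    fix y
    have 1: "x y \<in> (if y \<in> P \<and> card (N y) = p then forms (N y) d else {0})"
      using that(2) unfolding rank_forms_def by blast
    have 2: "theta c r x y \<in> (if y \<in> P \<and> card (N y) = p
        then opsum (vform (N y) (\<lambda>_. 1) c) (forms (N y) d) r else {0})"
      using that(3) unfolding opsum_theta_iff by blast
    show "x y \<in> (if y \<in> P \<and> card (N y) = p
        then opsum (vform (N y) (\<lambda>_. 1) c) (forms (N y) (d - 1)) r else {0})"
    proof (cases "y \<in> P \<and> card (N y) = p")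
      case True
      have "x y \<in> opsum (vform (N y) (\<lambda>_. 1) c) (forms (N y) (d - 1)) r"
      proof (rule vform_regular)
        show "finite (N y)" using True finite_N by blast
        show "inj_on c (N y)" using c by (rule inj_on_subset) simp
        show "x y \<in> forms (N y) d" using 1 True by simp
        show "vform (N y) (\<lambda>_. 1) c r (x y) \<in> opsum (vform (N y) (\<lambda>_. 1) c) (forms (N y) d) r"
          using 2 unfolding if_P[OF True] theta_def .
      qed (use True \<open>r < p\<close> in auto)
      then show ?thesis unfolding if_P[OF True] .
    next
      case False
      with 1 show ?thesis by (simp only: if_False)
    qed
  qed
  show "\<exists>b\<in>rank_forms (Suc p) d. bd b = x" if p: "p < n" and x: "x \<in> rank_forms p d" and 0: "bd x = 0"
  proof -
    have xz: "y \<in> P" "card (N y) = p" "set_mset a \<subseteq> N y" "int (size a) = d" if "x y a \<noteq> 0" for y a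
    proof -
      have *: "x y \<in> (if y \<in> P \<and> card (N y) = p then forms (N y) d else {0})"
        using x unfolding rank_forms_def by blast
      then show "y \<in> P" "card (N y) = p" using that by (auto split: if_splits)
      then have "x y \<in> forms (N y) d" using * by simp
      then show "set_mset a \<subseteq> N y" "int (size a) = d" using that by (auto simp: forms_def)
    qed
    \<comment> \<open>For one monomial \<open>a\<close> and one face \<open>z\<close> with vertex
      set \<open>set_mset a\<close>, the coefficients of \<open>a\<close> at the faces above
      \<open>z\<close> form a cellular cycle.\<close>
    have "\<exists>b. (\<forall>y. b y \<noteq> 0 \<longrightarrow> y \<in> P \<and> z \<sqsubseteq> y \<and> card (N y) = Suc p) \<and>
       (\<forall>u\<in>P. z \<sqsubseteq> u \<longrightarrow> cbd b u = x u a)"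
      if za: "z \<in> P" "N z = set_mset a" for z a
    proof -
      define f where "f = (\<lambda>y. if z \<sqsubseteq> y then x y a else 0)"
      have "\<forall>y. f y \<noteq> 0 \<longrightarrow> y \<in> P \<and> z \<sqsubseteq> y \<and> card (N y) = p"
        using xz by (auto simp: f_def)
      moreover have "\<forall>u\<in>P. z \<sqsubseteq> u \<longrightarrow> cbd f u = 0"
      proof (intro ballI impI)
        fix u assume u: "u \<in> P" "z \<sqsubseteq> u"
        have "cbd f u = cbd (\<lambda>y. x y a) u"
          using u za le_trans[of z u] by (intro cbd_cong) (auto simp: f_def)
        also have "\<dots> = bd x u a" using u za N_mono[of z u] by (simp add: bd_def)
        finally show "cbd f u = 0" using 0 by simp
      qed
      ultimately obtain b where "\<forall>y. b y \<noteq> 0 \<longrightarrow> y \<in> P \<and> z \<sqsubseteq> y \<and> card (N y) = Suc p"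
        "\<forall>u\<in>P. z \<sqsubseteq> u \<longrightarrow> cbd b u = f u"
        using exact[OF za(1) p] unfolding cell_exact_def by blast
      then show ?thesis by (intro exI[of _ b]) (auto simp: f_def)
    qed
    then obtain B where B: "\<And>z a y. z \<in> P \<Longrightarrow> N z = set_mset a \<Longrightarrow> B z a y \<noteq> 0 \<Longrightarrow>
        y \<in> P \<and> z \<sqsubseteq> y \<and> card (N y) = Suc p"
      "\<And>z a u. z \<in> P \<Longrightarrow> N z = set_mset a \<Longrightarrow> u \<in> P \<Longrightarrow> z \<sqsubseteq> u \<Longrightarrow> cbd (B z a) u = x u a"
      by metis
    \<comment> \<open>The bounding chains for different \<open>z\<close> do not interfere: below
      \<open>y\<close> there is exactly one face with vertex set \<open>set_mset a\<close>. The
      degree condition keeps the result homogeneous.\<close>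
    define b where "b = (\<lambda>y a. if y \<in> P \<and> set_mset a \<subseteq> N y \<and> int (size a) = d
      then B (face y (set_mset a)) a y else 0)"
    have "b \<in> rank_forms (Suc p) d"
      unfolding rank_forms_def mem_Collect_eq
    proof
      fix y
      have *: "y \<in> P \<and> card (N y) = Suc p \<and> set_mset a \<subseteq> N y \<and> int (size a) = d" if "b y a \<noteq> 0" for a
        using that B(1)[of "face y (set_mset a)" a y] face[of y "set_mset a"]
        by (auto simp: b_def split: if_splits)
      show "b y \<in> (if y \<in> P \<and> card (N y) = Suc p then forms (N y) d else {0})"
      proof (cases "y \<in> P \<and> card (N y) = Suc p")
        case True
        then show ?thesis using * by (auto simp: forms_def)
      next
        case False
        then have "b y a = 0" for a using *[of a] by blast
        then have "b y = 0" by (simp add: fun_eq_iff)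
        then show ?thesis using False by (simp only: if_False singleton_iff)
      qed
    qed
    moreover have "bd b = x"
    proof (intro ext)
      fix u a
      show "bd b u a = x u a"
      proof (cases "u \<in> P \<and> set_mset a \<subseteq> N u \<and> int (size a) = d")
        case True
        define z where "z = face u (set_mset a)"
        have z: "z \<in> P" "z \<sqsubseteq> u" "N z = set_mset a" using face[of u "set_mset a"] True by (auto simp: z_def)
        have "bd b u a = cbd (\<lambda>y. b y a) u" using True by (simp add: bd_def)
        also have "\<dots> = cbd (B z a) u"
        proof (rule cbd_cong)
          fix y assume y: "y \<in> P" "u \<sqsubseteq> y"
          have "N u \<subseteq> N y" using N_mono True y by blast
          then show "b y a = B z a y"
            using True y face_face[of y u "set_mset a"] by (auto simp: b_def z_def)
        qed
        also have "\<dots> = x u a" using B(2) z True by blast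
        finally show ?thesis .
      next
        case False
        then have "x u a = 0" using xz[of u a] by blast
        moreover have "bd b u a = 0"
          using False by (auto simp: bd_def cbd_def b_def intro!: sum.neutral)
        ultimately show ?thesis by simp
      qed
    qed
    ultimately show ?thesis by blast
  qed
qed

end

section \<open>Hilbert functions\<close>

text \<open>The iterated backward difference; on generating functions it is multiplication by
  \<open>(1 - t)^r\<close>.\<close>

primrec nabla :: "nat \<Rightarrow> (int \<Rightarrow> int) \<Rightarrow> int \<Rightarrow> int" where
  "nabla 0 g d = g d"
| "nabla (Suc r) g d = nabla r g d - nabla r g (d - 1)"

lemma nabla_Suc: "nabla (Suc r) g d = nabla r (\<lambda>d. g d - g (d - 1)) d"
proof (induction r arbitrary: d)
  case (Suc r)
  show ?case using Suc[of d] Suc[of "d - 1"] by simp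
qed simp

lemma nabla_sum: "nabla r (\<lambda>d. \<Sum>i\<in>I. a i * g i d) d = (\<Sum>i\<in>I. a i * nabla r (g i) d)"
  by (induction r arbitrary: d) (auto simp: right_diff_distrib sum_subtractf)

text \<open>The Hilbert function of the polynomial ring in \<open>p\<close> variables. For
  \<open>p = 0\<close> and \<open>d = 0\<close> the truncated subtraction yields
  \<open>0 choose 0\<close>, which is the correct value 1; negative degrees occur in backward
  differences.\<close>

definition num_monomials :: "nat \<Rightarrow> int \<Rightarrow> int" where
  "num_monomials p d = (if d < 0 then 0 else int ((p + nat d - 1) choose nat d))"

lemma num_monomials_Suc: "num_monomials (Suc p) d - num_monomials (Suc p) (d - 1) = num_monomials p d"
proof (cases "d \<le> 0")
  case True
  then show ?thesis by (auto simp: num_monomials_def)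
next
  case False
  then obtain e where d: "d = int (Suc e)"
    by (metis not_le nonneg_eq_int less_imp_le gr0_implies_Suc of_nat_0_less_iff)
  have "nat (d - 1) = e" "nat d = Suc e" using d by auto
  then show ?thesis using d by (simp add: num_monomials_def)
qed

text \<open>The Hilbert series is \<open>1 / (1 - t)^p\<close>, so \<open>p\<close> of the
  differences cancel its denominator.\<close>

lemma nabla_num_monomials: "nabla (m + p) (num_monomials p) d = nabla m (num_monomials 0) d"
proof (induction p)
  case (Suc p)
  then show ?case by (simp only: add_Suc_right nabla_Suc num_monomials_Suc)
qed simp

text \<open>The function \<open>num_monomials 0\<close> has generating function 1, so these are the
  coefficients of \<open>(1 - t)^m\<close>.\<close>

lemma nabla_num_monomials_0:
  "nabla m (num_monomials 0) d = (if d < 0 then 0 else (- 1) ^ nat d * int (m choose nat d))"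
proof (induction m arbitrary: d)
  case 0
  show ?case by (cases "nat d") (auto simp: num_monomials_def)
next
  case (Suc m)
  show ?case
  proof (cases "d \<le> 0")
    case True
    then show ?thesis by (auto simp: Suc)
  next
    case False
    then obtain e where d: "d = int (Suc e)"
      by (metis not_le nonneg_eq_int less_imp_le gr0_implies_Suc of_nat_0_less_iff)
    have "nat (d - 1) = e" "nat d = Suc e" using d by auto
    then show ?thesis using d by (simp add: Suc algebra_simps)
  qed
qed

lemma vect_linear_fscale:
  "(\<And>x y. T (x + y) = T x + T y) \<Longrightarrow> (\<And>c x. T (fscale c x) = fscale c (T x)) \<Longrightarrow>
    Vector_Spaces.linear fscale fscale T"
  by unfold_locales auto

context labelled_poset
begin

definition num_faces :: "nat \<Rightarrow> nat" where
  "num_faces p = card {y \<in> P. card (N y) = p}"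

lemma dim_rank_forms:
  shows "fv.fin_dim (rank_forms p d :: ('a \<Rightarrow> nat multiset \<Rightarrow> 'k::field) set)"
    and "int (fv.dim (rank_forms p d :: ('a \<Rightarrow> nat multiset \<Rightarrow> 'k) set)) = int (num_faces p) * num_monomials p d"
    and "fv.subspace (rank_forms p d :: ('a \<Rightarrow> nat multiset \<Rightarrow> 'k) set)"
proof -
  define S where "S = (SIGMA y:{y \<in> P. card (N y) = p}. {a. set_mset a \<subseteq> N y \<and> int (size a) = d})"
  have eq: "rank_forms p d = (supported S :: ('a \<Rightarrow> nat multiset \<Rightarrow> 'k) set)"
    unfolding rank_forms_def supported_def
  proof (intro Collect_cong iffI allI impI)
    fix f :: "'a \<Rightarrow> nat multiset \<Rightarrow> 'k" and y a
    assume "\<forall>y. f y \<in> (if y \<in> P \<and> card (N y) = p then forms (N y) d else {0})" "f y a \<noteq> 0"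
    then have "f y \<in> (if y \<in> P \<and> card (N y) = p then forms (N y) d else {0})" "f y a \<noteq> 0"
      by blast+
    then show "(y, a) \<in> S" by (auto simp: S_def forms_def split: if_splits)
  next
    fix f :: "'a \<Rightarrow> nat multiset \<Rightarrow> 'k" and y
    assume "\<forall>y a. f y a \<noteq> 0 \<longrightarrow> (y, a) \<in> S"
    then show "f y \<in> (if y \<in> P \<and> card (N y) = p then forms (N y) d else {0})"
      by (auto simp: S_def forms_def fun_eq_iff)
  qed
  have mon: "{a. set_mset a \<subseteq> A \<and> int (size a) = d} = (if d < 0 then {} else multisets_of_size A (nat d))"
    for A :: "nat set"
    by (auto simp: multisets_of_size_def)
  have fin: "finite {a. set_mset a \<subseteq> N y \<and> int (size a) = d}" if "y \<in> P" for y
    unfolding mon using finite_N[OF that] by auto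
  have finS: "finite S" unfolding S_def using finite_P fin by (intro finite_SigmaI) auto
  have "card S = (\<Sum>y\<in>{y \<in> P. card (N y) = p}. card {a. set_mset a \<subseteq> N y \<and> int (size a) = d})"
    unfolding S_def using finite_P fin by (intro card_SigmaI) auto
  then have "int (card S) = (\<Sum>y\<in>{y \<in> P. card (N y) = p}. num_monomials p d)"
    using finite_N by (auto simp: mon num_monomials_def card_multisets_of_size intro!: sum.cong)
  then have "int (card S) = int (num_faces p) * num_monomials p d" by (simp add: num_faces_def)
  then show "fv.fin_dim (rank_forms p d :: ('a \<Rightarrow> nat multiset \<Rightarrow> 'k) set)"
    "int (fv.dim (rank_forms p d :: ('a \<Rightarrow> nat multiset \<Rightarrow> 'k) set)) = int (num_faces p) * num_monomials p d"
    "fv.subspace (rank_forms p d :: ('a \<Rightarrow> nat multiset \<Rightarrow> 'k) set)"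
    using supported_dim[OF finS, where ?'k = 'k] supported_subspace by (auto simp: eq)
qed

text \<open>The sum is the dimension of the degree \<open>d\<close> part of the kernel of \<open>bd\<close> in rank \<open>n\<close> modulo the regular
  sequence \<open>theta c 0, \<dots>, theta c (n - 1)\<close>: each regular element replaces a Hilbert function by its
  backward difference.\<close>

theorem num_faces_alternating_nonneg:
  fixes c :: "nat \<Rightarrow> 'k::field"
  assumes c: "inj c"
    and exact: "\<And>z p. z \<in> P \<Longrightarrow> p < n \<Longrightarrow> cell_exact TYPE('k) z p"
  shows "0 \<le> (\<Sum>p\<le>n. (- 1) ^ (n - p) * int (num_faces p) * ((- 1) ^ d * int ((n - p) choose d)))"
proof -
  interpret R: regular_resolution "theta c" "bd :: _ \<Rightarrow> 'a \<Rightarrow> nat multiset \<Rightarrow> 'k" rank_forms n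
    by (rule regular_resolution_rank_forms[OF assms])
  have bd_scale: "bd (fscale a x) = fscale a (bd x)" for a and x :: "'a \<Rightarrow> nat multiset \<Rightarrow> 'k"
    by (auto simp: fun_eq_iff bd_def cbd_def fscale_def sum_distrib_left mult_ac)
  have lin_bd: "Vector_Spaces.linear fscale fscale (bd :: _ \<Rightarrow> 'a \<Rightarrow> nat multiset \<Rightarrow> 'k)"
  proof (rule vect_linear_fscale)
  qed (rule R.bd_add bd_scale)+
  have theta_scale: "theta c r (fscale a x) = fscale a (theta c r x)" for r a x
    by (auto simp: fun_eq_iff theta_def fscale_def vform_def lin_mult_scale)
  have lin_theta: "Vector_Spaces.linear fscale fscale (theta c r)" for r
    by (rule vect_linear_fscale[OF R.theta_add theta_scale])
  have sub_Z: "fv.subspace (R.Z p e)" for p e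
    using dim_rank_forms(3)[of p e, where ?'k = 'k]
    by (auto simp: R.Z_def fv.subspace_def R.bd_add R.bd_diff bd_scale)
  have fin_Z: "fv.fin_dim (R.Z p e)" for p e
    by (rule fv.fin_dim_subset[OF dim_rank_forms(1)[of p e]]) (auto simp: R.Z_def)
  define z where "z = (\<lambda>p e. int (fv.dim (R.Z p e)))"
  have z0: "z 0 e = int (num_faces 0) * num_monomials 0 e" for e
  proof -
    have "R.Z 0 e = rank_forms 0 e"
    proof -
      \<comment> \<open>The complex ends in rank 0, because a face that covers another one has
        positive rank.\<close>
      have "bd x = 0" if "x \<in> rank_forms 0 e" for x :: "'a \<Rightarrow> nat multiset \<Rightarrow> 'k"
      proof (intro ext)
        fix u a
        have "x y a = 0" if "y \<in> covers u" for y
        proof -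
          have "x y \<in> (if y \<in> P \<and> card (N y) = 0 then forms (N y) e else {0})"
            using \<open>x \<in> rank_forms 0 e\<close> unfolding rank_forms_def by blast
          moreover have "card (N y) \<noteq> 0" using that by (simp add: covers_def)
          ultimately show ?thesis by simp
        qed
        then show "bd x u a = 0 u a" by (simp add: bd_def cbd_def)
      qed
      then show ?thesis by (auto simp: R.Z_def)
    qed
    then show ?thesis by (simp add: z_def dim_rank_forms(2))
  qed
  \<comment> \<open>Exactness at \<open>p\<close> identifies the kernel in rank \<open>p\<close>
    with the image of rank \<open>Suc p\<close>, so rank-nullity links the two kernels.\<close>
  have zSuc: "z (Suc p) e = int (num_faces (Suc p)) * num_monomials (Suc p) e - z p e" if "p < n" for p e
  proof -
    let ?F = "rank_forms (Suc p) e :: ('a \<Rightarrow> nat multiset \<Rightarrow> 'k) set"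
    have "fv.dim (bd ` ?F) + fv.dim {u \<in> ?F. bd u = 0} = fv.dim ?F"
      by (rule fv.dim_kernel_image[OF lin_bd dim_rank_forms(3,1)])
    then have "int (fv.dim (R.Z p e)) + int (fv.dim (R.Z (Suc p) e))
        = int (num_faces (Suc p)) * num_monomials (Suc p) e"
      using R.Z_eq_bd[OF that, of e] dim_rank_forms(2)[of "Suc p" e, where ?'k = 'k]
      by (simp add: R.Z_def flip: of_nat_add)
    then show ?thesis by (simp add: z_def)
  qed
  have z: "z m e = (\<Sum>p\<le>m. (- 1) ^ (m - p) * int (num_faces p) * num_monomials p e)" if "m \<le> n" for m e
    using that
  proof (induction m)
    case 0
    then show ?case by (simp add: z0)
  next
    case (Suc m)
    have "(\<Sum>p\<le>m. (- 1) ^ (Suc m - p) * int (num_faces p) * num_monomials p e) = - z m e"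
      using Suc by (auto simp: Suc_diff_le sum_negf[symmetric] intro!: sum.cong)
    then show ?case using zSuc[of m e] Suc.prems by simp
  qed
  define I where "I = (\<lambda>r e. opsum (theta c) (R.Z n (e - 1)) r)"
  have I_sub: "I r e \<subseteq> R.Z n e" for r e by (simp add: I_def R.opsum_Z)
  have I_space: "fv.subspace (I r e)" for r e
  proof -
    have "fscale a x \<in> I r e" if "x \<in> I r e" for a x
      unfolding I_def
    proof (rule opsum_image[of "fscale a" "theta c" "R.Z n (e - 1)"])
      show "fscale a ` R.Z n (e - 1) \<subseteq> R.Z n (e - 1)"
        using sub_Z[of n "e - 1"] by (auto simp: fv.subspace_def)
    qed (use that in \<open>auto simp: fv.scale_right_distrib theta_scale I_def\<close>)
    moreover have "add_subgroup (I r e)" unfolding I_def by (rule R.opsum_Z_subgroup)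
    ultimately show ?thesis
      using add_subgroup_closed(1,4) unfolding fv.subspace_def by blast
  qed
  have fin_I: "fv.fin_dim (I r e)" for r e by (rule fv.fin_dim_subset[OF fin_Z I_sub])
  define q where "q = (\<lambda>r e. z n e - int (fv.dim (I r e)))"
  have q_nonneg: "q r e \<ge> 0" for r e
    using fv.dim_mono_fin[OF fin_Z I_sub, of r e] by (simp add: q_def z_def)
  have q_Suc: "q (Suc r) e = q r e - q r (e - 1)" if "r < n" for r e
  proof -
    have 1: "{theta c r u + w | u w. u \<in> R.Z n (e - 1) \<and> w \<in> I r e} = I (Suc r) e"
      unfolding I_def opsum.simps by (auto simp: add.commute)
    \<comment> \<open>Here regularity enters: multiplication by form \<open>r\<close> is injective
      modulo the ideal of the earlier forms.\<close>
    have 2: "{u \<in> R.Z n (e - 1). theta c r u \<in> I r e} = I r (e - 1)"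
    proof (intro set_eqI iffI)
      fix u assume "u \<in> {u \<in> R.Z n (e - 1). theta c r u \<in> I r e}"
      then show "u \<in> I r (e - 1)"
        using R.regular_Z[OF that, of u "e - 1"] by (simp add: I_def)
    next
      fix u assume u: "u \<in> I r (e - 1)"
      have "theta c r u \<in> I r e"
        unfolding I_def
      proof (rule opsum_image[OF R.theta_add R.theta_comm _ u[unfolded I_def]])
        show "theta c r ` R.Z n (e - 1 - 1) \<subseteq> R.Z n (e - 1)"
          using R.theta_Z[of _ n "e - 1 - 1" r] by auto
      qed
      then show "u \<in> {u \<in> R.Z n (e - 1). theta c r u \<in> I r e}" using u I_sub by blast
    qed
    have "fv.dim {theta c r u + w | u w. u \<in> R.Z n (e - 1) \<and> w \<in> I r e}
        + fv.dim {u \<in> R.Z n (e - 1). theta c r u \<in> I r e} = fv.dim (R.Z n (e - 1)) + fv.dim (I r e)"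
      by (rule fv.dim_image_add[OF lin_theta sub_Z fin_Z I_space fin_I])
    then have "fv.dim (I (Suc r) e) + fv.dim (I r (e - 1)) = fv.dim (R.Z n (e - 1)) + fv.dim (I r e)"
      by (simp only: 1 2)
    then show ?thesis by (simp add: q_def z_def)
  qed
  have q_nabla: "q r e = nabla r (z n) e" if "r \<le> n" for r e
    using that
  proof (induction r arbitrary: e)
    case 0
    have "fv.dim {0 :: 'a \<Rightarrow> nat multiset \<Rightarrow> 'k} = 0" using fv.dim_le_card[of "{0}" "{}"] by simp
    then show ?case by (simp add: q_def I_def)
  next
    case (Suc r)
    then show ?case by (simp add: q_Suc)
  qed
  have "0 \<le> nabla n (z n) (int d)" using q_nonneg[of n "int d"] q_nabla by simp
  also have "z n = (\<lambda>e. \<Sum>p\<le>n. ((- 1) ^ (n - p) * int (num_faces p)) * num_monomials p e)"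
    using z[of n] by (simp add: fun_eq_iff)
  also have "nabla n \<dots> (int d) = (\<Sum>p\<le>n. ((- 1) ^ (n - p) * int (num_faces p)) * nabla n (num_monomials p) (int d))"
    by (rule nabla_sum)
  also have "\<dots> = (\<Sum>p\<le>n. (- 1) ^ (n - p) * int (num_faces p) * ((- 1) ^ d * int ((n - p) choose d)))"
  proof (intro sum.cong refl)
    fix p assume "p \<in> {..n}"
    then have "nabla n (num_monomials p) (int d) = nabla (n - p) (num_monomials 0) (int d)"
      using nabla_num_monomials[of "n - p" p] by simp
    then show "(- 1) ^ (n - p) * int (num_faces p) * nabla n (num_monomials p) (int d) =
        (- 1) ^ (n - p) * int (num_faces p) * ((- 1) ^ d * int ((n - p) choose d))"
      by (simp add: nabla_num_monomials_0)
  qed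
  finally show ?thesis .
qed

end

section \<open>Cellular homology from the order complex\<close>

lemma sum_antisymmetric_pairs:
  fixes f :: "nat \<Rightarrow> nat \<Rightarrow> 'b::ab_group_add"
  assumes "finite A" and anti: "\<And>u v. u \<in> A \<Longrightarrow> v \<in> A \<Longrightarrow> u \<noteq> v \<Longrightarrow> f u v = - f v u"
  shows "(\<Sum>u\<in>A. \<Sum>v\<in>A - {u}. f u v) = 0"
proof -
  have "(\<Sum>v\<in>A - {u}. f u v) = (\<Sum>v\<in>A. if v < u then f u v else 0) + (\<Sum>v\<in>A. if u < v then f u v else 0)"
    if "u \<in> A" for u
  proof -
    have "(\<Sum>v\<in>A - {u}. f u v) = (\<Sum>v\<in>A. if v = u then 0 else f u v)"
      using assms(1) by (intro sum.mono_neutral_cong_left) auto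
    also have "\<dots> = (\<Sum>v\<in>A. (if v < u then f u v else 0) + (if u < v then f u v else 0))"
      by (intro sum.cong) auto
    finally show ?thesis by (simp add: sum.distrib)
  qed
  then have "(\<Sum>u\<in>A. \<Sum>v\<in>A - {u}. f u v)
      = (\<Sum>u\<in>A. \<Sum>v\<in>A. if v < u then f u v else 0) + (\<Sum>u\<in>A. \<Sum>v\<in>A. if u < v then f u v else 0)"
    by (simp add: sum.distrib)
  also have "(\<Sum>u\<in>A. \<Sum>v\<in>A. if u < v then f u v else 0) = (\<Sum>v\<in>A. \<Sum>u\<in>A. if u < v then f u v else 0)"
    by (rule sum.swap)
  also have "\<dots> = - (\<Sum>v\<in>A. \<Sum>u\<in>A. if u < v then f v u else 0)"
    unfolding sum_negf[symmetric]
  proof (intro sum.cong refl)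
    fix v u assume "v \<in> A" "u \<in> A"
    then show "(if u < v then f u v else 0) = - (if u < v then f v u else 0)"
      by (cases "u < v") (use anti[of u v] in simp_all)
  qed
  finally show ?thesis by simp
qed

locale pointed_labelled_poset = labelled_poset +
  fixes z :: 'a
  assumes z_in: "z \<in> P" and z_le: "y \<in> P \<Longrightarrow> z \<sqsubseteq> y" and N_z: "N z = {}"
begin

definition R :: "'a rel" where "R = {(x, y). x \<sqsubseteq> y}"

lemma mem_R [simp]: "(x, y) \<in> R \<longleftrightarrow> x \<sqsubseteq> y"
  by (simp add: R_def)

text \<open>The chains of nonempty faces, that is, the barycentric subdivision of the cell complex
  \<open>P\<close>.\<close>

definition L :: "'a set set" where "L = order_complex (P - {z}) R"

lemma mem_L: "F \<in> L \<longleftrightarrow> F \<subseteq> P - {z} \<and> (\<forall>x\<in>F. \<forall>y\<in>F. x \<sqsubseteq> y \<or> y \<sqsubseteq> x)"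
  by (auto simp: L_def order_complex_def Chains_def)

lemma finite_L: "finite L"
  by (rule finite_subset[of _ "Pow P"]) (auto simp: mem_L finite_P)

lemma finite_face_L: "F \<in> L \<Longrightarrow> finite F"
  using finite_P by (auto simp: mem_L intro: finite_subset)

lemma subset_L: "F \<in> L \<Longrightarrow> G \<subseteq> F \<Longrightarrow> G \<in> L"
  by (auto simp: mem_L)

lemma empty_L: "{} \<in> L"
  by (simp add: mem_L)

lemma N_eq_empty: "y \<in> P \<Longrightarrow> N y = {} \<longleftrightarrow> y = z"
  using eq_of_labels[OF z_in _ z_le] N_z by metis

lemma boundary_insert:
  "boundary R L c G = (\<Sum>x\<in>{x \<in> P - {z} - G. insert x G \<in> L}. (- 1) ^ card {u \<in> G. u \<sqsubseteq> x} * c (insert x G))"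
proof -
  let ?s = "\<lambda>F v. (- 1) ^ card {u \<in> F. u \<noteq> v \<and> u \<sqsubseteq> v} * c F"
  let ?X = "{x \<in> P - {z} - G. insert x G \<in> L}"
  have "boundary R L c G = (\<Sum>F\<in>L. \<Sum>v\<in>F. if F - {v} = G then ?s F v else 0)"
    unfolding boundary_def mem_R ..
  also have "\<dots> = (\<Sum>(F, v)\<in>Sigma L (\<lambda>F. F). if F - {v} = G then ?s F v else 0)"
    using finite_L finite_face_L by (intro sum.Sigma) auto
  also have "\<dots> = (\<Sum>(F, v)\<in>(\<lambda>x. (insert x G, x)) ` ?X. ?s F v)"
  proof (rule sum.mono_neutral_cong_right)
    show "finite (Sigma L (\<lambda>F. F))" using finite_L finite_face_L by (intro finite_SigmaI) auto
    show "(\<lambda>x. (insert x G, x)) ` ?X \<subseteq> Sigma L (\<lambda>F. F)" by auto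
    show "\<forall>i\<in>Sigma L (\<lambda>F. F) - (\<lambda>x. (insert x G, x)) ` ?X.
        (case i of (F, v) \<Rightarrow> if F - {v} = G then ?s F v else 0) = 0"
    proof (intro ballI)
      fix i assume i: "i \<in> Sigma L (\<lambda>F. F) - (\<lambda>x. (insert x G, x)) ` ?X"
      obtain F v where Fv: "i = (F, v)" by (cases i)
      have "F - {v} \<noteq> G"
      proof
        assume "F - {v} = G"
        then have "F = insert v G" "v \<notin> G" "v \<in> P - {z}" using i Fv by (auto simp: mem_L)
        then have "i \<in> (\<lambda>x. (insert x G, x)) ` ?X" using i Fv by auto
        then show False using i by blast
      qed
      then show "(case i of (F, v) \<Rightarrow> if F - {v} = G then ?s F v else 0) = 0" by (simp add: Fv)
    qed
  qed auto
  also have "\<dots> = (\<Sum>x\<in>?X. ?s (insert x G) x)"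
    by (subst sum.reindex) (auto simp: inj_on_def)
  also have "\<dots> = (\<Sum>x\<in>?X. (- 1) ^ card {u \<in> G. u \<sqsubseteq> x} * c (insert x G))"
  proof (intro sum.cong refl)
    fix x assume "x \<in> ?X"
    then have "{u \<in> insert x G. u \<noteq> x \<and> u \<sqsubseteq> x} = {u \<in> G. u \<sqsubseteq> x}" by auto
    then show "?s (insert x G) x = (- 1) ^ card {u \<in> G. u \<sqsubseteq> x} * c (insert x G)" by simp
  qed
  finally show ?thesis .
qed

lemma boundary_sum:
  "boundary R L (\<lambda>F. \<Sum>i\<in>I. a i * c i F) G = (\<Sum>i\<in>I. a i * boundary R L (c i) G)"
proof -
  have "boundary R L (\<lambda>F. \<Sum>i\<in>I. a i * c i F) G
      = (\<Sum>x\<in>{x \<in> P - {z} - G. insert x G \<in> L}. \<Sum>i\<in>I. a i * ((- 1) ^ card {u \<in> G. u \<sqsubseteq> x} * c i (insert x G)))"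
    by (simp add: boundary_insert sum_distrib_left mult.left_commute)
  then show ?thesis
    by (subst (asm) sum.swap) (simp add: boundary_insert sum_distrib_left)
qed

section \<open>Barycentric subdivision as a chain map\<close>

primrec sd :: "nat \<Rightarrow> 'a \<Rightarrow> 'a set \<Rightarrow> 'k::field" where
  "sd 0 y F = (if F = {} then 1 else 0)"
| "sd (Suc p) y F = (if y \<in> F then (- 1) ^ p *
     (\<Sum>v\<in>N y. below_sign (N y) v * sd p (face y (N y - {v})) (F - {y})) else 0)"

lemma facet:
  assumes "y \<in> P" "v \<in> N y"
  shows "face y (N y - {v}) \<in> P" "face y (N y - {v}) \<sqsubseteq> y" "N (face y (N y - {v})) = N y - {v}"
    "face y (N y - {v}) \<noteq> y" "y \<in> covers (face y (N y - {v}))"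
proof -
  note f = face[OF assms(1), of "N y - {v}", OF Diff_subset]
  show "face y (N y - {v}) \<in> P" "face y (N y - {v}) \<sqsubseteq> y" "N (face y (N y - {v})) = N y - {v}"
    by (fact f)+
  show "face y (N y - {v}) \<noteq> y" using f(3) assms(2) by (metis DiffD2 singletonI)
  show "y \<in> covers (face y (N y - {v}))"
    by (rule covers_face[OF assms(1), of v]) (use assms in auto)
qed

lemma sd_support:
  assumes "y \<in> P" "card (N y) = p" "sd p y F \<noteq> 0"
  shows "F \<in> L \<and> card F = p \<and> (\<forall>x\<in>F. x \<sqsubseteq> y)"
  using assms
proof (induction p arbitrary: y F)
  case 0
  then show ?case by (auto simp: empty_L split: if_splits)
next
  case (Suc p)
  have y: "y \<in> F" and "(\<Sum>v\<in>N y. below_sign (N y) v * sd p (face y (N y - {v})) (F - {y}) :: 'b) \<noteq> 0"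
    using Suc.prems(3) by (auto split: if_splits)
  then obtain v where v: "v \<in> N y" "sd p (face y (N y - {v})) (F - {y}) \<noteq> (0::'b)"
    by (metis (no_types, lifting) mult_zero_right sum.neutral)
  note f = facet[OF Suc.prems(1) v(1)]
  have "card (N (face y (N y - {v}))) = p"
    using f(3) Suc.prems(2) v(1) finite_N[OF Suc.prems(1)] by simp
  from Suc.IH[OF f(1) this v(2)] have IH: "F - {y} \<in> L" "card (F - {y}) = p"
    "\<And>x. x \<in> F - {y} \<Longrightarrow> x \<sqsubseteq> face y (N y - {v})" by auto
  have le: "x \<sqsubseteq> y" if "x \<in> F" for x
  proof (cases "x = y")
    case False
    then show ?thesis
      using IH(1) IH(3)[of x] that f Suc.prems(1) le_trans[of x "face y (N y - {v})" y] by (auto simp: mem_L)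
  qed (use le_refl Suc.prems in auto)
  have "y \<noteq> z" using Suc.prems(2) N_z by auto
  then have "F \<in> L" using IH(1) le Suc.prems(1) by (auto simp: mem_L)
  moreover have "card F = Suc p"
    using IH(2) card_Suc_Diff1[OF finite_face_L[OF \<open>F \<in> L\<close>] y] by simp
  ultimately show ?case using le by blast
qed

lemma sd_facets_below:
  assumes y: "y \<in> P" "card (N y) = Suc p"
    and nz: "(\<Sum>v\<in>N y. below_sign (N y) v * sd p (face y (N y - {v})) G :: 'k::field) \<noteq> 0"
  shows "G \<in> L \<and> card G = p \<and> (\<forall>x\<in>G. x \<sqsubseteq> y \<and> x \<noteq> y)"
proof -
  obtain v where v: "v \<in> N y" "sd p (face y (N y - {v})) G \<noteq> (0::'k)"
    using nz by (metis (no_types, lifting) mult_zero_right sum.neutral)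
  note f = facet[OF y(1) v(1)]
  have "card (N (face y (N y - {v}))) = p"
    using f(3) y(2) v(1) finite_N[OF y(1)] by simp
  from sd_support[OF f(1) this v(2)] have G: "G \<in> L" "card G = p"
    "\<And>x. x \<in> G \<Longrightarrow> x \<sqsubseteq> face y (N y - {v})" by auto
  have "x \<sqsubseteq> y \<and> x \<noteq> y" if "x \<in> G" for x
    using G(1) G(3)[OF that] that f y(1) le_trans[of x "face y (N y - {v})" y]
      le_antisym[of "face y (N y - {v})" y] by (auto simp: mem_L)
  then show ?thesis using G by blast
qed

text \<open>The apex \<open>y\<close> lies above the \<open>p\<close> elements of every chain of
  \<open>\<sigma>\<close>, so deleting it has sign \<open>(-1)^p\<close>, which the factor in the
  cone compensates. The remaining terms form the cone over the boundary of \<open>\<sigma>\<close>,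
  and that boundary is zero.\<close>

lemma boundary_cone:
  assumes y: "y \<in> P" "y \<noteq> z"
    and supp: "\<And>G. \<sigma> G \<noteq> 0 \<Longrightarrow> G \<in> L \<and> card G = p \<and> (\<forall>x\<in>G. x \<sqsubseteq> y \<and> x \<noteq> y)"
    and cycle: "\<And>G. boundary R L \<sigma> G = 0"
  shows "boundary R L (\<lambda>F. if y \<in> F then (- 1) ^ p * \<sigma> (F - {y}) else 0) G = (\<sigma> G :: 'k::field)"
proof (cases "y \<in> G")
  case False
  let ?X = "{x \<in> P - {z} - G. insert x G \<in> L}"
  let ?t = "\<lambda>x. (- 1) ^ card {u \<in> G. u \<sqsubseteq> x} * (if y \<in> insert x G then (- 1) ^ p * \<sigma> (insert x G - {y}) else 0)"
  have "sum ?t ?X = sum ?t (?X \<inter> {y})"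
    using False by (intro sum.mono_neutral_right) (auto simp: finite_P)
  also have "\<dots> = \<sigma> G"
  proof (cases "\<sigma> G = 0")
    case True
    have "?t y = 0" using False True by simp
    then show ?thesis by (cases "y \<in> ?X") (simp_all only: Int_insert_right if_True if_False Int_empty_right sum.insert sum.empty finite.emptyI empty_iff not_False_eq_True add_0_right True)
  next
    case nz: False
    from supp[OF nz] have G: "G \<in> L" "card G = p" "\<And>x. x \<in> G \<Longrightarrow> x \<sqsubseteq> y" by auto
    have "insert y G \<in> L" using G y le_refl by (auto simp: mem_L)
    then have X: "?X \<inter> {y} = {y}" using y False by auto
    have "{u \<in> G. u \<sqsubseteq> y} = G" using G by auto
    then have "?t y = \<sigma> G"
      using False G(2) by (simp flip: power_add mult.assoc)
    then show ?thesis unfolding X by simp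
  qed
  finally show ?thesis by (simp add: boundary_insert)
next
  case True
  \<comment> \<open>At a chain \<open>G\<close> containing the apex only smaller elements can be
    added; their positions are the same in \<open>G\<close> and in \<open>?H\<close>, so the
    coefficient is that of the boundary of \<open>\<sigma>\<close> at \<open>?H\<close> up to
    sign.\<close>
  let ?H = "G - {y}"
  have nb: "\<sigma> F = 0" if "y \<in> F" for F using supp[of F] that by blast
  have "boundary R L (\<lambda>F. if y \<in> F then (- 1) ^ p * \<sigma> (F - {y}) else 0) G
     = (\<Sum>x\<in>{x \<in> P - {z} - G. insert x G \<in> L}. (- 1) ^ card {u \<in> G. u \<sqsubseteq> x} * ((- 1) ^ p * \<sigma> (insert x G - {y})))"
    using True by (simp add: boundary_insert)
  also have "\<dots> = (\<Sum>x\<in>{x \<in> P - {z} - ?H. insert x ?H \<in> L}. (- 1) ^ card {u \<in> ?H. u \<sqsubseteq> x} * ((- 1) ^ p * \<sigma> (insert x ?H)))"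
  proof (rule sum.mono_neutral_cong_left)
    show "finite {x \<in> P - {z} - ?H. insert x ?H \<in> L}" using finite_P by simp
    show "{x \<in> P - {z} - G. insert x G \<in> L} \<subseteq> {x \<in> P - {z} - ?H. insert x ?H \<in> L}"
      by (auto elim!: subset_L)
    show "\<forall>x\<in>{x \<in> P - {z} - ?H. insert x ?H \<in> L} - {x \<in> P - {z} - G. insert x G \<in> L}.
      (- 1) ^ card {u \<in> ?H. u \<sqsubseteq> x} * ((- 1) ^ p * \<sigma> (insert x ?H)) = 0"
    proof
      fix x assume x: "x \<in> {x \<in> P - {z} - ?H. insert x ?H \<in> L} - {x \<in> P - {z} - G. insert x G \<in> L}"
      have "\<sigma> (insert x ?H) = 0"
      proof (rule ccontr)
        assume nz: "\<sigma> (insert x ?H) \<noteq> 0"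
        have "insert x G = insert y (insert x ?H)" using True by auto
        moreover have "insert y (insert x ?H) \<in> L"
          using supp[OF nz] y le_refl by (auto simp: mem_L)
        moreover have "x \<noteq> y" using nb nz by blast
        ultimately show False using x by auto
      qed
      then show "(- 1) ^ card {u \<in> ?H. u \<sqsubseteq> x} * ((- 1) ^ p * \<sigma> (insert x ?H)) = 0" by simp
    qed
    show "(- 1) ^ card {u \<in> G. u \<sqsubseteq> x} * ((- 1) ^ p * \<sigma> (insert x G - {y})) =
      (- 1) ^ card {u \<in> ?H. u \<sqsubseteq> x} * ((- 1) ^ p * \<sigma> (insert x ?H))"
      if x: "x \<in> {x \<in> P - {z} - G. insert x G \<in> L}" for x
    proof (cases "\<sigma> (insert x ?H) = 0")
      case zero: True
      have "insert x G - {y} = insert x ?H" using x True by auto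
      then show ?thesis using zero by simp
    next
      case False
      have "x \<sqsubseteq> y" "x \<noteq> y" using supp[OF False] by auto
      then have "\<not> y \<sqsubseteq> x" using le_antisym[of x y] x y by auto
      then have "{u \<in> G. u \<sqsubseteq> x} = {u \<in> ?H. u \<sqsubseteq> x}" by auto
      moreover have "insert x G - {y} = insert x ?H" using x True by auto
      ultimately show ?thesis by simp
    qed
  qed
  also have "\<dots> = (- 1) ^ p * boundary R L \<sigma> ?H"
    by (simp add: boundary_insert sum_distrib_left mult.left_commute)
  finally show ?thesis using cycle nb[OF True] by simp
qed

text \<open>\<open>sd y\<close> is the cone with apex \<open>y\<close> over the subdivided boundary of \<open>y\<close>.\<close>

lemma boundary_sd:
  assumes "y \<in> P" "card (N y) = Suc p"
  shows "boundary R L (sd (Suc p) y) G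
    = (\<Sum>v\<in>N y. below_sign (N y) v * sd p (face y (N y - {v})) G :: 'k::field)"
  using assms
proof (induction p arbitrary: y G)
  case (0 y G)
  define \<sigma> where "\<sigma> = (\<lambda>G. \<Sum>v\<in>N y. below_sign (N y) v * sd 0 (face y (N y - {v})) G :: 'k)"
  have "boundary R L \<sigma> G = 0" for G
    by (simp add: boundary_insert \<sigma>_def)
  moreover have "y \<noteq> z" using 0 N_z by auto
  moreover have "G \<in> L \<and> card G = 0 \<and> (\<forall>x\<in>G. x \<sqsubseteq> y \<and> x \<noteq> y)" if "\<sigma> G \<noteq> 0" for G
    using that unfolding \<sigma>_def by (rule sd_facets_below[OF 0])
  ultimately have "boundary R L (\<lambda>F. if y \<in> F then (- 1) ^ 0 * \<sigma> (F - {y}) else 0) G = \<sigma> G"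
    by (intro boundary_cone[OF 0(1)])
  then show ?case by (simp only: sd.simps(2)[of 0, abs_def] \<sigma>_def)
next
  case (Suc p y G)
  define \<sigma> where "\<sigma> = (\<lambda>G. \<Sum>v\<in>N y. below_sign (N y) v * sd (Suc p) (face y (N y - {v})) G :: 'k)"
  have "boundary R L \<sigma> G = 0" for G
  proof -
    have "boundary R L \<sigma> G = (\<Sum>v\<in>N y. below_sign (N y) v * boundary R L (sd (Suc p) (face y (N y - {v}))) G)"
      unfolding \<sigma>_def by (rule boundary_sum)
    also have "\<dots> = (\<Sum>v\<in>N y. \<Sum>w\<in>N y - {v}. below_sign (N y) v * (below_sign (N y - {v}) w
        * sd p (face y (N y - {v} - {w})) G))"
    proof (intro sum.cong refl)
      fix v assume v: "v \<in> N y"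
      note f = facet[OF Suc.prems(1) v]
      have cN: "card (N (face y (N y - {v}))) = Suc p"
        using f(3) Suc.prems(2) v finite_N[OF Suc.prems(1)] by simp
      have "boundary R L (sd (Suc p) (face y (N y - {v}))) G
        = (\<Sum>w\<in>N y - {v}. below_sign (N y - {v}) w
            * sd p (face (face y (N y - {v})) (N y - {v} - {w})) G :: 'k)"
        using Suc.IH[OF f(1) cN, of G] by (simp only: f(3))
      also have "\<dots> = (\<Sum>w\<in>N y - {v}. below_sign (N y - {v}) w * sd p (face y (N y - {v} - {w})) G :: 'k)"
      proof (intro sum.cong refl)
        fix w
        have "face y (N y - {v} - {w}) = face (face y (N y - {v})) (N y - {v} - {w})"
          by (rule face_face[OF Suc.prems(1) f(1,2)]) (simp add: f(3))
        then show "below_sign (N y - {v}) w * sd p (face (face y (N y - {v})) (N y - {v} - {w})) G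
            = (below_sign (N y - {v}) w * sd p (face y (N y - {v} - {w})) G :: 'k)"
          by simp
      qed
      finally show "below_sign (N y) v * boundary R L (sd (Suc p) (face y (N y - {v}))) G
        = (\<Sum>w\<in>N y - {v}. below_sign (N y) v * (below_sign (N y - {v}) w
        * sd p (face y (N y - {v} - {w})) G :: 'k))"
        by (simp only: sum_distrib_left)
    qed
    \<comment> \<open>Deleting two vertices in either order gives the same face with opposite
      signs.\<close>
    also have "\<dots> = 0"
    proof (rule sum_antisymmetric_pairs)
      show "finite (N y)" using finite_N Suc.prems by blast
      fix u v assume uv: "u \<in> N y" "v \<in> N y" "u \<noteq> v"
      have s: "below_sign (N y) w' = (if w < w' then - below_sign (N y - {w}) w' else (below_sign (N y - {w}) w' :: 'k))"
        if "w \<in> N y" for w w'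
        using below_sign_insert[of "N y - {w}" w w', where ?'a = 'k] that finite_N[OF Suc.prems(1)]
        by (simp add: insert_absorb)
      have "N y - {u} - {v} = N y - {v} - {u}" by auto
      then show "below_sign (N y) u * (below_sign (N y - {u}) v * sd p (face y (N y - {u} - {v})) G)
        = - (below_sign (N y) v * (below_sign (N y - {v}) u * (sd p (face y (N y - {v} - {u})) G :: 'k)))"
        using uv(3) by (cases "u < v") (simp_all add: s[OF uv(1), of v] s[OF uv(2), of u])
    qed
    finally show ?thesis .
  qed
  moreover have "y \<noteq> z" using Suc.prems N_z by auto
  moreover have "G \<in> L \<and> card G = Suc p \<and> (\<forall>x\<in>G. x \<sqsubseteq> y \<and> x \<noteq> y)" if "\<sigma> G \<noteq> 0" for G
    using that unfolding \<sigma>_def by (rule sd_facets_below[OF Suc.prems])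
  ultimately have "boundary R L (\<lambda>F. if y \<in> F then (- 1) ^ Suc p * \<sigma> (F - {y}) else 0) G = \<sigma> G"
    by (intro boundary_cone[OF Suc.prems(1)])
  then show ?case by (simp only: sd.simps(2)[of "Suc p", abs_def] \<sigma>_def)
qed

section \<open>A retraction of chains onto faces\<close>

definition mu :: "'a \<Rightarrow> nat" where "mu y = Max (N y)"

text \<open>The last vertex map from chains to faces: \<open>spans F w\<close> means that the chain \<open>F\<close> is sent to the face
  \<open>w\<close> below its top whose vertices are the largest labels of the elements of \<open>F\<close>. As \<open>mu\<close> is monotone
  on chains, no signs are needed in the induced map \<open>collapse\<close>.\<close>

definition spans :: "'a set \<Rightarrow> 'a \<Rightarrow> bool" where
  "spans F w \<longleftrightarrow> w \<in> P \<and> N w = mu ` F \<and> card F = card (N w) \<and>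
     (\<exists>t\<in>insert z F. (\<forall>x\<in>F. x \<sqsubseteq> t) \<and> w \<sqsubseteq> t)"

definition collapse :: "('a set \<Rightarrow> 'k::field) \<Rightarrow> 'a \<Rightarrow> 'k" where
  "collapse b w = (\<Sum>F\<in>L. if spans F w then b F else 0)"

lemma collapse_nonzero:
  assumes "collapse b w \<noteq> 0"
  obtains F where "F \<in> L" "spans F w" "b F \<noteq> 0"
proof -
  obtain F where "F \<in> L" "(if spans F w then b F else 0) \<noteq> 0"
    using sum.not_neutral_contains_not_neutral[OF assms[unfolded collapse_def]] by blast
  then show ?thesis using that[of F] by (simp split: if_splits)
qed

lemma mu_in: "y \<in> P - {z} \<Longrightarrow> mu y \<in> N y"
  using N_eq_empty finite_N by (auto simp: mu_def)

lemma mu_mono: "x \<in> P - {z} \<Longrightarrow> y \<in> P \<Longrightarrow> x \<sqsubseteq> y \<Longrightarrow> mu x \<le> mu y"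
  unfolding mu_def using N_mono[of x y] N_eq_empty finite_N by (intro Max_mono) auto

lemma chain_top:
  assumes "F \<in> L"
  obtains t where "t \<in> insert z F" "t \<in> P" "\<And>x. x \<in> F \<Longrightarrow> x \<sqsubseteq> t" "mu ` F \<subseteq> N t"
proof -
  have "\<exists>t\<in>insert z F. \<forall>x\<in>F. x \<sqsubseteq> t"
    using finite_face_L[OF assms] assms
  proof (induction F rule: finite_induct)
    case (insert y F)
    then obtain t where t: "t \<in> insert z F" "\<forall>x\<in>F. x \<sqsubseteq> t" using subset_L[of "insert y F" F] by auto
    have P: "t \<in> P" "y \<in> P" "F \<subseteq> P" using t insert.prems z_in by (auto simp: mem_L)
    have "t \<sqsubseteq> y \<or> y \<sqsubseteq> t" using t insert.prems z_le P by (auto simp: mem_L)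
    then show ?case
    proof
      assume "t \<sqsubseteq> y"
      then have "\<forall>x\<in>insert y F. x \<sqsubseteq> y" using t P le_refl le_trans by blast
      then show ?thesis by blast
    qed (use t in auto)
  qed auto
  then obtain t where t: "t \<in> insert z F" "\<And>x. x \<in> F \<Longrightarrow> x \<sqsubseteq> t" by blast
  have tP: "t \<in> P" using t(1) assms z_in by (auto simp: mem_L)
  have "mu ` F \<subseteq> N t"
  proof
    fix m assume "m \<in> mu ` F"
    then obtain x where x: "x \<in> F" "m = mu x" by auto
    then have "x \<in> P - {z}" using assms by (auto simp: mem_L)
    then show "m \<in> N t" using mu_in[of x] N_mono[of x t] tP t(2) x by auto
  qed
  then show ?thesis using that t tP by blast
qed

text \<open>The top of the large chain \<open>F\<close> may replace the top of each subchain, since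
  faces below it are compared by labels. This puts \<open>F\<close> and all its facets below one
  common face.\<close>

lemma spans_iff:
  assumes F: "F \<in> L" and t: "t \<in> insert z F" "t \<in> P" "\<And>x. x \<in> F \<Longrightarrow> x \<sqsubseteq> t" and "G \<subseteq> F"
  shows "spans G w \<longleftrightarrow> w \<in> P \<and> w \<sqsubseteq> t \<and> N w = mu ` G \<and> card G = card (N w)"
proof
  assume "spans G w"
  then obtain s where s: "w \<in> P" "N w = mu ` G" "card G = card (N w)" "s \<in> insert z G" "w \<sqsubseteq> s"
    unfolding spans_def by blast
  have "s \<in> P" "s \<sqsubseteq> t" using s(4) t \<open>G \<subseteq> F\<close> F z_in z_le by (auto simp: mem_L)
  then show "w \<in> P \<and> w \<sqsubseteq> t \<and> N w = mu ` G \<and> card G = card (N w)"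
    using s t le_trans[of w s t] by blast
next
  assume w: "w \<in> P \<and> w \<sqsubseteq> t \<and> N w = mu ` G \<and> card G = card (N w)"
  obtain s where s: "s \<in> insert z G" "s \<in> P" "\<And>x. x \<in> G \<Longrightarrow> x \<sqsubseteq> s" "mu ` G \<subseteq> N s"
    by (rule chain_top[OF subset_L[OF F \<open>G \<subseteq> F\<close>]]) blast
  have "s \<sqsubseteq> t" using s(1) t \<open>G \<subseteq> F\<close> z_le by auto
  then have "w \<sqsubseteq> s" using le_of_labels[of w s t] w s t by auto
  then show "spans G w" using w s unfolding spans_def by blast
qed

text \<open>The chain map property of the last vertex map, read at the single chain
  \<open>F\<close>. If \<open>mu\<close> is injective on \<open>F\<close>, then \<open>F\<close>
  spans one face \<open>y0\<close>, and the facets of \<open>F\<close> correspond to those of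
  \<open>y0\<close> with the same signs, as \<open>mu\<close> preserves the order. If
  \<open>mu\<close> is not injective, the right side is zero, and on the left at most two facets of
  \<open>F\<close> span \<open>w\<close>; they omit neighbouring elements of the chain and
  cancel.\<close>

lemma sum_facets_eq_incidence:
  assumes F: "F \<in> L" and w: "w \<in> P"
  shows "(\<Sum>v\<in>F. if spans (F - {v}) w then (- 1) ^ card {u \<in> F. u \<noteq> v \<and> u \<sqsubseteq> v} else 0)
    = (\<Sum>y\<in>covers w. if spans F y then incidence y w else (0 :: 'k::field))" (is "?l = ?r")
proof -
  obtain t where t: "t \<in> insert z F" "t \<in> P" "\<And>x. x \<in> F \<Longrightarrow> x \<sqsubseteq> t" "mu ` F \<subseteq> N t"
    by (rule chain_top[OF F]) blast
  have sp: "spans G u \<longleftrightarrow> u \<in> P \<and> u \<sqsubseteq> t \<and> N u = mu ` G \<and> card G = card (N u)" if "G \<subseteq> F" for G u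
    by (rule spans_iff[OF F t(1,2) _ that]) (rule t(3))
  have fin: "finite F" by (rule finite_face_L[OF F])
  have FP: "x \<in> P - {z}" if "x \<in> F" for x using F that by (auto simp: mem_L)
  have mono: "mu x \<le> mu y" if "x \<in> F" "y \<in> F" "x \<sqsubseteq> y" for x y
    using mu_mono[of x y] FP that by auto
  have comp: "x \<sqsubseteq> y \<or> y \<sqsubseteq> x" if "x \<in> F" "y \<in> F" for x y
    using F that by (auto simp: mem_L)
  have asym: "x = y" if "x \<in> F" "y \<in> F" "x \<sqsubseteq> y" "y \<sqsubseteq> x" for x y
    using le_antisym[of x y] FP that by auto
  show ?thesis
  proof (cases "inj_on mu F")
    case inj: True
    define y0 where "y0 = face t (mu ` F)"
    have y0: "y0 \<in> P" "y0 \<sqsubseteq> t" "N y0 = mu ` F" using face[OF t(2,4)] by (auto simp: y0_def)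
    have spF: "spans F y \<longleftrightarrow> y = y0" for y
      unfolding sp[OF subset_refl] using y0 face_unique[OF t(2), of y] card_image[OF inj]
      by (auto simp: y0_def)
    have below: "w \<sqsubseteq> y0" if "spans (F - {v}) w" for v
    proof (rule le_of_labels[OF w y0(1) t(2)])
      show "w \<sqsubseteq> t" "N w \<subseteq> N y0" using that y0 sp[of "F - {v}" w] by auto
    qed (rule y0)
    show ?thesis
    proof (cases "y0 \<in> covers w")
      case True
      then obtain m where m: "m \<notin> N w" "N y0 = insert m (N w)" by (rule covers_label[OF w])
      have "m \<in> mu ` F" using m y0 by auto
      then obtain v0 where v0: "v0 \<in> F" "m = mu v0" by blast
      have wy0: "w \<sqsubseteq> y0" using True by (simp add: covers_def)
      have wt: "w \<sqsubseteq> t" using le_trans[OF w y0(1) t(2) wy0 y0(2)] .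
      have im: "mu ` (F - {v}) = mu ` F - {mu v}" if "v \<in> F" for v
        using inj that by (auto simp: inj_on_def)
      have Nw: "N w = mu ` F - {mu v0}" using m y0 v0 by auto
      have spv: "spans (F - {v}) w \<longleftrightarrow> v = v0" if v: "v \<in> F" for v
      proof
        assume "spans (F - {v}) w"
        then have "mu ` F - {mu v} = mu ` F - {mu v0}" using im[OF v] Nw by (simp add: spans_def)
        then have "mu v = mu v0" using v0 v by blast
        then show "v = v0" using inj v v0 by (auto simp: inj_on_def)
      next
        assume "v = v0"
        moreover have "card (F - {v0}) = card (mu ` (F - {v0}))"
          using inj by (intro card_image[symmetric] inj_on_subset[OF inj]) auto
        ultimately show "spans (F - {v}) w"
          using sp[of "F - {v0}" w] w wt Nw im[OF v0(1)] by auto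
      qed
      have "?l = (\<Sum>v\<in>F. if v = v0 then (- 1) ^ card {u \<in> F. u \<noteq> v \<and> u \<sqsubseteq> v} else 0)"
        by (intro sum.cong refl) (simp add: spv)
      also have "\<dots> = (- 1) ^ card {u \<in> F. u \<noteq> v0 \<and> u \<sqsubseteq> v0}" using fin v0 by simp
      also have "card {u \<in> F. u \<noteq> v0 \<and> u \<sqsubseteq> v0} = card (mu ` {u \<in> F. u \<noteq> v0 \<and> u \<sqsubseteq> v0})"
        by (intro card_image[symmetric] inj_on_subset[OF inj]) auto
      also have "mu ` {u \<in> F. u \<noteq> v0 \<and> u \<sqsubseteq> v0} = {k \<in> N w. k < m}"
      proof (intro set_eqI iffI)
        fix k assume "k \<in> mu ` {u \<in> F. u \<noteq> v0 \<and> u \<sqsubseteq> v0}"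
        then obtain u where u: "u \<in> F" "u \<noteq> v0" "u \<sqsubseteq> v0" "k = mu u" by auto
        then have "mu u \<noteq> mu v0" using inj v0 by (auto simp: inj_on_def)
        then show "k \<in> {k \<in> N w. k < m}" using u v0 Nw mono[of u v0] by auto
      next
        fix k assume "k \<in> {k \<in> N w. k < m}"
        then obtain u where u: "u \<in> F" "k = mu u" "mu u < mu v0" using Nw v0 by auto
        then have "u \<noteq> v0" "u \<sqsubseteq> v0" using mono[of v0 u] comp[of u v0] v0 by auto
        then show "k \<in> mu ` {u \<in> F. u \<noteq> v0 \<and> u \<sqsubseteq> v0}" using u by auto
      qed
      also have "(- 1) ^ card {k \<in> N w. k < m} = (incidence y0 w :: 'k)"
        by (simp add: incidence_eq[OF w m] below_sign_def)
      also have "incidence y0 w = ?r" using True by (simp add: spF)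
      finally show ?thesis .
    next
      case False
      have "\<not> spans (F - {v}) w" if v: "v \<in> F" for v
      proof
        assume s: "spans (F - {v}) w"
        have "card (N w) = card (F - {v})" using s unfolding spans_def by metis
        then have "Suc (card (N w)) = card F" by (simp only: card_Suc_Diff1[OF fin v])
        then have "card (N y0) = Suc (card (N w))" using y0 card_image[OF inj] by simp
        then show False using False below[OF s] y0 by (simp add: covers_def)
      qed
      then have "?l = 0" by (intro sum.neutral) auto
      moreover have "?r = 0" using False by (intro sum.neutral) (auto simp: spF)
      ultimately show ?thesis by simp
    qed
  next
    case ninj: False
    have "\<not> spans F y" for y
      using ninj eq_card_imp_inj_on[OF fin, of mu] by (auto simp: spans_def)
    then have r: "?r = 0" by simp
    show ?thesis
    proof (cases "\<exists>v\<in>F. spans (F - {v}) w")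
      case False
      then have "?l = 0" by (intro sum.neutral) auto
      then show ?thesis using r by simp
    next
      case True
      have pair: "\<exists>v2\<in>F. v2 \<noteq> v1 \<and> mu v2 = mu v1" "inj_on mu (F - {v1})" "mu ` (F - {v1}) = mu ` F"
        if v1: "v1 \<in> F" "spans (F - {v1}) w" for v1
      proof -
        show i: "inj_on mu (F - {v1})"
          using v1 fin by (intro eq_card_imp_inj_on) (auto simp: spans_def)
        have "mu v1 \<in> mu ` (F - {v1})"
        proof (rule ccontr)
          assume "mu v1 \<notin> mu ` (F - {v1})"
          with i have "inj_on mu (insert v1 (F - {v1}))" by (subst inj_on_insert) auto
          then show False using ninj v1 by (simp add: insert_absorb)
        qed
        then show "\<exists>v2\<in>F. v2 \<noteq> v1 \<and> mu v2 = mu v1" by force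
        show "mu ` (F - {v1}) = mu ` F"
          using \<open>mu v1 \<in> mu ` (F - {v1})\<close> v1(1) insert_Diff[of v1 F] by (metis image_insert insert_absorb)
      qed
      obtain a0 where a0: "a0 \<in> F" "spans (F - {a0}) w" using True by blast
      obtain b0 where b0: "b0 \<in> F" "b0 \<noteq> a0" "mu b0 = mu a0" using pair(1)[OF a0] by blast
      have "mu ` (F - {b0}) = mu ` F"
      proof -
        have "mu b0 \<in> mu ` (F - {b0})" using a0 b0 by force
        then show ?thesis using b0(1) insert_Diff[of b0 F] by (metis image_insert insert_absorb)
      qed
      then have "spans (F - {b0}) w"
        using a0(2) pair(3)[OF a0] fin a0(1) b0(1) unfolding sp[OF Diff_subset] by simp
      then obtain v1 v2 where v: "v1 \<in> F" "v2 \<in> F" "v1 \<noteq> v2" "mu v1 = mu v2" "v1 \<sqsubseteq> v2"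
        "spans (F - {v1}) w" "spans (F - {v2}) w"
        using a0 b0 comp[of a0 b0] by metis
      have only: "v = v1 \<or> v = v2" if "v \<in> F" "spans (F - {v}) w" for v
        using pair(2)[OF that] v by (auto simp: inj_on_def)
      have "?l = (\<Sum>v\<in>{v1, v2}. (- 1) ^ card {u \<in> F. u \<noteq> v \<and> u \<sqsubseteq> v})"
        by (rule sum.mono_neutral_cong_right) (use fin v only in auto)
      also have "\<dots> = (- 1) ^ card {u \<in> F. u \<noteq> v1 \<and> u \<sqsubseteq> v1} + (- 1) ^ card {u \<in> F. u \<noteq> v2 \<and> u \<sqsubseteq> v2}"
        using v(3) by simp
      \<comment> \<open>No element of \<open>F\<close> lies strictly between \<open>v1\<close> and
        \<open>v2\<close>: monotonicity would force the same \<open>mu\<close> on it, a third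
        coincidence. So the two signs are opposite.\<close>
      also have "{u \<in> F. u \<noteq> v2 \<and> u \<sqsubseteq> v2} = insert v1 {u \<in> F. u \<noteq> v1 \<and> u \<sqsubseteq> v1}"
      proof (intro set_eqI iffI)
        fix u assume u: "u \<in> {u \<in> F. u \<noteq> v2 \<and> u \<sqsubseteq> v2}"
        have "u \<sqsubseteq> v1" if "u \<noteq> v1"
        proof (rule ccontr)
          assume "\<not> u \<sqsubseteq> v1"
          then have "v1 \<sqsubseteq> u" using comp[of u v1] u v by auto
          then have "mu u = mu v2" using mono[of v1 u] mono[of u v2] u v by auto
          then show False using pair(2)[OF v(1,6)] u v that by (auto simp: inj_on_def)
        qed
        then show "u \<in> insert v1 {u \<in> F. u \<noteq> v1 \<and> u \<sqsubseteq> v1}" using u by auto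
      next
        fix u assume u: "u \<in> insert v1 {u \<in> F. u \<noteq> v1 \<and> u \<sqsubseteq> v1}"
        then have "u \<in> F" "u \<sqsubseteq> v1" using v le_refl FP by auto
        then have "u \<sqsubseteq> v2" "u \<noteq> v2"
          using le_trans[of u v1 v2] FP v asym[of v1 v2] by auto
        then show "u \<in> {u \<in> F. u \<noteq> v2 \<and> u \<sqsubseteq> v2}" using \<open>u \<in> F\<close> by simp
      qed
      finally show ?thesis using fin r by simp
    qed
  qed
qed

lemma collapse_boundary:
  assumes "w \<in> P"
  shows "collapse (boundary R L b) w = cbd (collapse b) w"
proof -
  let ?s = "\<lambda>F v. (- 1) ^ card {u \<in> F. u \<noteq> v \<and> u \<sqsubseteq> v}"
  have "collapse (boundary R L b) w
      = (\<Sum>G\<in>L. \<Sum>F\<in>L. \<Sum>v\<in>F. if F - {v} = G then if spans G w then ?s F v * b F else 0 else 0)"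
    unfolding collapse_def boundary_def mem_R
  proof (intro sum.cong refl)
    fix G
    show "(if spans G w then \<Sum>F\<in>L. \<Sum>v\<in>F. if F - {v} = G then ?s F v * b F else 0 else 0)
      = (\<Sum>F\<in>L. \<Sum>v\<in>F. if F - {v} = G then if spans G w then ?s F v * b F else 0 else 0)"
      by (cases "spans G w") (simp_all cong: if_cong)
  qed
  also have "\<dots> = (\<Sum>F\<in>L. \<Sum>v\<in>F. \<Sum>G\<in>L. if F - {v} = G then if spans G w then ?s F v * b F else 0 else 0)"
    by (subst sum.swap) (intro sum.cong refl sum.swap)
  also have "\<dots> = (\<Sum>F\<in>L. (\<Sum>v\<in>F. if spans (F - {v}) w then ?s F v else 0) * b F)"
    unfolding sum_distrib_right
    using subset_L finite_L by (intro sum.cong refl) (auto simp: sum.delta')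
  also have "\<dots> = (\<Sum>F\<in>L. (\<Sum>y\<in>covers w. if spans F y then incidence y w else 0) * b F)"
    by (intro sum.cong refl) (simp only: sum_facets_eq_incidence[OF _ assms])
  also have "\<dots> = cbd (collapse b) w"
    unfolding cbd_def collapse_def sum_distrib_left sum_distrib_right
    by (subst sum.swap) (intro sum.cong refl, simp)
  finally show ?thesis .
qed

text \<open>Passing from deleted vertices to the cover relation lets the sums over a face and over
  its facets be interchanged, after which \<open>cbd\<close> appears.\<close>

lemma lower_sum:
  assumes "y \<in> P"
  shows "(\<Sum>v\<in>N y. below_sign (N y) v * f (face y (N y - {v})))
    = (\<Sum>x\<in>P. if y \<in> covers x then incidence y x * f x else (0::'k::field))"
proof -
  have "(\<Sum>x\<in>P. if y \<in> covers x then incidence y x * f x else 0)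
    = (\<Sum>x\<in>(\<lambda>v. face y (N y - {v})) ` N y. incidence y x * f x)"
  proof (rule sum.mono_neutral_cong_right)
    show "\<forall>x\<in>P - (\<lambda>v. face y (N y - {v})) ` N y. (if y \<in> covers x then incidence y x * f x else 0) = 0"
    proof
      fix x assume x: "x \<in> P - (\<lambda>v. face y (N y - {v})) ` N y"
      have "y \<notin> covers x"
      proof
        assume y: "y \<in> covers x"
        obtain v where v: "v \<notin> N x" "N y = insert v (N x)" using covers_label[of x y] x y by auto
        have "x = face y (N y - {v})"
          using face_unique[OF assms, of x] x y v by (auto simp: covers_def)
        then show False using x v by blast
      qed
      then show "(if y \<in> covers x then incidence y x * f x else 0) = 0" by simp
    qed
  qed (use finite_P facet[OF assms] in auto)
  also have "\<dots> = (\<Sum>v\<in>N y. incidence y (face y (N y - {v})) * f (face y (N y - {v})))"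
    using facet(3)[OF assms] by (subst sum.reindex) (auto simp: inj_on_def, metis DiffI DiffD2 singletonD singletonI)
  also have "\<dots> = (\<Sum>v\<in>N y. below_sign (N y) v * f (face y (N y - {v})))"
  proof (intro sum.cong refl)
    fix v assume v: "v \<in> N y"
    have "N y - (N y - {v}) = {v}" using v by auto
    then show "incidence y (face y (N y - {v})) * f (face y (N y - {v})) = below_sign (N y) v * f (face y (N y - {v}))"
      using facet(3)[OF assms v] by (simp add: incidence_def)
  qed
  finally show ?thesis by simp
qed

lemma collapse_sum: "collapse (\<lambda>F. \<Sum>i\<in>I. a i * c i F) w = (\<Sum>i\<in>I. a i * collapse (c i) w)"
proof -
  have "collapse (\<lambda>F. \<Sum>i\<in>I. a i * c i F) w = (\<Sum>F\<in>L. \<Sum>i\<in>I. a i * (if spans F w then c i F else 0))"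
    unfolding collapse_def by (intro sum.cong refl) auto
  then show ?thesis
    by (subst (asm) sum.swap) (simp add: collapse_def sum_distrib_left)
qed

text \<open>Subdividing and then collapsing is the identity. A chain in the subdivision of
  \<open>y\<close> has as many elements as \<open>y\<close> has vertices and lies below
  \<open>y\<close>, so \<open>y\<close> is the only face it can span. The coefficient at
  \<open>y\<close> is found by comparing boundaries.\<close>

lemma collapse_sd:
  assumes "y \<in> P" "card (N y) = p" "w \<in> P"
  shows "collapse (sd p y) w = (if w = y then 1 else (0::'k::field))"
  using assms
proof (induction p arbitrary: y w)
  case (0 y w)
  have "N y = {}" using 0 finite_N by simp
  then have y: "y = z" using N_eq_empty 0 by simp
  have "spans {} w \<longleftrightarrow> w = y"
    using N_eq_empty[of w] z_in N_z le_refl 0 y by (auto simp: spans_def)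
  moreover have "collapse (sd 0 y) w = (\<Sum>F\<in>L. if F = {} then if spans {} w then 1 else 0 else 0)"
    unfolding collapse_def by (intro sum.cong refl) auto
  ultimately show ?case using finite_L empty_L by (simp add: sum.delta del: sd.simps)
next
  case (Suc p y w)
  have zero: "collapse (sd (Suc p) y) u = (0::'k)" if u: "u \<in> P" "u \<noteq> y" for u
  proof (rule ccontr)
    assume "collapse (sd (Suc p) y) u \<noteq> (0::'k)"
    then obtain F where F: "F \<in> L" "spans F u" "sd (Suc p) y F \<noteq> (0::'k)"
      by (rule collapse_nonzero)
    from sd_support[OF Suc.prems(1,2) F(3)] have c: "card F = Suc p" "\<And>x. x \<in> F \<Longrightarrow> x \<sqsubseteq> y" by auto
    obtain t where t: "t \<in> insert z F" "u \<sqsubseteq> t" using F(2) unfolding spans_def by blast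
    have "t \<in> P" "t \<sqsubseteq> y" using t F(1) z_in z_le c Suc.prems(1) by (auto simp: mem_L)
    then have "u \<sqsubseteq> y" using le_trans[OF u(1) _ Suc.prems(1) t(2)] by blast
    moreover have "card (N u) = Suc p" using F(2) c by (simp add: spans_def)
    ultimately show False using eq_of_card[OF u(1) Suc.prems(1)] Suc.prems(2) u(2) by simp
  qed
  show ?case
  proof (cases "w = y")
    case True
    have "N y \<noteq> {}" using Suc.prems by auto
    then obtain v where v: "v \<in> N y" by blast
    \<comment> \<open>At the facet \<open>x\<close> the boundary of the collapsed subdivision is the
      unknown coefficient times an incidence number; by the chain map properties and induction it is
      also that incidence number.\<close>
    define x where "x = face y (N y - {v})"
    note f = facet[OF Suc.prems(1) v, folded x_def]
    have bs: "below_sign (N y) v \<noteq> (0::'k)" by (simp add: below_sign_def)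
    have "cbd (collapse (sd (Suc p) y)) x = (\<Sum>u\<in>covers x. if u = y then incidence y x * collapse (sd (Suc p) y) y else (0::'k))"
      unfolding cbd_def by (intro sum.cong refl) (use zero in \<open>auto simp: covers_def\<close>)
    also have "\<dots> = incidence y x * collapse (sd (Suc p) y) y" using f(5) by simp
    finally have 1: "cbd (collapse (sd (Suc p) y)) x = incidence y x * (collapse (sd (Suc p) y) y :: 'k)" .
    have "cbd (collapse (sd (Suc p) y)) x = collapse (boundary R L (sd (Suc p) y)) x"
      by (rule collapse_boundary[OF f(1), symmetric])
    also have "boundary R L (sd (Suc p) y) = (\<lambda>G. \<Sum>v\<in>N y. below_sign (N y) v * sd p (face y (N y - {v})) G :: 'k)"
      by (rule ext) (rule boundary_sd[OF Suc.prems(1,2)])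
    also have "collapse \<dots> x = (\<Sum>u\<in>N y. below_sign (N y) u * collapse (sd p (face y (N y - {u}))) x)"
      by (rule collapse_sum)
    also have "\<dots> = (\<Sum>u\<in>N y. if u = v then below_sign (N y) v else 0)"
    proof (intro sum.cong refl)
      fix u assume u: "u \<in> N y"
      note g = facet[OF Suc.prems(1) u]
      have "card (N (face y (N y - {u}))) = p"
        using g(3) Suc.prems(2) u finite_N[OF Suc.prems(1)] by simp
      from Suc.IH[OF g(1) this f(1)]
      have "collapse (sd p (face y (N y - {u}))) x = (if x = face y (N y - {u}) then 1 else (0::'k))" .
      moreover have "x = face y (N y - {u}) \<longleftrightarrow> u = v"
      proof
        assume "x = face y (N y - {u})"
        then have "N y - {v} = N y - {u}" using f(3) g(3) by metis
        then show "u = v" using u v by blast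
      qed (simp add: x_def)
      ultimately show "below_sign (N y) u * collapse (sd p (face y (N y - {u}))) x
        = (if u = v then below_sign (N y) v else (0::'k))" by simp
    qed
    also have "\<dots> = below_sign (N y) v" using v finite_N[OF Suc.prems(1)] by simp
    also have "N y - N x = {v}" using f(3) v by auto
    then have "below_sign (N y) v = (incidence y x :: 'k)" by (simp add: incidence_def)
    finally have "incidence y x * collapse (sd (Suc p) y) y = (incidence y x :: 'k)" using 1 by (simp del: sd.simps)
    moreover have "incidence y x \<noteq> (0::'k)" by (simp add: incidence_def below_sign_def)
    ultimately show ?thesis using True by (simp del: sd.simps)
  next
    case False
    then show ?thesis using zero[OF Suc.prems(3)] by (simp del: sd.simps)
  qed
qed

text \<open>The subdivision of a cellular cycle is a simplicial cycle, hence a boundary; collapsing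
  a chain that it bounds gives a cellular chain with the original cycle as boundary, as
  \<open>collapse\<close> undoes \<open>sd\<close>.\<close>

theorem cell_exact_of_homology:
  assumes hom: "reduced_homology_zero TYPE('k::field) R L (int p - 1)"
  shows "cell_exact TYPE('k) z p"
  unfolding cell_exact_def
proof (intro allI impI)
  fix c :: "'a \<Rightarrow> 'k"
  assume supp: "\<forall>y. c y \<noteq> 0 \<longrightarrow> y \<in> P \<and> z \<sqsubseteq> y \<and> card (N y) = p"
    and cycle: "\<forall>x\<in>P. z \<sqsubseteq> x \<longrightarrow> cbd c x = 0"
  define Y where "Y = {y \<in> P. card (N y) = p}"
  have finY: "finite Y" using finite_P by (simp add: Y_def)
  define \<sigma> where "\<sigma> = (\<lambda>F. \<Sum>y\<in>Y. c y * sd p y F)"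
  have chain: "\<sigma> \<in> simplicial_chains L (int p - 1)"
    unfolding simplicial_chains_def mem_Collect_eq
  proof (intro allI impI)
    fix F assume "\<sigma> F \<noteq> 0"
    then obtain y where "y \<in> Y" "sd p y F \<noteq> (0::'k)"
      unfolding \<sigma>_def by (metis (no_types, lifting) mult_zero_right sum.neutral)
    then show "F \<in> L \<and> int (card F) = int p - 1 + 1"
      using sd_support[of y p F] by (auto simp: Y_def)
  qed
  have "boundary R L \<sigma> G = 0" for G
  proof (cases p)
    case 0
    then have "\<sigma> F = 0" if "F \<noteq> {}" for F using that by (simp add: \<sigma>_def)
    then show ?thesis by (simp add: boundary_insert)
  next
    case (Suc q)
    have "boundary R L \<sigma> G = (\<Sum>y\<in>Y. c y * boundary R L (sd p y) G)"
      unfolding \<sigma>_def by (rule boundary_sum)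
    also have "\<dots> = (\<Sum>y\<in>Y. c y * (\<Sum>x\<in>P. if y \<in> covers x then incidence y x * sd q x G else 0))"
    proof (intro sum.cong refl)
      fix y assume "y \<in> Y"
      then have y: "y \<in> P" "card (N y) = Suc q" by (auto simp: Y_def Suc)
      show "c y * boundary R L (sd p y) G = c y * (\<Sum>x\<in>P. if y \<in> covers x then incidence y x * sd q x G else 0)"
        unfolding Suc boundary_sd[OF y] lower_sum[OF y(1), where f = "\<lambda>x. sd q x G"] ..
    qed
    also have "\<dots> = (\<Sum>x\<in>P. \<Sum>y\<in>Y. c y * (if y \<in> covers x then incidence y x * sd q x G else 0))"
      unfolding sum_distrib_left by (rule sum.swap)
    also have "\<dots> = (\<Sum>x\<in>P. cbd c x * sd q x G)"
    proof (intro sum.cong refl)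
      fix x
      have "(\<Sum>y\<in>Y. c y * (if y \<in> covers x then incidence y x * sd q x G else 0))
        = (\<Sum>y\<in>Y \<inter> covers x. incidence y x * c y * sd q x G)"
        using finY by (intro sum.mono_neutral_cong_right) (auto simp: mult_ac)
      also have "\<dots> = (\<Sum>y\<in>covers x. incidence y x * c y * sd q x G)"
        using supp by (intro sum.mono_neutral_left) (auto simp: Y_def)
      finally show "(\<Sum>y\<in>Y. c y * (if y \<in> covers x then incidence y x * sd q x G else 0)) = cbd c x * sd q x G"
        by (simp add: cbd_def sum_distrib_right)
    qed
    also have "\<dots> = 0" using cycle z_le by (intro sum.neutral) simp
    finally show ?thesis .
  qed
  then have "boundary R L \<sigma> = (\<lambda>_. 0)" by (rule ext)
  with chain hom have "\<sigma> \<in> boundary R L ` (simplicial_chains L (int p - 1 + 1) :: ('a set \<Rightarrow> 'k) set)"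
    unfolding reduced_homology_zero_def by blast
  then obtain b :: "'a set \<Rightarrow> 'k" where b: "b \<in> simplicial_chains L (int p - 1 + 1)" "\<sigma> = boundary R L b"
    by blast
  have "collapse b y \<noteq> 0 \<longrightarrow> y \<in> P \<and> z \<sqsubseteq> y \<and> card (N y) = Suc p" for y
  proof
    assume "collapse b y \<noteq> 0"
    then obtain F where F: "spans F y" "b F \<noteq> 0"
      by (rule collapse_nonzero)
    then have "card F = Suc p" using b(1) by (force simp: simplicial_chains_def)
    then show "y \<in> P \<and> z \<sqsubseteq> y \<and> card (N y) = Suc p" using F(1) z_le by (simp add: spans_def)
  qed
  moreover have "cbd (collapse b) x = c x" if x: "x \<in> P" for x
  proof -
    have "cbd (collapse b) x = collapse \<sigma> x" by (simp add: b(2) collapse_boundary[OF x])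
    also have "\<dots> = (\<Sum>y\<in>Y. c y * collapse (sd p y) x)"
      unfolding \<sigma>_def by (rule collapse_sum)
    also have "\<dots> = (\<Sum>y\<in>Y. if x = y then c x else 0)"
      using x by (intro sum.cong refl) (auto simp: Y_def collapse_sd)
    also have "\<dots> = (if x \<in> Y then c x else 0)" using finY by simp
    also have "\<dots> = c x" using supp x by (auto simp: Y_def)
    finally show ?thesis .
  qed
  ultimately show "\<exists>b. (\<forall>y. b y \<noteq> 0 \<longrightarrow> y \<in> P \<and> z \<sqsubseteq> y \<and> card (N y) = Suc p) \<and>
      (\<forall>x\<in>P. z \<sqsubseteq> x \<longrightarrow> cbd b x = c x)"
    by blast
qed

end

section \<open>Links and extension of the base field\<close>

context labelled_poset
begin

lemma link_pointed:
  assumes z: "z \<in> P"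
  shows "pointed_labelled_poset {y \<in> P. z \<sqsubseteq> y} (\<sqsubseteq>) (\<lambda>y. N y - N z) z"
proof
  fix y S assume y: "y \<in> {y \<in> P. z \<sqsubseteq> y}" and S: "S \<subseteq> N y - N z"
  let ?x = "face y (S \<union> N z)"
  have sub: "S \<union> N z \<subseteq> N y" using S N_mono[of z y] z y by auto
  have x: "?x \<in> P" "?x \<sqsubseteq> y" "N ?x = S \<union> N z" using face[OF _ sub] y by auto
  have "z \<sqsubseteq> ?x" using le_of_labels[of z ?x y] x y z by auto
  then have "?x \<in> {y \<in> P. z \<sqsubseteq> y} \<and> ?x \<sqsubseteq> y \<and> N ?x - N z = S" using x S by auto
  moreover have "u = ?x" if "u \<in> {y \<in> P. z \<sqsubseteq> y} \<and> u \<sqsubseteq> y \<and> N u - N z = S" for u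
  proof -
    have "N u = S \<union> N z" using N_mono[of z u] z that by auto
    then show ?thesis using face_unique[of y u] that y by auto
  qed
  ultimately show "\<exists>!x. x \<in> {y \<in> P. z \<sqsubseteq> y} \<and> x \<sqsubseteq> y \<and> N x - N z = S" by blast
next
  fix x y assume "x \<in> {y \<in> P. z \<sqsubseteq> y}" "y \<in> {y \<in> P. z \<sqsubseteq> y}" "x \<sqsubseteq> y"
  then show "N x - N z \<subseteq> N y - N z" using N_mono[of x y] by auto
next
  fix x y u assume "x \<in> {y \<in> P. z \<sqsubseteq> y}" "y \<in> {y \<in> P. z \<sqsubseteq> y}" "u \<in> {y \<in> P. z \<sqsubseteq> y}" "x \<sqsubseteq> y" "y \<sqsubseteq> u"
  then show "x \<sqsubseteq> u" using le_trans[of x y u] by simp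
next
  fix x y assume "x \<in> {y \<in> P. z \<sqsubseteq> y}" "y \<in> {y \<in> P. z \<sqsubseteq> y}" "x \<sqsubseteq> y" "y \<sqsubseteq> x"
  then show "x = y" using le_antisym[of x y] by simp
qed (simp_all add: finite_P z finite_N le_refl)

text \<open>The incidence numbers of the link of \<open>z\<close> computed with the labels outside \<open>N z\<close> differ from
  those of the whole poset by a change of orientation of the faces.\<close>

lemma cell_exact_link:
  assumes z: "z \<in> P"
    and ex: "labelled_poset.cell_exact {y \<in> P. z \<sqsubseteq> y} (\<sqsubseteq>) (\<lambda>y. N y - N z) TYPE('k::field) z p"
  shows "cell_exact TYPE('k) z (p + card (N z))"
proof -
  interpret K: pointed_labelled_poset "{y \<in> P. z \<sqsubseteq> y}" "(\<sqsubseteq>)" "\<lambda>y. N y - N z" z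
    by (rule link_pointed[OF z])
  \<comment> \<open>When \<open>v\<close> is added to a face, the labels in \<open>N z\<close> below
    \<open>v\<close> contribute the sign \<open>below_sign (N z) v\<close> that the link does not
    see. It equals \<open>\<kappa> y * \<kappa> x\<close>, so rescaling the basis removes
    it.\<close>
  define \<kappa> :: "'a \<Rightarrow> 'k" where "\<kappa> = (\<lambda>y. \<Prod>v\<in>N y - N z. below_sign (N z) v)"
  have sq: "\<kappa> y * \<kappa> y = 1" for y by (simp add: \<kappa>_def flip: prod.distrib)
  have cardN: "card (N y - N z) + card (N z) = card (N y)" if "y \<in> P" "z \<sqsubseteq> y" for y
  proof -
    have "N z \<subseteq> N y" using N_mono z that by auto
    then show ?thesis using finite_N that z by (simp add: card_Diff_subset card_mono)
  qed
  have cov: "K.covers x = covers x" if "x \<in> P" "z \<sqsubseteq> x" for x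
  proof (intro set_eqI iffI)
    fix y assume "y \<in> K.covers x"
    then show "y \<in> covers x" using cardN[of y] cardN[of x] that
      by (auto simp: K.covers_def covers_def)
  next
    fix y assume y: "y \<in> covers x"
    then have "z \<sqsubseteq> y" using le_trans[of z x y] that z by (auto simp: covers_def)
    then show "y \<in> K.covers x" using cardN[of y] cardN[of x] that y
      by (auto simp: K.covers_def covers_def)
  qed
  have inc: "incidence y x = (\<kappa> y * \<kappa> x * K.incidence y x :: 'k)"
    if x: "x \<in> P" "z \<sqsubseteq> x" and y: "y \<in> covers x" for x y
  proof -
    obtain v where v: "v \<notin> N x" "N y = insert v (N x)" by (rule covers_label[OF x(1) y])
    have sub: "N z \<subseteq> N x" using N_mono z x by auto
    have d1: "N y - N z = insert v (N x - N z)" "v \<notin> N x - N z" using v sub by auto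
    have "\<kappa> y = below_sign (N z) v * \<kappa> x"
      unfolding \<kappa>_def d1(1) using d1(2) finite_N[OF x(1)] by simp
    then have 1: "\<kappa> y * \<kappa> x = below_sign (N z) v" using sq[of x] by (simp add: mult.assoc)
    have "N y - N z - (N x - N z) = {v}" using v sub by auto
    then have 2: "K.incidence y x = (below_sign (N y - N z) v :: 'k)"
      by (simp add: K.incidence_def)
    have "N y - N x = {v}" using v by auto
    then have 3: "incidence y x = (below_sign (N y) v :: 'k)" by (simp add: incidence_def)
    have "{u \<in> N y. u < v} = {u \<in> N z. u < v} \<union> {u \<in> N y - N z. u < v}" using v sub by auto
    then have "card {u \<in> N y. u < v} = card {u \<in> N z. u < v} + card {u \<in> N y - N z. u < v}"
      using finite_N[OF z] finite_N[OF x(1)] v by (simp add: card_Un_disjoint disjoint_iff)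
    then show ?thesis by (simp add: 1 2 3 below_sign_def power_add)
  qed
  have cbd: "cbd (\<lambda>y. \<kappa> y * c y) x = \<kappa> x * K.cbd c x" if x: "x \<in> P" "z \<sqsubseteq> x" for c x
  proof -
    have "cbd (\<lambda>y. \<kappa> y * c y) x = (\<Sum>y\<in>covers x. (\<kappa> y * \<kappa> y) * (\<kappa> x * (K.incidence y x * c y)))"
      unfolding cbd_def by (intro sum.cong refl) (simp add: inc[OF x] mult_ac)
    then show ?thesis by (simp add: sq K.cbd_def cov[OF x] sum_distrib_left)
  qed
  have \<kappa>2: "\<kappa> y * (\<kappa> y * a) = a" for y a by (simp add: sq flip: mult.assoc)
  show ?thesis
    unfolding cell_exact_def
  proof (intro allI impI)
    fix c :: "'a \<Rightarrow> 'k"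
    assume supp: "\<forall>y. c y \<noteq> 0 \<longrightarrow> y \<in> P \<and> z \<sqsubseteq> y \<and> card (N y) = p + card (N z)"
      and cycle: "\<forall>x\<in>P. z \<sqsubseteq> x \<longrightarrow> cbd c x = 0"
    define c' where "c' = (\<lambda>y. \<kappa> y * c y)"
    have 1: "\<forall>y. c' y \<noteq> 0 \<longrightarrow> y \<in> {y \<in> P. z \<sqsubseteq> y} \<and> z \<sqsubseteq> y \<and> card (N y - N z) = p"
      using supp cardN by (fastforce simp: c'_def)
    have 2: "\<forall>x\<in>{y \<in> P. z \<sqsubseteq> y}. z \<sqsubseteq> x \<longrightarrow> K.cbd c' x = 0"
    proof (intro ballI impI)
      fix x assume x: "x \<in> {y \<in> P. z \<sqsubseteq> y}"
      have "(\<lambda>y. \<kappa> y * c' y) = c" by (simp add: c'_def \<kappa>2)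
      then have "\<kappa> x * K.cbd c' x = 0" using cbd[of x c'] cycle x by simp
      moreover have "\<kappa> x \<noteq> 0" using sq[of x] by auto
      ultimately show "K.cbd c' x = 0" by simp
    qed
    from ex[unfolded K.cell_exact_def, THEN spec, THEN mp, OF 1, THEN mp, OF 2]
    obtain b where b: "\<forall>y. b y \<noteq> 0 \<longrightarrow> y \<in> {y \<in> P. z \<sqsubseteq> y} \<and> z \<sqsubseteq> y \<and> card (N y - N z) = Suc p"
      "\<forall>x\<in>{y \<in> P. z \<sqsubseteq> y}. z \<sqsubseteq> x \<longrightarrow> K.cbd b x = c' x"
      by (elim exE conjE)
    have supp': "y \<in> P \<and> z \<sqsubseteq> y \<and> card (N y) = Suc (p + card (N z))" if "\<kappa> y * b y \<noteq> 0" for y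
    proof -
      have "b y \<noteq> 0" using that by auto
      then have "y \<in> P" "z \<sqsubseteq> y" "card (N y - N z) = Suc p" using b(1) by auto
      then show ?thesis using cardN[of y] by simp
    qed
    have bd': "cbd (\<lambda>y. \<kappa> y * b y) x = c x" if "x \<in> P" "z \<sqsubseteq> x" for x
      using cbd[OF that, of b] b(2) that by (simp add: c'_def \<kappa>2)
    show "\<exists>b. (\<forall>y. b y \<noteq> 0 \<longrightarrow> y \<in> P \<and> z \<sqsubseteq> y \<and> card (N y) = Suc (p + card (N z))) \<and>
        (\<forall>x\<in>P. z \<sqsubseteq> x \<longrightarrow> cbd b x = c x)"
      by (intro exI[of _ "\<lambda>y. \<kappa> y * b y"] conjI allI impI ballI supp' bd')
  qed
qed

lemma cell_exact_low:
  assumes z: "z \<in> P" and "p < card (N z)"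
  shows "cell_exact TYPE('k::field) z p"
  unfolding cell_exact_def
proof (intro allI impI)
  fix c :: "'a \<Rightarrow> 'k"
  assume "\<forall>y. c y \<noteq> 0 \<longrightarrow> y \<in> P \<and> z \<sqsubseteq> y \<and> card (N y) = p"
  moreover have "card (N y) \<noteq> p" if "y \<in> P" "z \<sqsubseteq> y" for y
    using card_mono[OF finite_N[OF that(1)] N_mono[OF z that]] assms(2) by simp
  ultimately have "c y = 0" for y by blast
  then show "\<exists>b. (\<forall>y. b y \<noteq> 0 \<longrightarrow> y \<in> P \<and> z \<sqsubseteq> y \<and> card (N y) = Suc p) \<and>
      (\<forall>x\<in>P. z \<sqsubseteq> x \<longrightarrow> cbd b x = c x)"
    by (intro exI[of _ "\<lambda>_. 0"]) (simp add: cbd_def)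
qed

text \<open>The coefficients of a cycle over Laurent series are cycles over the base field.\<close>

lemma cell_exact_fls:
  assumes "cell_exact TYPE('k::field) z p"
  shows "cell_exact TYPE('k fls) z p"
  unfolding cell_exact_def
proof (intro allI impI)
  fix c :: "'a \<Rightarrow> 'k fls"
  assume supp: "\<forall>y. c y \<noteq> 0 \<longrightarrow> y \<in> P \<and> z \<sqsubseteq> y \<and> card (N y) = p"
    and cycle: "\<forall>x\<in>P. z \<sqsubseteq> x \<longrightarrow> cbd c x = 0"
  have sgn: "fls_nth (below_sign S v * f) j = below_sign S v * fls_nth f j" for S v j and f :: "'k fls"
    by (cases "even (card {u \<in> S. u < v})") (simp_all add: below_sign_def)
  have nth: "fls_nth (cbd f x) j = cbd (\<lambda>y. fls_nth (f y) j) x" for f :: "'a \<Rightarrow> 'k fls" and x j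
    by (simp add: cbd_def fls_nth_sum incidence_def sgn)
  \<comment> \<open>The last clause selects the zero chain wherever the cycle has no coefficients,
    so the chosen chains vanish below a fixed exponent and form Laurent series.\<close>
  define Q where "Q = (\<lambda>j b. (\<forall>y. b y \<noteq> 0 \<longrightarrow> y \<in> P \<and> z \<sqsubseteq> y \<and> card (N y) = Suc p) \<and>
      (\<forall>x\<in>P. z \<sqsubseteq> x \<longrightarrow> cbd b x = fls_nth (c x) j) \<and>
      ((\<forall>x. fls_nth (c x) j = 0) \<longrightarrow> b = (\<lambda>_. 0)))"
  have "\<exists>b. Q j b" for j
  proof (cases "\<forall>x. fls_nth (c x) j = 0")
    case True
    then show ?thesis by (intro exI[of _ "\<lambda>_. 0"]) (simp add: Q_def cbd_def)
  next
    case False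
    have 1: "\<forall>y. fls_nth (c y) j \<noteq> 0 \<longrightarrow> y \<in> P \<and> z \<sqsubseteq> y \<and> card (N y) = p"
      using supp by (metis fls_zero_nth)
    have 2: "\<forall>x\<in>P. z \<sqsubseteq> x \<longrightarrow> cbd (\<lambda>y. fls_nth (c y) j) x = 0"
      using cycle by (simp flip: nth)
    obtain b where "\<forall>y. b y \<noteq> 0 \<longrightarrow> y \<in> P \<and> z \<sqsubseteq> y \<and> card (N y) = Suc p"
      "\<forall>x\<in>P. z \<sqsubseteq> x \<longrightarrow> cbd b x = fls_nth (c x) j"
      using assms[unfolded cell_exact_def, THEN spec, THEN mp, OF 1, THEN mp, OF 2] by blast
    with False have "Q j b" unfolding Q_def by blast
    then show ?thesis by (rule exI[where P = "Q j"])
  qed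
  then obtain B where B: "\<And>j. Q j (B j)" by metis
  define m where "m = Min (insert 0 (fls_subdegree ` c ` P))"
  have low: "fls_nth (c x) j = 0" if "j < m" for x j
  proof (cases "x \<in> P")
    case True
    then have "m \<le> fls_subdegree (c x)" using finite_P by (auto simp: m_def)
    then show ?thesis using that by simp
  next
    case False
    then show ?thesis using supp by (metis fls_zero_nth)
  qed
  define b where "b = (\<lambda>y. Abs_fls (\<lambda>j. B j y))"
  have b: "fls_nth (b y) j = B j y" for y j
    unfolding b_def
  proof (rule nth_Abs_fls_lower_bound[of m])
    show "\<forall>i<m. B i y = 0" using low B unfolding Q_def by metis
  qed
  have "y \<in> P \<and> z \<sqsubseteq> y \<and> card (N y) = Suc p" if "b y \<noteq> 0" for y
  proof -
    have "\<exists>j. fls_nth (b y) j \<noteq> 0"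
    proof (rule ccontr)
      assume "\<not> (\<exists>j. fls_nth (b y) j \<noteq> 0)"
      then have "b y = 0" by (intro fls_eqI) simp
      with that show False by simp
    qed
    then obtain j where "fls_nth (b y) j \<noteq> 0" by blast
    then show ?thesis using B[of j] by (auto simp: b Q_def)
  qed
  moreover have "cbd b x = c x" if "x \<in> P" "z \<sqsubseteq> x" for x
  proof (rule fls_eqI)
    show "fls_nth (cbd b x) j = fls_nth (c x) j" for j
      using B[of j] that by (simp add: nth b Q_def)
  qed
  ultimately show "\<exists>b. (\<forall>y. b y \<noteq> 0 \<longrightarrow> y \<in> P \<and> z \<sqsubseteq> y \<and> card (N y) = Suc p) \<and>
      (\<forall>x\<in>P. z \<sqsubseteq> x \<longrightarrow> cbd b x = c x)"
    by blast
qed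

lemma card_faces_below:
  assumes "y \<in> P"
  shows "card {x \<in> P. x \<sqsubseteq> y \<and> card (N x) = i} = card (N y) choose i"
proof -
  have "bij_betw N {x \<in> P. x \<sqsubseteq> y \<and> card (N x) = i} {S. S \<subseteq> N y \<and> card S = i}"
  proof (rule bij_betw_byWitness[where f' = "face y"])
    show "\<forall>x\<in>{x \<in> P. x \<sqsubseteq> y \<and> card (N x) = i}. face y (N x) = x"
      using face_unique[OF assms] by auto
    show "\<forall>S\<in>{S. S \<subseteq> N y \<and> card S = i}. N (face y S) = S"
      using face(3)[OF assms] by auto
    show "N ` {x \<in> P. x \<sqsubseteq> y \<and> card (N x) = i} \<subseteq> {S. S \<subseteq> N y \<and> card S = i}"
      using N_mono assms by blast
    show "face y ` {S. S \<subseteq> N y \<and> card S = i} \<subseteq> {x \<in> P. x \<sqsubseteq> y \<and> card (N x) = i}"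
      using face[OF assms] by auto
  qed
  from bij_betw_same_card[OF this] show ?thesis
    by (simp add: n_subsets[OF finite_N[OF assms]])
qed

end

section \<open>The h-vector of a Cohen--Macaulay simplicial poset\<close>

text \<open>The atoms are numbered injectively, and \<open>N y\<close> is the set of numbers of the
  atoms below \<open>y\<close>. In a Boolean interval each element is determined by the atoms below
  it, and every set of atoms occurs.\<close>

lemma simplicial_poset_labelled:
  assumes "simplicial_poset P r z"
  obtains N where "pointed_labelled_poset P (\<lambda>x y. (x, y) \<in> r) N z"
proof -
  have fin: "finite P" and po: "partial_order_on P r" and z: "z \<in> P" "\<And>y. y \<in> P \<Longrightarrow> (z, y) \<in> r"
    and iso: "\<And>y. y \<in> P \<Longrightarrow> \<exists>k::nat. poset_isomorphic (interval P r z y) r (Pow {1..k}) {(A, B). A \<subseteq> B}"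
    using assms by (auto simp: simplicial_poset_def is_minimum_def)
  have refl: "\<And>x. x \<in> P \<Longrightarrow> (x, x) \<in> r" and anti: "\<And>x y. (x, y) \<in> r \<Longrightarrow> (y, x) \<in> r \<Longrightarrow> x = y"
    and tr: "\<And>x y u. (x, y) \<in> r \<Longrightarrow> (y, u) \<in> r \<Longrightarrow> (x, u) \<in> r"
    using po by (auto simp: partial_order_on_def preorder_on_def refl_on_def antisym_def trans_def)
  define A where "A = {v \<in> P. v \<noteq> z \<and> (\<forall>u\<in>P. (u, v) \<in> r \<longrightarrow> u = z \<or> u = v)}"
  have finA: "finite A" using fin by (simp add: A_def)
  obtain idx :: "'a \<Rightarrow> nat" where idx: "inj_on idx A"
    using finite_imp_inj_to_nat_seg[OF finA] by blast
  define ats where "ats = (\<lambda>y. {v \<in> A. (v, y) \<in> r})"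
  \<comment> \<open>The isomorphism onto the Boolean lattice takes the atoms below \<open>x\<close>
    to the singletons inside \<open>f x\<close>; being an atom of the interval and being one of
    \<open>P\<close> agree, as the interval is closed downwards.\<close>
  have atoms: "\<exists>f k. bij_betw f (interval P r z y) (Pow {1..k::nat}) \<and>
      (\<forall>x\<in>interval P r z y. \<forall>x'\<in>interval P r z y. (x, x') \<in> r \<longleftrightarrow> f x \<subseteq> f x') \<and>
      (\<forall>x\<in>interval P r z y. f ` ats x = (\<lambda>j. {j}) ` f x)" if y: "y \<in> P" for y
  proof -
    let ?I = "interval P r z y"
    obtain f k where f: "bij_betw f ?I (Pow {1..k::nat})"
      "\<And>x x'. x \<in> ?I \<Longrightarrow> x' \<in> ?I \<Longrightarrow> (x, x') \<in> r \<longleftrightarrow> f x \<subseteq> f x'"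
      using iso[OF y] unfolding poset_isomorphic_def by auto
    have I: "x \<in> ?I \<longleftrightarrow> x \<in> P \<and> (x, y) \<in> r" for x using z by (auto simp: interval_def)
    have inj: "f x = f x' \<Longrightarrow> x = x'" if "x \<in> ?I" "x' \<in> ?I" for x x'
      using f(1) that by (auto simp: bij_betw_def inj_on_def)
    have surj: "\<exists>x\<in>?I. f x = S" if "S \<subseteq> {1..k}" for S
    proof -
      have "S \<in> f ` ?I" using that by (simp add: bij_betw_imp_surj_on[OF f(1)])
      then show ?thesis by blast
    qed
    have zI: "z \<in> ?I" using I z y by blast
    have fz: "f z = {}"
    proof -
      obtain x where "x \<in> ?I" "f x = {}" using surj[of "{}"] by blast
      then show ?thesis using f(2)[OF zI, of x] z I by auto
    qed
    have img: "f ` ats x = (\<lambda>j. {j}) ` f x" if x: "x \<in> ?I" for x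
    proof (intro set_eqI iffI)
      fix S assume "S \<in> f ` ats x"
      then obtain v where v: "v \<in> A" "(v, x) \<in> r" "S = f v" by (auto simp: ats_def)
      have vI: "v \<in> ?I" using v x I tr by (auto simp: A_def)
      have "f v \<noteq> {}" using inj[OF vI zI] fz v(1) by (auto simp: A_def)
      then obtain j where j: "j \<in> f v" by blast
      have "f v \<subseteq> {1..k}" using f(1) vI by (auto simp: bij_betw_def)
      then obtain u where u: "u \<in> ?I" "f u = {j}" using surj[of "{j}"] j by blast
      have "(u, v) \<in> r" using f(2)[OF u(1) vI] u j by simp
      then have "u = v" using v(1) u fz I by (auto simp: A_def)
      moreover have "j \<in> f x" using f(2)[OF vI x] v(2) j by blast
      ultimately show "S \<in> (\<lambda>j. {j}) ` f x" using u v by blast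
    next
      fix S assume "S \<in> (\<lambda>j. {j}) ` f x"
      then obtain j where j: "j \<in> f x" "S = {j}" by blast
      have "f x \<subseteq> {1..k}" using f(1) x by (auto simp: bij_betw_def)
      then obtain u where u: "u \<in> ?I" "f u = {j}" using surj[of "{j}"] j by blast
      have "(u, x) \<in> r" using f(2)[OF u(1) x] u j by simp
      moreover have "u \<in> A"
        unfolding A_def mem_Collect_eq
      proof (intro conjI ballI impI)
        show "u \<in> P" using u I by blast
        show "u \<noteq> z" using u fz by auto
        fix w assume w: "w \<in> P" "(w, u) \<in> r"
        then have wI: "w \<in> ?I" using I u tr by blast
        then have "f w \<subseteq> {j}" using f(2)[OF wI u(1)] w u by simp
        then have "f w = {} \<or> f w = {j}" by blast
        then show "w = z \<or> w = u" using inj[OF wI zI] inj[OF wI u(1)] fz u by auto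
      qed
      ultimately show "S \<in> f ` ats x" using u j by (auto simp: ats_def)
    qed
    show ?thesis by (intro exI[of _ f] exI[of _ k] conjI ballI f(1) f(2) img)
  qed
  define N where "N = (\<lambda>y. idx ` ats y)"
  have ats_mono: "ats x \<subseteq> ats y" if "(x, y) \<in> r" for x y using that tr by (auto simp: ats_def)
  have "pointed_labelled_poset P (\<lambda>x y. (x, y) \<in> r) N z"
  proof
    show "finite (N y)" for y using finA by (simp add: N_def ats_def)
    show "N x \<subseteq> N y" if "(x, y) \<in> r" for x y using ats_mono[OF that] by (auto simp: N_def)
    show "N z = {}" using z anti by (auto simp: N_def ats_def A_def)
    fix y S assume y: "y \<in> P" and S: "S \<subseteq> N y"
    let ?I = "interval P r z y"
    obtain f k where f: "bij_betw f ?I (Pow {1..k::nat})"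
      "\<forall>x\<in>?I. \<forall>x'\<in>?I. (x, x') \<in> r \<longleftrightarrow> f x \<subseteq> f x'" "\<forall>x\<in>?I. f ` ats x = (\<lambda>j. {j}) ` f x"
      using atoms[OF y] by (elim exE conjE)
    have I: "x \<in> ?I \<longleftrightarrow> x \<in> P \<and> (x, y) \<in> r" for x using z by (auto simp: interval_def)
    have injI: "inj_on f ?I" using f(1) by (simp add: bij_betw_def)
    have atI: "ats x \<subseteq> ?I" if "x \<in> ?I" for x using that I tr by (auto simp: ats_def A_def)
    have yI: "y \<in> ?I" using I y refl by blast
    obtain S' where S': "S' \<subseteq> ats y" "S = idx ` S'" using S unfolding N_def by (meson subset_imageE)
    define J where "J = {j. {j} \<in> f ` S'}"
    have fS': "f ` S' = (\<lambda>j. {j}) ` J"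
    proof -
      have "f ` S' \<subseteq> (\<lambda>j. {j}) ` f y" using S'(1) f(3) yI by blast
      then have *: "\<exists>j. F = {j}" if "F \<in> f ` S'" for F using that by (meson imageE subsetD)
      show ?thesis
      proof (intro set_eqI iffI)
        fix F assume F: "F \<in> f ` S'"
        with * obtain j where "F = {j}" by metis
        with F show "F \<in> (\<lambda>j. {j}) ` J" unfolding J_def by blast
      next
        fix F assume "F \<in> (\<lambda>j. {j}) ` J"
        then show "F \<in> f ` S'" unfolding J_def by blast
      qed
    qed
    have "J \<subseteq> {1..k}"
    proof
      fix j assume "j \<in> J"
      then have "{j} \<in> f ` ?I" using S'(1) atI[OF yI] unfolding J_def by blast
      then show "j \<in> {1..k}" using f(1) by (auto simp: bij_betw_def)
    qed
    then have "J \<in> f ` ?I" using f(1) by (auto simp: bij_betw_def)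
    then obtain x where x: "x \<in> ?I" "f x = J" by blast
    have "f ` ats x = f ` S'" using f(3) x fS' by simp
    then have "ats x = S'"
      using inj_on_image_eq_iff[OF injI atI[OF x(1)], of S'] S'(1) atI[OF yI] by blast
    then have "x \<in> P \<and> (x, y) \<in> r \<and> N x = S" using x I S' by (simp add: N_def)
    moreover have "u = x" if u: "u \<in> P \<and> (u, y) \<in> r \<and> N u = S" for u
    proof -
      have uI: "u \<in> ?I" using u I by blast
      have "idx ` ats u = idx ` ats x" using u S' \<open>ats x = S'\<close> by (simp add: N_def)
      then have "ats u = ats x"
        by (subst (asm) inj_on_image_eq_iff[OF idx]) (auto simp: ats_def)
      then have "(\<lambda>j. {j}) ` f u = (\<lambda>j. {j}) ` f x" using f(3) uI x(1) by metis
      then have "f u = f x" by (subst (asm) inj_image_eq_iff) (auto simp: inj_on_def)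
      then show ?thesis using injI uI x(1) by (auto simp: inj_on_def)
    qed
    ultimately show "\<exists>!x. x \<in> P \<and> (x, y) \<in> r \<and> N x = S" by blast
  qed (use fin z refl in \<open>auto intro: anti tr\<close>)
  then show ?thesis by (rule that)
qed

section \<open>Ranks, saturated chains and their links\<close>

context pointed_labelled_poset
begin

definition K :: "'a set set" where "K = order_complex P R"

lemma mem_K: "F \<in> K \<longleftrightarrow> F \<subseteq> P \<and> (\<forall>x\<in>F. \<forall>y\<in>F. x \<sqsubseteq> y \<or> y \<sqsubseteq> x)"
  by (auto simp: K_def order_complex_def Chains_def)

lemma finite_K: "finite K" "F \<in> K \<Longrightarrow> finite F"
  by (rule finite_subset[of _ "Pow P"], auto simp: mem_K finite_P intro: finite_subset)

lemma card_chain_below: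
  assumes y: "y \<in> P" and C: "C \<in> K" "\<And>x. x \<in> C \<Longrightarrow> x \<sqsubseteq> y"
  shows "card C \<le> Suc (card (N y))"
proof -
  have "inj_on (\<lambda>x. card (N x)) C"
  proof (rule inj_onI)
    fix x x' assume x: "x \<in> C" "x' \<in> C" "card (N x) = card (N x')"
    then have "x \<in> P" "x' \<in> P" "x \<sqsubseteq> x' \<or> x' \<sqsubseteq> x" using C(1) by (auto simp: mem_K)
    then show "x = x'" using eq_of_card[of x x'] eq_of_card[of x' x] x(3) by auto
  qed
  moreover have "(\<lambda>x. card (N x)) ` C \<subseteq> {..card (N y)}"
  proof
    fix m assume "m \<in> (\<lambda>x. card (N x)) ` C"
    then obtain x where x: "x \<in> C" "m = card (N x)" by blast
    have "N x \<subseteq> N y" using C x(1) y by (intro N_mono) (auto simp: mem_K)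
    then show "m \<in> {..card (N y)}" using card_mono[OF finite_N[OF y]] x(2) by simp
  qed
  ultimately show ?thesis
    by (metis card_atMost card_inj_on_le finite_atMost)
qed

lemma saturated_chain:
  assumes "y \<in> P"
  obtains C where "C \<in> K" "\<And>x. x \<in> C \<Longrightarrow> x \<sqsubseteq> y" "y \<in> C" "z \<in> C" "card C = Suc (card (N y))"
proof -
  have "\<exists>C\<in>K. (\<forall>x\<in>C. x \<sqsubseteq> y) \<and> y \<in> C \<and> z \<in> C \<and> card C = Suc (card (N y))"
    using assms
  proof (induction "card (N y)" arbitrary: y)
    case (0 y)
    then have "y = z" using N_eq_empty finite_N by simp
    then show ?case using z_in le_refl N_z by (intro bexI[of _ "{z}"]) (auto simp: mem_K)
  next
    case (Suc p y)
    then have "N y \<noteq> {}" by auto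
    then obtain v where v: "v \<in> N y" by blast
    define x where "x = face y (N y - {v})"
    note f = facet[OF Suc.prems v, folded x_def]
    have "p = card (N x)" using f(3) v Suc.hyps(2) finite_N[OF Suc.prems] by simp
    from Suc.hyps(1)[OF this f(1)] obtain C where
      C: "C \<in> K" "\<And>u. u \<in> C \<Longrightarrow> u \<sqsubseteq> x" "z \<in> C" "card C = Suc (card (N x))" by blast
    have le: "u \<sqsubseteq> y" if "u \<in> C" for u
      using le_trans[of u x y] C(1,2) that f Suc.prems by (auto simp: mem_K)
    have "y \<notin> C" using C(2)[of y] f le_antisym[of x y] Suc.prems by auto
    then have "card (insert y C) = Suc (card (N y))"
      using C(4) finite_K(2)[OF C(1)] \<open>p = card (N x)\<close> Suc.hyps(2) by simp
    moreover have "insert y C \<in> K" using C(1) le Suc.prems le_refl by (auto simp: mem_K)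
    ultimately show ?case
      using le C(3) Suc.prems le_refl by (intro bexI[of _ "insert y C"]) auto
  qed
  then show ?thesis using that by blast
qed

lemma rank_of_eq: "y \<in> P \<Longrightarrow> rank_of P R z y = card (N y)"
proof -
  assume y: "y \<in> P"
  have oc: "order_complex (interval P R z y) R = {C \<in> K. \<forall>x\<in>C. x \<sqsubseteq> y}"
    using z_le by (auto simp: order_complex_def interval_def Chains_def mem_K)
  obtain C where C: "C \<in> K" "\<And>x. x \<in> C \<Longrightarrow> x \<sqsubseteq> y" "card C = Suc (card (N y))"
    by (rule saturated_chain[OF y]) blast
  have "Max (card ` {C \<in> K. \<forall>x\<in>C. x \<sqsubseteq> y}) = Suc (card (N y))"
  proof (rule Max_eqI)
    show "finite (card ` {C \<in> K. \<forall>x\<in>C. x \<sqsubseteq> y})" using finite_K by simp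
    show "Suc (card (N y)) \<in> card ` {C \<in> K. \<forall>x\<in>C. x \<sqsubseteq> y}"
      using C by (intro image_eqI[of _ _ C]) auto
  qed (use card_chain_below[OF y] in auto)
  then show ?thesis by (simp add: rank_of_def oc)
qed

lemma maximal_chain:
  assumes "graded_of_rank P R n" "C \<in> K"
  obtains D where "D \<in> K" "C \<subseteq> D" "card D = n + 1"
proof -
  have ne: "finite {D \<in> K. C \<subseteq> D}" "{D \<in> K. C \<subseteq> D} \<noteq> {}" using finite_K assms(2) by auto
  from finite_has_maximal[OF ne]
  obtain D where D: "D \<in> {D \<in> K. C \<subseteq> D}" "\<forall>E\<in>{D \<in> K. C \<subseteq> D}. D \<subseteq> E \<longrightarrow> D = E"
    by (elim bexE)
  then have DK: "D \<in> K" "C \<subseteq> D" by auto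
  have "\<forall>E\<in>K. D \<subseteq> E \<longrightarrow> E = D"
  proof (intro ballI impI)
    fix E assume E: "E \<in> K" "D \<subseteq> E"
    then have "E \<in> {D \<in> K. C \<subseteq> D}" using DK by auto
    from D(2)[THEN bspec, THEN mp, OF this E(2)] show "E = D" by (rule sym)
  qed
  then have "card D = n + 1"
    using assms(1) DK(1) unfolding graded_of_rank_def K_def by simp
  then show ?thesis using that[OF DK] by simp
qed

lemma card_N_le: "graded_of_rank P R n \<Longrightarrow> y \<in> P \<Longrightarrow> card (N y) \<le> n"
proof -
  assume g: "graded_of_rank P R n" and y: "y \<in> P"
  obtain C where C: "C \<in> K" "card C = Suc (card (N y))" by (rule saturated_chain[OF y]) blast
  obtain D where D: "D \<in> K" "C \<subseteq> D" "card D = n + 1" by (rule maximal_chain[OF g C(1)])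
  show ?thesis using card_mono[OF finite_K(2)[OF D(1)] D(2)] C D by simp
qed

text \<open>A saturated chain up to \<open>y\<close> admits no further element below
  \<open>y\<close>, so its link sees exactly what lies strictly above \<open>y\<close>. Thus the
  hypothesis on links yields the homology above each face.\<close>

lemma link_saturated_chain:
  assumes y: "y \<in> P" and C: "C \<in> K" "\<And>x. x \<in> C \<Longrightarrow> x \<sqsubseteq> y" "y \<in> C" "card C = Suc (card (N y))"
  shows "link K C = order_complex ({u \<in> P. y \<sqsubseteq> u} - {y}) R"
proof (intro set_eqI iffI)
  fix G assume "G \<in> link K C"
  then have G: "G \<in> K" "G \<inter> C = {}" "G \<union> C \<in> K" by (auto simp: link_def)
  have "y \<sqsubseteq> g \<and> g \<noteq> y" if g: "g \<in> G" for g
  proof -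
    have "\<not> g \<sqsubseteq> y"
    proof
      assume "g \<sqsubseteq> y"
      then have "card (insert g C) \<le> Suc (card (N y))"
        using G(3) C g by (intro card_chain_below[OF y]) (auto simp: mem_K)
      moreover have "g \<notin> C" using G(2) g by blast
      ultimately show False using C(4) finite_K(2)[OF C(1)] by simp
    qed
    moreover have "y \<sqsubseteq> g \<or> g \<sqsubseteq> y" using G(3) g C(3) by (auto simp: mem_K)
    ultimately show ?thesis using le_refl[OF y] by auto
  qed
  then show "G \<in> order_complex ({u \<in> P. y \<sqsubseteq> u} - {y}) R"
    using G(1) by (auto simp: mem_K order_complex_def Chains_def)
next
  fix G assume "G \<in> order_complex ({u \<in> P. y \<sqsubseteq> u} - {y}) R"
  then have G: "\<And>g. g \<in> G \<Longrightarrow> g \<in> P \<and> y \<sqsubseteq> g \<and> g \<noteq> y" "\<And>g h. g \<in> G \<Longrightarrow> h \<in> G \<Longrightarrow> g \<sqsubseteq> h \<or> h \<sqsubseteq> g"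
    by (auto simp: order_complex_def Chains_def)
  have le: "x \<sqsubseteq> g" if "x \<in> C" "g \<in> G" for x g
    using le_trans[of x y g] C G(1)[OF that(2)] that(1) y by (auto simp: mem_K)
  have "G \<inter> C = {}" using G(1) C(2) le_antisym y by blast
  moreover have "G \<in> K" using G by (auto simp: mem_K)
  moreover have "G \<union> C \<in> K" using G le C(1) by (auto simp: mem_K)
  ultimately show "G \<in> link K C" by (simp add: link_def)
qed

lemma cell_exact_of_cohen_macaulay:
  assumes g: "graded_of_rank P R n" and cm: "cohen_macaulay_poset TYPE('k::field) P R"
    and y: "y \<in> P" and p: "p < n"
  shows "cell_exact TYPE('k) y p"
proof (cases "p < card (N y)")
  case True
  then show ?thesis by (rule cell_exact_low[OF y])
next
  case False
  obtain C where C: "C \<in> K" "\<And>x. x \<in> C \<Longrightarrow> x \<sqsubseteq> y" "y \<in> C" "card C = Suc (card (N y))"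
    by (rule saturated_chain[OF y]) blast
  interpret Q: pointed_labelled_poset "{u \<in> P. y \<sqsubseteq> u}" "(\<sqsubseteq>)" "\<lambda>u. N u - N y" y
    by (rule link_pointed[OF y])
  have QL: "Q.L = link K C"
    using link_saturated_chain[OF y C] by (simp add: Q.L_def)
  \<comment> \<open>Extending \<open>C\<close> to a maximal chain bounds the dimension of the link
    from below, which places the required degree in the range of the hypothesis.\<close>
  obtain D where D: "D \<in> K" "C \<subseteq> D" "card D = n + 1" by (rule maximal_chain[OF g C(1)])
  have "D - C \<in> link K C"
    using D C(1) by (auto simp: link_def mem_K)
  moreover have "card (D - C) = n - card (N y)"
    using D C finite_K(2)[OF C(1)] by (simp add: card_Diff_subset)
  moreover have "finite (link K C)" using finite_K by (simp add: link_def)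
  ultimately have "n - card (N y) \<le> max_face_size (link K C)"
    unfolding max_face_size_def by (metis Max_ge finite_imageI imageI)
  then have dim: "int (p - card (N y)) - 1 < complex_dim (link K C)"
    using p False by (simp add: complex_dim_def)
  have "reduced_homology_zero TYPE('k) R (link K C) (int (p - card (N y)) - 1)"
    using cm C(1) dim unfolding cohen_macaulay_poset_def cohen_macaulay_complex_def K_def by blast
  then have "Q.cell_exact TYPE('k) y (p - card (N y))"
    by (intro Q.cell_exact_of_homology) (simp add: QL)
  then have "cell_exact TYPE('k) y (p - card (N y) + card (N y))"
    by (rule cell_exact_link[OF y])
  then show ?thesis using False by simp
qed

text \<open>The entry \<open>h_k\<close> of the h-vector; \<open>num_faces i\<close> is the number
  usually written \<open>f_{i-1}\<close>.\<close>

definition h_entry :: "nat \<Rightarrow> nat \<Rightarrow> int" where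
  "h_entry n k = (\<Sum>i\<le>k. (- 1) ^ (k - i) * int ((n - i) choose (k - i)) * int (num_faces i))"

theorem h_entry_nonneg:
  assumes g: "graded_of_rank P R n" and cm: "cohen_macaulay_poset TYPE('k::field) P R" and k: "k \<le> n"
  shows "0 \<le> h_entry n k"
proof -
  \<comment> \<open>The powers of the indeterminate are infinitely many distinct scalars, even over
    a finite field.\<close>
  have "inj (\<lambda>s. (fls_X :: 'k fls) ^ s)"
  proof (rule injI)
    fix s t :: nat assume "(fls_X :: 'k fls) ^ s = fls_X ^ t"
    then have "fls_nth ((fls_X :: 'k fls) ^ s) (int s) = fls_nth (fls_X ^ t) (int s)" by simp
    then show "s = t" by (simp split: if_splits)
  qed
  then have "0 \<le> (\<Sum>i\<le>n. (- 1) ^ (n - i) * int (num_faces i) * ((- 1) ^ (n - k) * int ((n - i) choose (n - k))))"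
    by (rule num_faces_alternating_nonneg)
      (intro cell_exact_fls cell_exact_of_cohen_macaulay[OF g cm])
  also have "\<dots> = (\<Sum>i\<le>k. (- 1) ^ (n - i) * int (num_faces i) * ((- 1) ^ (n - k) * int ((n - i) choose (n - k))))"
    using k by (intro sum.mono_neutral_right) (auto simp: binomial_eq_0)
  also have "\<dots> = h_entry n k"
    unfolding h_entry_def
  proof (intro sum.cong refl)
    fix i assume i: "i \<in> {..k}"
    have "n - i = (n - k) + (k - i)" using i k by auto
    then have "(- 1) ^ (n - i) * (- 1) ^ (n - k) = ((- 1) ^ (k - i) :: int)"
      by (simp add: power_add flip: power_mult_distrib)
    note sgn = this
    have "(- 1) ^ (n - i) * int (num_faces i) * ((- 1) ^ (n - k) * c)
      = ((- 1) ^ (n - i) * (- 1) ^ (n - k)) * c * int (num_faces i)" for c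
      by (simp only: mult_ac)
    note this[unfolded sgn]
    moreover have "(n - i) choose (n - k) = (n - i) choose (k - i)"
      using binomial_symmetric[of "n - k" "n - i"] i k by simp
    ultimately show "(- 1) ^ (n - i) * int (num_faces i) * ((- 1) ^ (n - k) * int ((n - i) choose (n - k)))
      = (- 1) ^ (k - i) * int ((n - i) choose (k - i)) * int (num_faces i)"
      by (simp only:)
  qed
  finally show ?thesis .
qed

end

section \<open>Interlacing on the upper half plane\<close>

definition cpoly :: "real poly \<Rightarrow> complex \<Rightarrow> complex" where
  "cpoly p z = poly (map_poly of_real p) z"

lemma cpoly_0 [simp]: "cpoly 0 z = 0"
  by (simp add: cpoly_def)

lemma cpoly_pCons [simp]: "cpoly (pCons a p) z = of_real a + z * cpoly p z"
  by (simp add: cpoly_def map_poly_pCons)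

lemma cpoly_1 [simp]: "cpoly 1 z = 1"
  by (simp add: one_pCons)

lemma cpoly_add [simp]: "cpoly (p + q) z = cpoly p z + cpoly q z"
  by (induction p q rule: poly_induct2) (simp_all add: algebra_simps)

lemma cpoly_smult [simp]: "cpoly (smult c p) z = of_real c * cpoly p z"
  by (induction p) (simp_all add: algebra_simps)

lemma cpoly_mult [simp]: "cpoly (p * q) z = cpoly p z * cpoly q z"
  by (induction p) (simp_all add: algebra_simps)

lemma cpoly_power [simp]: "cpoly (p ^ m) z = cpoly p z ^ m"
  by (induction m) simp_all

lemma cpoly_monom [simp]: "cpoly (monom c m) z = of_real c * z ^ m"
  by (induction m) (simp_all add: monom_0 monom_Suc)

lemma cpoly_sum [simp]: "cpoly (\<Sum>i\<in>I. f i) z = (\<Sum>i\<in>I. cpoly (f i) z)"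
  by (induction I rule: infinite_finite_induct) simp_all

lemma cpoly_of_real: "cpoly p (of_real x) = of_real (poly p x)"
  by (induction p) simp_all

lemma cpoly_cnj: "cpoly p (cnj z) = cnj (cpoly p z)"
  by (induction p) simp_all

lemma real_rooted_iff: "real_rooted p \<longleftrightarrow> p = 0 \<or> (\<forall>z. Im z > 0 \<longrightarrow> cpoly p z \<noteq> 0)"
proof -
  have "z \<in> \<real>" if p: "\<forall>z. Im z > 0 \<longrightarrow> cpoly p z \<noteq> 0" and z: "cpoly p z = 0" for z
  proof -
    have "\<not> Im z > 0" using p z by blast
    moreover have "cpoly p (cnj z) = 0" by (simp add: cpoly_cnj z)
    then have "\<not> Im (cnj z) > 0" using p by blast
    ultimately show ?thesis by (simp add: complex_is_Real_iff)
  qed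
  moreover have "Im z = 0" if "z \<in> \<real>" for z using that by (simp add: complex_is_Real_iff)
  ultimately show ?thesis
    unfolding real_rooted_def cpoly_def[symmetric] by (metis less_irrefl)
qed

text \<open>For values \<open>a = p(z)\<close> and \<open>b = q(z)\<close> of real-rooted polynomials at points \<open>z\<close> of the upper
  half plane, the first inequality expresses that \<open>p\<close> interlaces \<open>q\<close>, the second that \<open>q\<close> interlaces
  \<open>x p\<close>. Both are additive in \<open>p\<close> and in \<open>q\<close>.\<close>

definition prec_at :: "complex \<Rightarrow> complex \<Rightarrow> complex \<Rightarrow> bool" where
  "prec_at z a b \<longleftrightarrow> Im (b * cnj a) \<ge> 0 \<and> Im (z * a * cnj b) \<ge> 0"

lemma prec_at_0 [simp]: "prec_at z 0 b" "prec_at z a 0"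
  by (simp_all add: prec_at_def)

lemma prec_at_refl: "Im z > 0 \<Longrightarrow> prec_at z a a"
  by (simp add: prec_at_def mult.assoc complex_mult_cnj)

lemma prec_at_add_right: "prec_at z a b \<Longrightarrow> prec_at z a c \<Longrightarrow> prec_at z a (b + c)"
  by (simp add: prec_at_def algebra_simps)

lemma prec_at_add_left: "prec_at z a c \<Longrightarrow> prec_at z b c \<Longrightarrow> prec_at z (a + b) c"
  by (simp add: prec_at_def algebra_simps)

lemma prec_at_sum_right: "(\<And>i. i \<in> I \<Longrightarrow> prec_at z a (b i)) \<Longrightarrow> prec_at z a (\<Sum>i\<in>I. b i)"
  by (induction I rule: infinite_finite_induct) (simp_all add: prec_at_add_right)

lemma prec_at_sum_left: "(\<And>i. i \<in> I \<Longrightarrow> prec_at z (b i) a) \<Longrightarrow> prec_at z (\<Sum>i\<in>I. b i) a"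
  by (induction I rule: infinite_finite_induct) (simp_all add: prec_at_add_left)

lemma prec_at_scale:
  assumes "prec_at z a b" "r \<ge> 0" "s \<ge> 0"
  shows "prec_at z (of_real r * a) (of_real s * b)"
proof -
  have "of_real s * b * cnj (of_real r * a) = of_real (r * s) * (b * cnj a)"
    "z * (of_real r * a) * cnj (of_real s * b) = of_real (r * s) * (z * a * cnj b)"
    by simp_all
  moreover have "Im (of_real c * w) = c * Im w" for c w by simp
  ultimately show ?thesis using assms by (simp only: prec_at_def) simp
qed

text \<open>If \<open>b = - a\<close>, the second inequality bounds \<open>Im z * |a|^2\<close>
  above by 0.\<close>

lemma prec_at_add_eq_0:
  assumes "Im z > 0" "prec_at z a b" "a + b = 0"
  shows "a = 0" "b = 0"
proof -
  have b: "b = - a" using assms(3) by (simp add: eq_neg_iff_add_eq_0 add.commute)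
  have "z * a * cnj b = - (z * (a * cnj a))" by (simp add: b mult.assoc)
  then have "Im z * (cmod a)\<^sup>2 \<le> 0"
    using assms(2) unfolding prec_at_def by (simp add: complex_norm_square[symmetric] flip: of_real_power)
  then show "a = 0" using assms(1) by (simp add: mult_le_0_iff)
  then show "b = 0" by (simp add: b)
qed

text \<open>If \<open>b = - z a\<close>, it is the first inequality that bounds
  \<open>Im z * |a|^2\<close> above by 0.\<close>

lemma prec_at_mult_add_eq_0:
  assumes "Im z > 0" "prec_at z a b" "z * a + b = 0"
  shows "a = 0" "b = 0"
proof -
  have b: "b = - (z * a)" using assms(3) by (simp add: eq_neg_iff_add_eq_0 add.commute)
  have "b * cnj a = - (z * (a * cnj a))" by (simp add: b mult.assoc)
  then have "Im z * (cmod a)\<^sup>2 \<le> 0"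
    using assms(2) unfolding prec_at_def by (simp add: complex_norm_square[symmetric] flip: of_real_power)
  then show "a = 0" using assms(1) by (simp add: mult_le_0_iff)
  then show "b = 0" by (simp add: b)
qed

text \<open>Here \<open>a\<close>, \<open>b\<close>, \<open>c\<close> stand for the sums of the
  polynomials with index below \<open>k\<close>, from \<open>k\<close> to below \<open>l\<close>,
  and from \<open>l\<close> on; the conclusion compares the new polynomials \<open>k\<close> and
  \<open>l\<close> when the new position may be a descent. Both imaginary parts expand into the
  given nonnegative ones and squared moduli, with nonnegative coefficients.\<close>

lemma prec_at_descent_step:
  assumes z: "Im z > 0" and "prec_at z a b" "prec_at z a c" "prec_at z b c"
  shows "prec_at z (z * a + b + c) (z * a + z * b + c)"
proof -
  have 1: "Im ((z * a + z * b + c) * cnj (z * a + b + c)) =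
    Im (z * a * cnj b) + (cmod z)\<^sup>2 * Im (b * cnj a) + Im z * (cmod b)\<^sup>2 + Im (z * b * cnj c) + Im (c * cnj b)"
    unfolding cmod_power2 by (simp add: algebra_simps power2_eq_square)
  have 2: "Im (z * (z * a + b + c) * cnj (z * a + z * b + c)) =
    Im z * (cmod (z * a + c))\<^sup>2 + (cmod z)\<^sup>2 * (Im (z * a * cnj b) + Im (b * cnj a) + Im (c * cnj b)) + Im (z * b * cnj c)"
    unfolding cmod_power2 by (simp add: algebra_simps power2_eq_square)
  show ?thesis
    unfolding prec_at_def 1 2 using assms
    by (auto simp: prec_at_def intro!: add_nonneg_nonneg mult_nonneg_nonneg)
qed

text \<open>By additivity on the left, the sum of all terms but the last is still in the relation to
  the last, which reduces to two summands.\<close>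

lemma prec_at_sum_eq_0:
  assumes z: "Im z > 0" and "finite I"
    and prec: "\<And>i j. i \<in> I \<Longrightarrow> j \<in> I \<Longrightarrow> i < j \<Longrightarrow> prec_at z (a i) (a j)"
    and "(\<Sum>i\<in>I. a i) = 0" "i \<in> I"
  shows "a (i :: nat) = 0"
  using assms(2,3,4,5)
proof (induction I arbitrary: i rule: finite_linorder_max_induct)
  case (insert m I)
  have "m \<notin> I" using insert.hyps by auto
  then have s: "(\<Sum>i\<in>I. a i) + a m = 0" using insert.prems(2) insert.hyps by (simp add: add.commute)
  have p: "prec_at z (\<Sum>i\<in>I. a i) (a m)"
    using insert.hyps insert.prems(1) by (intro prec_at_sum_left) auto
  note 0 = prec_at_add_eq_0[OF z p s]
  show ?case
  proof (cases "i = m")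
    case False
    then show ?thesis using insert.IH[of i] insert.prems 0(1) by auto
  qed (use 0 in simp)
qed simp

text \<open>\<open>desc_poly T n k\<close> is the part of the Eulerian polynomial of the permutations \<open>w\<close> of
  \<open>{1..n+1}\<close> with \<open>w (n + 1) = n + 1 - k\<close>.\<close>

primrec desc_poly :: "nat set \<Rightarrow> nat \<Rightarrow> nat \<Rightarrow> real poly" where
  "desc_poly T 0 k = (if k = 0 then 1 else 0)"
| "desc_poly T (Suc n) k = (if Suc n \<in> T then monom 1 1 * (\<Sum>i<k. desc_poly T n i) else 0)
     + (\<Sum>i\<in>{k..n}. desc_poly T n i)"

lemma desc_poly_prec_at:
  assumes z: "Im z > 0" and "k \<le> l" "l \<le> n"
  shows "prec_at z (cpoly (desc_poly T n k) z) (cpoly (desc_poly T n l) z)"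
  using assms(2,3)
proof (induction n arbitrary: k l)
  case 0
  then show ?case using z by (simp add: prec_at_refl)
next
  case (Suc n)
  let ?a = "\<lambda>i. cpoly (desc_poly T n i) z"
  have IH: "prec_at z (?a i) (?a j)" if "i \<le> j" "j \<le> n" for i j using Suc.IH that by blast
  define A B C where "A = (\<Sum>i<k. ?a i)" and "B = (\<Sum>i\<in>{k..<l}. ?a i)" and "C = (\<Sum>i\<in>{l..n}. ?a i)"
  have AB: "prec_at z A B" and AC: "prec_at z A C" and BC: "prec_at z B C"
    unfolding A_def B_def C_def using Suc.prems
    by (auto intro!: prec_at_sum_left prec_at_sum_right IH)
  have 1: "(\<Sum>i\<in>{k..n}. ?a i) = B + C"
  proof -
    have "{k..n} = {k..<l} \<union> {l..n}" using Suc.prems by auto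
    then show ?thesis unfolding B_def C_def by (simp add: sum.union_disjoint ivl_disj_int)
  qed
  have 2: "(\<Sum>i<l. ?a i) = A + B"
  proof -
    have "{..<l} = {..<k} \<union> {k..<l}" using Suc.prems by auto
    then show ?thesis unfolding A_def B_def by (simp add: sum.union_disjoint ivl_disj_int)
  qed
  show ?case
  proof (cases "Suc n \<in> T")
    case True
    have "cpoly (desc_poly T (Suc n) k) z = z * A + B + C"
      using True by (simp add: 1 A_def[symmetric])
    moreover have "cpoly (desc_poly T (Suc n) l) z = z * A + z * B + C"
      using True by (simp add: 2 C_def[symmetric] algebra_simps)
    ultimately show ?thesis using prec_at_descent_step[OF z AB AC BC] by simp
  next
    case False
    have "cpoly (desc_poly T (Suc n) k) z = B + C" "cpoly (desc_poly T (Suc n) l) z = C"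
      using False by (simp_all add: 1 C_def[symmetric])
    then show ?thesis using prec_at_add_left[OF BC prec_at_refl[OF z]] by simp
  qed
qed

text \<open>Some of these polynomials are identically zero, for instance index \<open>k = n\<close>
  when \<open>n > 0\<close> is not in \<open>T\<close>. So a zero in the upper half plane is traced
  down the recursion until every polynomial that contributes is seen to be zero.\<close>

lemma desc_poly_nonvanishing:
  assumes z: "Im z > 0" and "k \<le> n" "cpoly (desc_poly T n k) z = 0"
  shows "desc_poly T n k = 0"
  using assms(2,3)
proof (induction n arbitrary: k)
  case 0
  then show ?case by (auto split: if_splits)
next
  case (Suc n)
  let ?a = "\<lambda>i. cpoly (desc_poly T n i) z"
  have prec: "prec_at z (?a i) (?a j)" if "i \<le> j" "j \<le> n" for i j
    using desc_poly_prec_at[OF z that] .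
  have zero: "desc_poly T n i = 0" if "(\<Sum>i\<in>I. ?a i) = 0" "I \<subseteq> {..n}" "i \<in> I" for I i
  proof -
    have "finite I" using that(2) finite_subset by blast
    then have "?a i = 0"
      using that by (intro prec_at_sum_eq_0[OF z, of I ?a]) (auto intro!: prec)
    then show ?thesis using Suc.IH[of i] that by auto
  qed
  define A D where "A = (\<Sum>i<k. ?a i)" and "D = (\<Sum>i\<in>{k..n}. ?a i)"
  have AD: "prec_at z A D"
    unfolding A_def D_def using Suc.prems by (auto intro!: prec_at_sum_left prec_at_sum_right prec)
  have "(Suc n \<in> T \<longrightarrow> A = 0) \<and> D = 0"
  proof (cases "Suc n \<in> T")
    case True
    then have "z * A + D = 0" using Suc.prems by (simp add: A_def D_def)
    then show ?thesis using prec_at_mult_add_eq_0[OF z AD] by blast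
  next
    case False
    then show ?thesis using Suc.prems by (simp add: D_def)
  qed
  note 0 = this
  have "desc_poly T n i = 0" if "Suc n \<in> T" "i < k" for i
  proof (rule zero[of "{..<k}"])
    show "(\<Sum>i<k. ?a i) = 0" using 0 that by (simp add: A_def)
    show "{..<k} \<subseteq> {..n}" using Suc.prems(1) by auto
  qed (use that in simp)
  moreover have "desc_poly T n i = 0" if "i \<in> {k..n}" for i
  proof (rule zero[of "{k..n}"])
    show "(\<Sum>i\<in>{k..n}. ?a i) = 0" using 0 by (simp add: D_def)
  qed (use that in auto)
  ultimately show ?case by (simp add: sum.neutral)
qed

section \<open>Nonnegative combinations\<close>

lemma coeff_sum_nonneg: "(\<And>i. i \<in> I \<Longrightarrow> 0 \<le> coeff (f i) m) \<Longrightarrow> 0 \<le> coeff (\<Sum>i\<in>I. f i :: real poly) m"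
  by (simp add: coeff_sum sum_nonneg)

lemma desc_poly_coeff_nonneg: "0 \<le> coeff (desc_poly T n k) m"
proof (induction n arbitrary: k m)
  case (Suc n)
  have "0 \<le> coeff (monom 1 1 * (\<Sum>i<k. desc_poly T n i)) m"
    using Suc by (cases m) (auto simp: monom_Suc monom_0 coeff_sum intro!: sum_nonneg)
  then show ?case using Suc by (auto intro!: add_nonneg_nonneg coeff_sum_nonneg)
qed (auto simp: coeff_1)

definition comb :: "nat set \<Rightarrow> nat \<Rightarrow> (nat \<Rightarrow> real) \<Rightarrow> real poly" where
  "comb T n h = (\<Sum>k\<le>n. smult (h k) (desc_poly T n k))"

text \<open>At a zero in the upper half plane every summand vanishes, and then each is the zero
  polynomial; so the combination has no such zero unless it is 0.\<close>

lemma comb_real_rooted: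
  assumes "\<And>k. k \<le> n \<Longrightarrow> 0 \<le> h k"
  shows "real_rooted (comb T n h)"
proof (cases "\<exists>z. Im z > 0 \<and> cpoly (comb T n h) z = 0")
  case True
  then obtain z where z: "Im z > 0" "cpoly (comb T n h) z = 0" by blast
  have "smult (h k) (desc_poly T n k) = 0" if k: "k \<le> n" for k
  proof -
    have "of_real (h k) * cpoly (desc_poly T n k) z = 0"
    proof (rule prec_at_sum_eq_0[OF z(1), of "{..n}" "\<lambda>k. of_real (h k) * cpoly (desc_poly T n k) z"])
      show "(\<Sum>k\<le>n. of_real (h k) * cpoly (desc_poly T n k) z) = 0"
        using z(2) by (simp add: comb_def)
    qed (use assms k z(1) in \<open>auto intro!: prec_at_scale desc_poly_prec_at\<close>)
    then show ?thesis using desc_poly_nonvanishing[OF z(1) k] by auto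
  qed
  then have "comb T n h = 0" unfolding comb_def by (intro sum.neutral) blast
  then show ?thesis by (simp add: real_rooted_iff)
next
  case False
  then show ?thesis by (auto simp: real_rooted_iff)
qed

lemma comb_coeff_nonneg: "(\<And>k. k \<le> n \<Longrightarrow> 0 \<le> h k) \<Longrightarrow> 0 \<le> coeff (comb T n h) m"
  unfolding comb_def by (intro coeff_sum_nonneg) (simp add: desc_poly_coeff_nonneg)

lemma desc_poly_prec_comb:
  assumes "\<And>k. k \<le> n \<Longrightarrow> 0 \<le> h k" and z: "Im z > 0"
  shows "Im (cpoly (comb T n h) z * cnj (cpoly (desc_poly T n 0) z)) \<ge> 0"
proof -
  have "prec_at z (of_real 1 * cpoly (desc_poly T n 0) z) (of_real (h k) * cpoly (desc_poly T n k) z)"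
    if "k \<le> n" for k
    using that assms by (intro prec_at_scale desc_poly_prec_at) auto
  then have "prec_at z (cpoly (desc_poly T n 0) z) (cpoly (comb T n h) z)"
    unfolding comb_def by (auto intro!: prec_at_sum_right)
  then show ?thesis by (simp add: prec_at_def)
qed

lemma desc_poly_0_eq_comb: "desc_poly T n 0 = comb T n (\<lambda>k. if k = 0 then 1 else 0)"
  by (simp add: comb_def if_distrib[of "\<lambda>c. smult c _"] sum.delta cong: if_cong)

section \<open>Interlacing of root lists\<close>

lemma real_rooted_factorization:
  assumes "real_rooted p" "p \<noteq> 0"
  shows "p = smult (lead_coeff p) (\<Prod>a\<in>#proots p. [:- a, 1:])"
proof -
  have "\<exists>c M. p = smult c (\<Prod>a\<in>#M. [:- a, 1:])"
    using assms
  proof (induction "degree p" arbitrary: p)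
    case 0
    then obtain c where "p = [:c:]" by (metis degree_eq_zeroE)
    then have "p = smult c (\<Prod>a\<in>#{#}. [:- a, 1:])" by simp
    then show ?case by blast
  next
    case (Suc m p)
    have "degree (map_poly of_real p :: complex poly) = degree p"
      by (rule degree_map_poly) simp
    then have "\<not> constant (poly (map_poly of_real p :: complex poly))"
      using Suc.hyps(2) by (simp add: constant_degree)
    then obtain w where w: "cpoly p w = 0"
      unfolding cpoly_def using fundamental_theorem_of_algebra by blast
    then have "w \<in> \<real>" using Suc.prems by (auto simp: real_rooted_def cpoly_def)
    then obtain a where a: "w = of_real a" by (auto elim: Reals_cases)
    have "poly p a = 0" using w by (simp add: a cpoly_of_real)
    then obtain q where q: "p = [:- a, 1:] * q" by (metis dvdE poly_eq_0_iff_dvd)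
    have q0: "q \<noteq> 0" using q Suc.prems(2) by auto
    have "real_rooted q"
      unfolding real_rooted_iff
    proof (intro disjI2 allI impI)
      fix z :: complex assume "Im z > 0"
      then have "cpoly p z \<noteq> 0" using Suc.prems by (auto simp: real_rooted_iff)
      then show "cpoly q z \<noteq> 0" by (simp only: q cpoly_mult) auto
    qed
    moreover have "m = degree q"
      using Suc.hyps(2) q0 unfolding q by (subst (asm) degree_mult_eq) auto
    ultimately obtain c M where "q = smult c (\<Prod>a\<in>#M. [:- a, 1:])"
      using Suc.hyps(1) q0 by blast
    then have "p = smult c (\<Prod>a\<in>#add_mset a M. [:- a, 1:])" by (simp add: q)
    then show ?case by blast
  qed
  then obtain c M where p: "p = smult c (\<Prod>a\<in>#M. [:- a, 1:])" by blast
  have c: "c \<noteq> 0" using assms(2) p by auto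
  have lc: "lead_coeff (\<Prod>a\<in>#M. [:- a, 1:]) = (1::real)" for M
    by (induction M) (simp_all add: lead_coeff_mult del: mult_pCons_left)
  have "proots (\<Prod>a\<in>#M. [:- a, 1:]) = (M :: real multiset)" for M
  proof (induction M)
    case (add a M)
    have "(\<Prod>a\<in>#M. [:- a, 1:]) \<noteq> (0 :: real poly)" using lc[of M] by auto
    then show ?case using add by (simp add: proots_mult del: mult_pCons_left)
  qed simp
  then have "proots p = M" using c by (simp add: p)
  moreover have "lead_coeff p = c"
    unfolding p lead_coeff_smult lc by simp
  ultimately show ?thesis using p by (simp only:)
qed

text \<open>The argument of \<open>s + i \<epsilon> - a\<close> for \<open>\<epsilon> > 0\<close>.\<close>

definition angle :: "real \<Rightarrow> real \<Rightarrow> real \<Rightarrow> real" where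
  "angle e s a = pi / 2 - arctan ((s - a) / e)"

lemma angle_polar:
  assumes "e > 0"
  shows "Complex s e - of_real a = of_real (e * sqrt (1 + ((s - a) / e)\<^sup>2)) * cis (angle e s a)"
proof -
  have "sqrt (1 + ((s - a) / e)\<^sup>2) > 0" by (intro real_sqrt_gt_zero add_pos_nonneg) auto
  then show ?thesis
    using assms
    by (simp add: complex_eq_iff angle_def cos_diff sin_diff sin_arctan cos_arctan)
qed

definition total_angle :: "real \<Rightarrow> real \<Rightarrow> real multiset \<Rightarrow> real" where
  "total_angle e s M = (\<Sum>a\<in>#M. angle e s a)"

lemma total_angle_polar:
  assumes "e > 0"
  shows "\<exists>c>0. cpoly (\<Prod>a\<in>#M. [:- a, 1:]) (Complex s e) = of_real c * cis (total_angle e s M)"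
proof (induction M)
  case empty
  show ?case by (intro exI[of _ 1]) (simp add: total_angle_def)
next
  case (add a M)
  then obtain c where c: "c > 0"
    "cpoly (\<Prod>a\<in>#M. [:- a, 1:]) (Complex s e) = of_real c * cis (total_angle e s M)" by blast
  let ?r = "e * sqrt (1 + ((s - a) / e)\<^sup>2)"
  have "?r > 0" using assms by (intro mult_pos_pos real_sqrt_gt_zero add_pos_nonneg) auto
  moreover have "cpoly [:- a, 1:] (Complex s e) = of_real ?r * cis (angle e s a)"
    using angle_polar[OF assms, of s a] by simp
  then have "cpoly (\<Prod>a\<in>#add_mset a M. [:- a, 1:]) (Complex s e)
      = of_real (?r * c) * cis (total_angle e s (add_mset a M))"
    by (simp add: c total_angle_def cis_mult[symmetric] del: cpoly_pCons mult_pCons_left)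
  ultimately show ?case using c(1) by (intro exI[of _ "?r * c"]) simp
qed

lemma continuous_on_total_angle: "e > 0 \<Longrightarrow> continuous_on S (\<lambda>s. total_angle e s M)"
  unfolding total_angle_def angle_def by (induction M) (auto intro!: continuous_intros)

lemma total_angle_tendsto_0: "e > 0 \<Longrightarrow> ((\<lambda>s. total_angle e s M) \<longlongrightarrow> 0) at_top"
proof (induction M)
  case (add a M)
  have "filterlim (\<lambda>s. (s - a) / e) at_top at_top" using add.prems by real_asymp
  then have "((\<lambda>s. pi / 2 - arctan ((s - a) / e)) \<longlongrightarrow> pi / 2 - pi / 2) at_top"
    by (intro tendsto_intros filterlim_compose[OF tendsto_arctan_at_top])
  then show ?case
    using tendsto_add[of "\<lambda>s. angle e s a" 0 at_top "\<lambda>s. total_angle e s M" 0] add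
    by (simp add: total_angle_def angle_def[abs_def])
qed (simp add: total_angle_def)

text \<open>As the point descends to \<open>t\<close> on the real axis, the argument of its
  difference from a root tends to \<open>pi\<close> if the root is to the right and to 0 if it is to
  the left. At a root itself the limit would be \<open>pi / 2\<close>.\<close>

lemma total_angle_tendsto_count:
  assumes "t \<notin># M"
  shows "(\<lambda>m. total_angle (1 / Suc m) t M) \<longlonglongrightarrow> pi * size (filter_mset (\<lambda>a. t < a) M)"
  using assms
proof (induction M)
  case (add a M)
  have "(\<lambda>m. angle (1 / Suc m) t a) \<longlonglongrightarrow> (if t < a then pi else 0)"
  proof (cases "t < a")
    case True
    have "filterlim (\<lambda>m. (t - a) / (1 / Suc m)) at_bot sequentially"
      using True by real_asymp
    then have "(\<lambda>m. pi / 2 - arctan ((t - a) / (1 / Suc m))) \<longlonglongrightarrow> pi / 2 - (- (pi / 2))"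
      by (intro tendsto_intros filterlim_compose[OF tendsto_arctan_at_bot])
    then show ?thesis using True by (simp add: angle_def)
  next
    case False
    then have "t - a > 0" using add.prems by auto
    then have "filterlim (\<lambda>m. (t - a) / (1 / Suc m)) at_top sequentially"
      by real_asymp
    then have "(\<lambda>m. pi / 2 - arctan ((t - a) / (1 / Suc m))) \<longlonglongrightarrow> pi / 2 - pi / 2"
      by (intro tendsto_intros filterlim_compose[OF tendsto_arctan_at_top])
    then show ?thesis using False by (simp add: angle_def)
  qed
  moreover have "(\<lambda>m. total_angle (1 / Suc m) t M) \<longlonglongrightarrow> pi * size (filter_mset (\<lambda>a. t < a) M)"
    using add by simp
  ultimately have "(\<lambda>m. angle (1 / Suc m) t a + total_angle (1 / Suc m) t M)
      \<longlonglongrightarrow> (if t < a then pi else 0) + pi * size (filter_mset (\<lambda>a. t < a) M)"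
    by (rule tendsto_add)
  then show ?case by (auto simp: total_angle_def algebra_simps split: if_splits)
qed (simp add: total_angle_def)

text \<open>To return to values near 0 from outside \<open>[0, pi]\<close>, a continuous function
  must pass through \<open>(-pi, 0)\<close> or \<open>(pi, 2 pi)\<close>, where the sine is
  negative. The \<open>y\<close> in each case is a value of that kind.\<close>

lemma bounded_of_sin_nonneg:
  fixes D :: "real \<Rightarrow> real"
  assumes cont: "\<And>S. continuous_on S D" and lim: "(D \<longlongrightarrow> 0) at_top" and sin: "\<And>s. sin (D s) \<ge> 0"
  shows "0 \<le> D s \<and> D s \<le> pi"
proof -
  have ivt: "\<exists>x. D x = y" if "D s < y \<and> y < D s' \<or> D s' < y \<and> y < D s" "s \<le> s'" for y s'
    using that IVT'[of D s y s'] IVT2'[of D s' y s] cont[of "{s..s'}"] by fastforce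
  have "0 \<le> D s"
  proof (rule ccontr)
    assume neg: "\<not> 0 \<le> D s"
    define y where "y = max (D s / 2) (- pi / 2)"
    have y: "D s < y" "y < 0" "- pi < y" using neg by (auto simp: y_def max_def)
    have "eventually (\<lambda>s'. y < D s') at_top" using lim y by (intro order_tendstoD) auto
    then obtain s' where "y < D s'" "s \<le> s'"
      using eventually_ge_at_top[of s] by (metis (mono_tags, lifting) eventually_at_top_linorder linorder_le_cases order_trans)
    then obtain x where "D x = y" using ivt y by blast
    moreover have "sin y < 0" using sin_lt_zero[of "y + 2 * pi"] y by simp
    ultimately show False using sin[of x] by simp
  qed
  moreover have "D s \<le> pi"
  proof (rule ccontr)
    assume "\<not> D s \<le> pi"
    define y where "y = min ((D s + pi) / 2) (3 * pi / 2)"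
    have y: "y < D s" "pi < y" "y < 2 * pi" using \<open>\<not> D s \<le> pi\<close> by (auto simp: y_def min_def field_simps)
    have "eventually (\<lambda>s'. D s' < y) at_top" using y pi_gt_zero by (intro order_tendstoD(2)[OF lim]) linarith
    then obtain s' where "D s' < y" "s \<le> s'"
      using eventually_ge_at_top[of s] by (metis (mono_tags, lifting) eventually_at_top_linorder linorder_le_cases order_trans)
    then obtain x where "D x = y" using ivt y by blast
    moreover have "sin y < 0" using y by (intro sin_lt_zero)
    ultimately show False using sin[of x] by simp
  qed
  ultimately show ?thesis ..
qed

lemma length_filter_sorted:
  assumes "sorted_wrt (\<ge>) (xs :: real list)" "i < length xs"
  shows "t < xs ! i \<Longrightarrow> Suc i \<le> length (filter (\<lambda>x. t < x) xs)"
    and "xs ! i \<le> t \<Longrightarrow> length (filter (\<lambda>x. t < x) xs) \<le> i"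
proof -
  have ge: "xs ! j \<ge> xs ! k" if "j \<le> k" "k < length xs" for j k
    using that assms(1) by (cases "j = k") (auto simp: sorted_wrt_iff_nth_less)
  have eq: "length (filter (\<lambda>x. t < x) xs) = card {j. j < length xs \<and> t < xs ! j}"
    by (rule length_filter_conv_card)
  show "Suc i \<le> length (filter (\<lambda>x. t < x) xs)" if "t < xs ! i"
  proof -
    have "{..i} \<subseteq> {j. j < length xs \<and> t < xs ! j}"
      using that assms(2) ge[of _ i] by force
    from card_mono[OF _ this] show ?thesis by (simp add: eq)
  qed
  show "length (filter (\<lambda>x. t < x) xs) \<le> i" if "xs ! i \<le> t"
  proof -
    have "j < i" if "j < length xs" "t < xs ! j" for j
      using ge[of i j] \<open>xs ! i \<le> t\<close> that by (meson leD le_less_trans not_le order_trans)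
    then have "{j. j < length xs \<and> t < xs ! j} \<subseteq> {..<i}" by auto
    from card_mono[OF _ this] show ?thesis by (simp add: eq)
  qed
qed

lemma root_list_filter: "length (filter (\<lambda>x. t < x) (root_list p)) = size (filter_mset (\<lambda>a. t < a) (proots p))"
proof -
  have "mset (root_list p) = proots p" by (simp add: root_list_def)
  then show ?thesis by (metis mset_filter size_mset)
qed

text \<open>The hypothesis says that the continuous difference of the arguments of \<open>g\<close>
  and \<open>f\<close> along a horizontal line has nonnegative sine, so it stays in
  \<open>[0, pi]\<close>. Lowering the line to the real axis turns it into \<open>pi\<close> times
  the difference of the numbers of roots to the right of \<open>t\<close>, which is therefore 0 or
  1. This is interlacing in terms of counts.\<close>

theorem interlaces_of_upper_half_plane:
  assumes f: "real_rooted f" "lead_coeff f > 0" and g: "real_rooted g" "lead_coeff g > 0"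
    and im: "\<And>z. Im z > 0 \<Longrightarrow> Im (cpoly g z * cnj (cpoly f z)) \<ge> 0"
  shows "interlaces f g"
proof -
  have f0: "f \<noteq> 0" and g0: "g \<noteq> 0" using f g by auto
  define D where "D = (\<lambda>e s. total_angle e s (proots g) - total_angle e s (proots f))"
  have sinD: "sin (D e s) \<ge> 0" if e: "e > 0" for e s
  proof -
    obtain c where c: "c > 0" "cpoly (\<Prod>a\<in>#proots f. [:- a, 1:]) (Complex s e) = of_real c * cis (total_angle e s (proots f))"
      using total_angle_polar[OF e] by blast
    obtain d where d: "d > 0" "cpoly (\<Prod>a\<in>#proots g. [:- a, 1:]) (Complex s e) = of_real d * cis (total_angle e s (proots g))"
      using total_angle_polar[OF e] by blast
    have "cpoly f (Complex s e) = of_real (lead_coeff f * c) * cis (total_angle e s (proots f))"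
      by (subst real_rooted_factorization[OF f(1) f0]) (simp add: c)
    moreover have "cpoly g (Complex s e) = of_real (lead_coeff g * d) * cis (total_angle e s (proots g))"
      by (subst real_rooted_factorization[OF g(1) g0]) (simp add: d)
    ultimately have "cpoly g (Complex s e) * cnj (cpoly f (Complex s e))
        = of_real ((lead_coeff g * d) * (lead_coeff f * c)) * cis (D e s)"
      by (simp add: D_def cis_cnj cis_mult[symmetric] mult_ac flip: cis_inverse) (simp add: cis_mult)
    moreover have "Im (of_real r * cis x) = r * sin x" for r x by simp
    ultimately have "0 \<le> ((lead_coeff g * d) * (lead_coeff f * c)) * sin (D e s)"
      using im[of "Complex s e"] e by (metis complex.sel(2))
    moreover have "(lead_coeff g * d) * (lead_coeff f * c) > 0" using f g c d by simp
    ultimately show ?thesis by (simp add: zero_le_mult_iff)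
  qed
  have D: "0 \<le> D e s \<and> D e s \<le> pi" if e: "e > 0" for e s
  proof (rule bounded_of_sin_nonneg[of "D e"])
    show "continuous_on S (D e)" for S
      unfolding D_def by (intro continuous_intros continuous_on_total_angle e)
    show "(D e \<longlongrightarrow> 0) at_top"
      using tendsto_diff[OF total_angle_tendsto_0[OF e] total_angle_tendsto_0[OF e]]
      by (simp add: D_def[abs_def])
  qed (rule sinD[OF e])
  define cnt where "cnt = (\<lambda>(t::real) p. size (filter_mset (\<lambda>a. t < a) (proots p)))"
  have count: "cnt t f \<le> cnt t g \<and> cnt t g \<le> cnt t f + 1" if t: "t \<notin># proots f" "t \<notin># proots g" for t
  proof -
    have lim: "(\<lambda>m. D (1 / Suc m) t) \<longlonglongrightarrow> pi * cnt t g - pi * cnt t f"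
      unfolding D_def cnt_def by (intro tendsto_diff total_angle_tendsto_count t)
    have "0 \<le> pi * cnt t g - pi * cnt t f"
      by (rule tendsto_lowerbound[OF lim]) (use D in \<open>auto intro!: always_eventually\<close>)
    moreover have "pi * cnt t g - pi * cnt t f \<le> pi"
      by (rule tendsto_upperbound[OF lim]) (use D in \<open>auto intro!: always_eventually\<close>)
    ultimately have "0 \<le> pi * (real (cnt t g) - real (cnt t f))" "pi * (real (cnt t g) - real (cnt t f)) \<le> pi * 1"
      by (simp_all add: algebra_simps)
    then have "0 \<le> real (cnt t g) - real (cnt t f)" "real (cnt t g) - real (cnt t f) \<le> 1"
      using pi_gt_zero by (auto simp: zero_le_mult_iff mult_le_cancel_left not_le)
    then show ?thesis by linarith
  qed
  define al be where "al = root_list f" and "be = root_list g"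
  have sorted: "sorted_wrt (\<ge>) (root_list p)" for p
    by (simp add: root_list_def sorted_wrt_rev)
  have cnt: "cnt t f = length (filter (\<lambda>x. t < x) al)" "cnt t g = length (filter (\<lambda>x. t < x) be)" for t
    by (simp_all add: cnt_def al_def be_def root_list_filter)
  have fin: "finite (set_mset (proots f) \<union> set_mset (proots g))" by simp
  have between: "\<exists>t. u < t \<and> t < v \<and> t \<notin># proots f \<and> t \<notin># proots g" if "u < v" for u v
  proof -
    have "infinite ({u<..<v} - (set_mset (proots f) \<union> set_mset (proots g)))"
      using that fin infinite_Ioo[OF that] by (simp add: Diff_infinite_finite)
    then obtain t where "t \<in> {u<..<v} - (set_mset (proots f) \<union> set_mset (proots g))"
      using infinite_imp_nonempty by blast
    then show ?thesis by auto
  qed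
  have "length al \<le> length be \<and> length be \<le> length al + 1"
  proof -
    \<comment> \<open>To the left of all roots the counts are the lengths of the root lists.\<close>
    define t where "t = Min (insert 0 (set_mset (proots f) \<union> set_mset (proots g))) - 1"
    have lt: "t < x" if "x \<in># proots f \<or> x \<in># proots g" for x
    proof -
      have "Min (insert 0 (set_mset (proots f) \<union> set_mset (proots g))) \<le> x"
        using that by (intro Min_le) auto
      then show ?thesis by (simp add: t_def)
    qed
    then have "t \<notin># proots f" "t \<notin># proots g" by auto
    moreover have "cnt t p = size (proots p)" if "p = f \<or> p = g" for p
      unfolding cnt_def using lt that by (intro arg_cong[where f = size] filter_mset_eq_conv[THEN iffD2]) auto
    moreover have "length (root_list p) = size (proots p)" for p
      by (simp add: root_list_def flip: size_mset)
    ultimately show ?thesis using count[of t] by (auto simp: al_def be_def)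
  qed
  then have len: "length be = length al \<or> length be = length al + 1" by linarith
  moreover have "al ! i \<le> be ! i" if i: "i < length al" for i
  proof (rule ccontr)
    assume "\<not> al ! i \<le> be ! i"
    then obtain t where t: "be ! i < t" "t < al ! i" "t \<notin># proots f" "t \<notin># proots g"
      using between[of "be ! i" "al ! i"] by auto
    have "i < length be" using i len by auto
    then have "cnt t g \<le> i" using length_filter_sorted(2)[OF sorted, of i g t] t by (simp add: cnt be_def)
    moreover have "Suc i \<le> cnt t f" using length_filter_sorted(1)[OF sorted, of i f t] t i by (simp add: cnt al_def)
    ultimately show False using count[OF t(3,4)] by simp
  qed
  moreover have "be ! (i + 1) \<le> al ! i" if i: "i + 1 < length be" for i
  proof (rule ccontr)
    assume "\<not> be ! (i + 1) \<le> al ! i"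
    then obtain t where t: "al ! i < t" "t < be ! (i + 1)" "t \<notin># proots f" "t \<notin># proots g"
      using between[of "al ! i" "be ! (i + 1)"] by auto
    have "i < length al" using i len by auto
    then have "cnt t f \<le> i" using length_filter_sorted(2)[OF sorted, of i f t] t by (simp add: cnt al_def)
    moreover have "Suc (i + 1) \<le> cnt t g" using length_filter_sorted(1)[OF sorted, of "i + 1" g t] t i by (simp add: cnt be_def)
    ultimately show False using count[OF t(3,4)] by simp
  qed
  ultimately show ?thesis
    using f(1) g(1) by (simp add: interlaces_def Let_def al_def be_def)
qed

section \<open>Descents and the last letter\<close>

text \<open>Composition with \<open>insert_value m a\<close> appends the last letter \<open>a\<close> to a permutation of \<open>{1..m}\<close>.\<close>

definition insert_value :: "nat \<Rightarrow> nat \<Rightarrow> nat \<Rightarrow> nat" where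
  "insert_value m a i = (if 1 \<le> i \<and> i \<le> m then if i < a then i else i + 1 else if i = Suc m then a else i)"

lemma insert_value_permutes:
  assumes "1 \<le> a" "a \<le> Suc m"
  shows "insert_value m a permutes {1..Suc m}"
proof (rule bij_imp_permutes)
  show "bij_betw (insert_value m a) {1..Suc m} {1..Suc m}"
    by (rule bij_betw_byWitness[where f' = "\<lambda>j. if j < a then j else if j = a then Suc m else j - 1"])
      (use assms in \<open>auto simp: insert_value_def\<close>)
  show "insert_value m a x = x" if "x \<notin> {1..Suc m}" for x
    using that by (auto simp: insert_value_def)
qed

text \<open>Raising the letters from \<open>a\<close> on preserves their order; the new last letter
  follows a larger one exactly if the old last letter was at least \<open>a\<close>, as that letter
  was raised too.\<close>

lemma Des_insert_value:
  assumes w: "w permutes {1..m}" and "1 \<le> m" and a: "1 \<le> a" "a \<le> Suc m"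
  shows "Des (Suc m) (insert_value m a \<circ> w) = Des m w \<union> (if a \<le> w m then {m} else {})"
proof (intro set_eqI)
  fix i
  have in_range: "1 \<le> w j \<and> w j \<le> m" if "1 \<le> j" "j \<le> m" for j
    using permutes_in_image[OF w, of j] that by simp
  have top: "w (Suc m) = Suc m" using permutes_not_in[OF w, of "Suc m"] by simp
  show "i \<in> Des (Suc m) (insert_value m a \<circ> w) \<longleftrightarrow> i \<in> Des m w \<union> (if a \<le> w m then {m} else {})"
  proof (cases "1 \<le> i \<and> i < m")
    case True
    then show ?thesis using in_range[of i] in_range[of "Suc i"]
      by (auto simp: Des_def insert_value_def)
  next
    case False
    show ?thesis
    proof (cases "i = m")
      case True
      then show ?thesis using in_range[of m] top assms(2)
        by (auto simp: Des_def insert_value_def)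
    qed (use False in \<open>auto simp: Des_def\<close>)
  qed
qed

definition desc_term :: "nat set \<Rightarrow> nat \<Rightarrow> (nat \<Rightarrow> nat) \<Rightarrow> real poly" where
  "desc_term T n w = (if Des n w \<subseteq> T then monom 1 (des n w) else 0)"

lemma desc_term_insert_value:
  assumes w: "w permutes {1..m}" and "1 \<le> m" and a: "1 \<le> a" "a \<le> Suc m"
  shows "desc_term T (Suc m) (insert_value m a \<circ> w) =
    (if a \<le> w m then if m \<in> T then monom 1 1 * desc_term T m w else 0 else desc_term T m w)"
proof -
  have "m \<notin> Des m w" "finite (Des m w)" using assms(2) by (auto simp: Des_def)
  then show ?thesis
    by (auto simp: desc_term_def des_def Des_insert_value[OF assms] mult_monom)
qed

lemma finite_permutes: "finite {w. w permutes {1..m::nat} \<and> Q w}"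
  by (rule finite_subset[OF _ finite_permutations[of "{1..m}"]]) auto

lemma sum_over_last_letter:
  assumes "1 \<le> a" "a \<le> Suc m"
  shows "(\<Sum>w | w permutes {1..Suc m} \<and> w (Suc m) = a. f w)
    = (\<Sum>w | w permutes {1..m}. f (insert_value m a \<circ> w))"
proof (rule sum.reindex_bij_witness[of _ "\<lambda>w. insert_value m a \<circ> w" "\<lambda>w. inv (insert_value m a) \<circ> w"])
  note c = insert_value_permutes[OF assms]
  have ca: "insert_value m a (Suc m) = a" by (simp add: insert_value_def)
  fix w assume w: "w \<in> {w. w permutes {1..Suc m} \<and> w (Suc m) = a}"
  show "insert_value m a \<circ> (inv (insert_value m a) \<circ> w) = w"
    by (simp add: fun_eq_iff permutes_inverses[OF c])
  then show "f (insert_value m a \<circ> (inv (insert_value m a) \<circ> w)) = f w" by simp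
  have p1: "inv (insert_value m a) \<circ> w permutes {1..Suc m}"
    using w c by (auto intro: permutes_compose permutes_inv)
  have p2: "(inv (insert_value m a) \<circ> w) (Suc m) = Suc m"
    using w ca permutes_inverses(2)[OF c, of "Suc m"] by simp
  have "inv (insert_value m a) \<circ> w permutes {1..m}"
    by (rule permutes_superset[OF p1]) (use p2 in \<open>auto simp: le_Suc_eq\<close>)
  then show "inv (insert_value m a) \<circ> w \<in> {w. w permutes {1..m}}" by simp
next
  note c = insert_value_permutes[OF assms]
  fix w assume w: "w \<in> {w. w permutes {1..m}}"
  show "inv (insert_value m a) \<circ> (insert_value m a \<circ> w) = w"
    by (simp add: fun_eq_iff permutes_inverses[OF c])
  have "w permutes {1..Suc m}" using w by (auto intro: permutes_subset)
  moreover have "w (Suc m) = Suc m" using permutes_not_in[of w "{1..m}" "Suc m"] w by simp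
  ultimately show "insert_value m a \<circ> w \<in> {w. w permutes {1..Suc m} \<and> w (Suc m) = a}"
    using c by (auto intro: permutes_compose simp: insert_value_def)
qed

lemma sum_permutes_by_last:
  "(\<Sum>w | w permutes {1..Suc n}. f w) = (\<Sum>i\<le>n. \<Sum>w | w permutes {1..Suc n} \<and> w (Suc n) = Suc n - i. f w)"
proof -
  have "{w. w permutes {1..Suc n}} = (\<Union>i\<le>n. {w. w permutes {1..Suc n} \<and> w (Suc n) = Suc n - i})"
  proof (intro set_eqI iffI)
    fix w assume w: "w \<in> {w. w permutes {1..Suc n}}"
    then have "1 \<le> w (Suc n)" "w (Suc n) \<le> Suc n" using permutes_in_image[of w "{1..Suc n}" "Suc n"] by auto
    then show "w \<in> (\<Union>i\<le>n. {w. w permutes {1..Suc n} \<and> w (Suc n) = Suc n - i})"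
      using w by (auto intro!: bexI[of _ "Suc n - w (Suc n)"])
  qed auto
  then show ?thesis
    by (simp only:) (rule sum.UNION_disjoint, simp, intro ballI finite_permutes, auto)
qed

theorem desc_poly_eq_sum:
  "k \<le> n \<Longrightarrow> desc_poly T n k = (\<Sum>w | w permutes {1..Suc n} \<and> w (Suc n) = Suc n - k. desc_term T (Suc n) w)"
proof (induction n arbitrary: k)
  case 0
  have "{w. w permutes {1..Suc 0} \<and> w (Suc 0) = Suc 0 - k} = {id}"
    using 0 by (auto simp: permutes_sing)
  then show ?case using 0 by (simp add: desc_term_def Des_def des_def one_pCons monom_0)
next
  case (Suc n k)
  define a where "a = Suc (Suc n) - k"
  have a: "1 \<le> a" "a \<le> Suc (Suc n)" using Suc.prems by (auto simp: a_def)
  have "(\<Sum>w | w permutes {1..Suc (Suc n)} \<and> w (Suc (Suc n)) = a. desc_term T (Suc (Suc n)) w)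
    = (\<Sum>i\<le>n. \<Sum>w | w permutes {1..Suc n} \<and> w (Suc n) = Suc n - i. desc_term T (Suc (Suc n)) (insert_value (Suc n) a \<circ> w))"
    by (subst sum_over_last_letter[OF a]) (rule sum_permutes_by_last)
  also have "\<dots> = (\<Sum>i\<le>n. if i < k then if Suc n \<in> T then monom 1 1 * desc_poly T n i else 0 else desc_poly T n i)"
  proof (intro sum.cong refl)
    fix i assume i: "i \<in> {..n}"
    have "a \<le> Suc n - i \<longleftrightarrow> i < k" using i Suc.prems by (auto simp: a_def)
    then have "(\<Sum>w | w permutes {1..Suc n} \<and> w (Suc n) = Suc n - i. desc_term T (Suc (Suc n)) (insert_value (Suc n) a \<circ> w))
      = (\<Sum>w | w permutes {1..Suc n} \<and> w (Suc n) = Suc n - i.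
          if i < k then if Suc n \<in> T then monom 1 1 * desc_term T (Suc n) w else 0 else desc_term T (Suc n) w)"
      by (intro sum.cong refl) (auto simp: desc_term_insert_value[OF _ _ a])
    also have "\<dots> = (if i < k then if Suc n \<in> T then monom 1 1 * desc_poly T n i else 0 else desc_poly T n i)"
      using Suc.IH[of i] i by (auto simp: sum_distrib_left)
    finally show "(\<Sum>w | w permutes {1..Suc n} \<and> w (Suc n) = Suc n - i. desc_term T (Suc (Suc n)) (insert_value (Suc n) a \<circ> w))
      = (if i < k then if Suc n \<in> T then monom 1 1 * desc_poly T n i else 0 else desc_poly T n i)" .
  qed
  also have "\<dots> = (\<Sum>i<k. if Suc n \<in> T then monom 1 1 * desc_poly T n i else 0) + (\<Sum>i\<in>{k..n}. desc_poly T n i)"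
  proof -
    have "{..n} = {..<k} \<union> {k..n}" using Suc.prems by auto
    then show ?thesis by (simp add: sum.union_disjoint ivl_disj_int)
  qed
  also have "\<dots> = desc_poly T (Suc n) k" by (simp add: sum_distrib_left)
  finally show ?case by (simp add: a_def)
qed

text \<open>Appending the largest letter creates no descent, so the permutations of
  \<open>{1..n+1}\<close> that end in \<open>n + 1\<close> give the polynomial for
  \<open>{1..n}\<close>.\<close>

theorem eulerian_poly_eq_desc_poly:
  assumes "n > 0"
  shows "eulerian_poly n T = desc_poly T n 0"
proof -
  obtain m where n: "n = Suc m" using assms gr0_implies_Suc by blast
  have "eulerian_poly n T = (\<Sum>w | w permutes {1..n}. desc_term T n w)"
    unfolding eulerian_poly_def desc_term_def
    by (intro sum.mono_neutral_cong_left) (auto simp: finite_permutations)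
  also have "\<dots> = (\<Sum>i\<le>m. desc_poly T m i)"
    unfolding n sum_permutes_by_last by (intro sum.cong refl) (simp add: desc_poly_eq_sum)
  also have "\<dots> = desc_poly T n 0" by (simp add: n atMost_atLeast0)
  finally show ?thesis .
qed

section \<open>Chains of the rank-selected poset\<close>

definition pX :: "real poly" where "pX = monom 1 1"
definition pY :: "real poly" where "pY = 1 - pX"

lemma pY_eq: "pY = [:1, -1:]"
  by (simp add: pY_def pX_def one_pCons monom_Suc monom_0)

lemma desc_poly_Suc:
  "desc_poly T (Suc n) k = (if Suc n \<in> T then pX * (\<Sum>i<k. desc_poly T n i) else 0) + (\<Sum>i\<in>{k..n}. desc_poly T n i)"
  by (simp add: pX_def)

lemmas [simp del] = desc_poly.simps(2)

text \<open>The number of selected ranks above \<open>i\<close>: a chain of top rank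
  \<open>i\<close> misses them, and each contributes a factor \<open>1 - x\<close>.\<close>

definition gap :: "nat set \<Rightarrow> nat \<Rightarrow> nat \<Rightarrow> nat" where
  "gap T i n = card (T \<inter> {i<..n})"

lemma gap_Suc: "i \<le> n \<Longrightarrow> gap T i (Suc n) = (if Suc n \<in> T then Suc (gap T i n) else gap T i n)"
proof -
  assume "i \<le> n"
  then have "T \<inter> {i<..Suc n} = (if Suc n \<in> T then insert (Suc n) (T \<inter> {i<..n}) else T \<inter> {i<..n})"
    by (auto simp: le_Suc_eq)
  then show ?thesis by (simp add: gap_def)
qed

lemma gap_self [simp]: "gap T n n = 0"
  by (simp add: gap_def)

lemma gap_split: "i < j \<Longrightarrow> j \<le> n \<Longrightarrow> j \<in> T \<Longrightarrow> gap T i n = Suc (gap T i (j - 1) + gap T j n)"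
proof -
  assume "i < j" "j \<le> n" "j \<in> T"
  then have "T \<inter> {i<..n} = insert j ((T \<inter> {i<..j - 1}) \<union> (T \<inter> {j<..n}))" by auto
  moreover have "(T \<inter> {i<..j - 1}) \<inter> (T \<inter> {j<..n}) = {}" "j \<notin> (T \<inter> {i<..j - 1}) \<union> (T \<inter> {j<..n})"
    using \<open>i < j\<close> by auto
  ultimately show ?thesis by (simp add: gap_def card_Un_disjoint)
qed

lemma hockey_stick:
  assumes "k \<le> Suc n" "j \<le> n"
  shows "(\<Sum>i\<in>{k..n}. (n - i) choose (n - j)) = (Suc n - k) choose (Suc n - j)"
proof (cases "k = Suc n")
  case False
  then have k: "k \<le> n" using assms by simp
  have "(\<Sum>i\<in>{k..n}. (n - i) choose (n - j)) = (\<Sum>m\<le>n - k. m choose (n - j))"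
    by (rule sum.reindex_bij_witness[of _ "\<lambda>m. n - m" "\<lambda>i. n - i"]) (use k in auto)
  also have "\<dots> = Suc (n - k) choose Suc (n - j)" by (rule sum_choose_upper)
  finally show ?thesis using k assms by (simp add: Suc_diff_le)
qed (use assms in \<open>simp add: Suc_diff_le\<close>)

text \<open>The binomial coefficient of the term \<open>j\<close> is the one with which
  \<open>h_k\<close> enters the number of faces of rank \<open>j\<close>. So a sum over
  \<open>k\<close> weighted by the h-vector becomes a sum weighted by face numbers, as in the
  splitting of chains by their top.\<close>

lemma desc_poly_closed_form:
  "k \<le> n \<Longrightarrow> desc_poly T n k = (if k = 0 then pY ^ gap T 0 n else 0)
     + (\<Sum>j\<in>T \<inter> {1..n}. of_nat ((n - k) choose (n - j)) * (pX * pY ^ gap T j n * desc_poly T j 0))"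
proof (induction n arbitrary: k)
  case 0
  then show ?case by simp
next
  case (Suc n k)
  let ?A = "\<lambda>j. desc_poly T j 0"
  define S where "S = (\<Sum>i\<in>{k..n}. desc_poly T n i)"
  have S: "S = (if k = 0 then pY ^ gap T 0 n else 0)
     + (\<Sum>j\<in>T \<inter> {1..n}. of_nat ((Suc n - k) choose (Suc n - j)) * (pX * pY ^ gap T j n * ?A j))"
  proof -
    have "S = (\<Sum>i\<in>{k..n}. (if i = 0 then pY ^ gap T 0 n else 0))
      + (\<Sum>i\<in>{k..n}. \<Sum>j\<in>T \<inter> {1..n}. of_nat ((n - i) choose (n - j)) * (pX * pY ^ gap T j n * ?A j))"
      unfolding S_def sum.distrib[symmetric] by (intro sum.cong refl) (simp add: Suc.IH)
    also have "(\<Sum>i\<in>{k..n}. (if i = 0 then pY ^ gap T 0 n else 0)) = (if k = 0 then pY ^ gap T 0 n else 0)"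
      by (auto simp: sum.delta)
    also have "(\<Sum>i\<in>{k..n}. \<Sum>j\<in>T \<inter> {1..n}. of_nat ((n - i) choose (n - j)) * (pX * pY ^ gap T j n * ?A j))
      = (\<Sum>j\<in>T \<inter> {1..n}. of_nat (\<Sum>i\<in>{k..n}. (n - i) choose (n - j)) * (pX * pY ^ gap T j n * ?A j))"
      by (subst sum.swap) (simp add: sum_distrib_right)
    also have "\<dots> = (\<Sum>j\<in>T \<inter> {1..n}. of_nat ((Suc n - k) choose (Suc n - j)) * (pX * pY ^ gap T j n * ?A j))"
      by (intro sum.cong refl) (use Suc.prems in \<open>auto simp: hockey_stick\<close>)
    finally show ?thesis .
  qed
  show ?case
  proof (cases "Suc n \<in> T")
    case False
    have "T \<inter> {1..Suc n} = T \<inter> {1..n}" using False by (auto simp: le_Suc_eq)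
    then show ?thesis
      using False S by (auto simp: desc_poly_Suc S_def[symmetric] gap_Suc intro!: sum.cong)
  next
    case True
    have ins: "T \<inter> {1..Suc n} = insert (Suc n) (T \<inter> {1..n})" using True by (auto simp: le_Suc_eq)
    have A: "?A (Suc n) = (\<Sum>i\<le>n. desc_poly T n i)" by (simp add: desc_poly_Suc atMost_atLeast0)
    have "{..n} = {..<k} \<union> {k..n}" using Suc.prems by auto
    \<comment> \<open>The prefix sum, which carries the factor \<open>x\<close>, is the total minus
      \<open>S\<close>; hence the new polynomial is \<open>x\<close> times the total plus
      \<open>1 - x\<close> times \<open>S\<close>.\<close>
    then have "?A (Suc n) = (\<Sum>i<k. desc_poly T n i) + S"
      unfolding A S_def by (simp add: sum.union_disjoint ivl_disj_int)
    then have "desc_poly T (Suc n) k = pX * ?A (Suc n) + pY * S"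
      using True by (simp add: desc_poly_Suc S_def[symmetric] pY_def algebra_simps)
    also have "pY * S = (if k = 0 then pY ^ gap T 0 (Suc n) else 0)
      + (\<Sum>j\<in>T \<inter> {1..n}. of_nat ((Suc n - k) choose (Suc n - j)) * (pX * pY ^ gap T j (Suc n) * ?A j))"
      unfolding S distrib_left sum_distrib_left
      by (intro arg_cong2[where f = "(+)"] sum.cong refl) (use True in \<open>auto simp: gap_Suc mult_ac\<close>)
    finally show ?thesis
      unfolding ins by (simp add: add_ac)
  qed
qed

text \<open>This is the recursion obtained by splitting the chains of a Boolean lattice of rank
  \<open>j\<close> by their top element, of which there are \<open>j choose i\<close> in rank
  \<open>i\<close>.\<close>

lemma desc_poly_0_recursion:
  assumes "j \<ge> 1"
  shows "desc_poly T j 0 = pY ^ gap T 0 (j - 1)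
     + (\<Sum>i\<in>T \<inter> {1..<j}. of_nat (j choose i) * (pX * pY ^ gap T i (j - 1) * desc_poly T i 0))" (is "_ = ?rhs")
proof -
  obtain m where j: "j = Suc m" using assms by (cases j) auto
  have iv: "{1..<j} = {1..m}" by (auto simp: j)
  have ch: "Suc m choose (Suc m - i) = Suc m choose i" if "i \<in> T \<inter> {1..m}" for i
    using that binomial_symmetric[of i "Suc m"] by simp
  show ?thesis
  proof (cases "j \<in> T")
    case False
    have "T \<inter> {1..j} = T \<inter> {1..m}" using False by (auto simp: j le_Suc_eq)
    then show ?thesis
      unfolding iv using desc_poly_closed_form[of 0 j T] False ch
      by (auto simp: j gap_Suc intro!: sum.cong)
  next
    case True
    have ins: "T \<inter> {1..j} = insert j (T \<inter> {1..m})" using True by (auto simp: j le_Suc_eq)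
    have "desc_poly T j 0 = pY ^ gap T 0 j
      + (\<Sum>i\<in>T \<inter> {1..j}. of_nat ((j - 0) choose (j - i)) * (pX * pY ^ gap T i j * desc_poly T i 0))"
      using desc_poly_closed_form[of 0 j T] by (simp only: le0 refl if_True)
    also have "(\<Sum>i\<in>T \<inter> {1..j}. of_nat ((j - 0) choose (j - i)) * (pX * pY ^ gap T i j * desc_poly T i 0))
      = pX * desc_poly T j 0
      + (\<Sum>i\<in>T \<inter> {1..m}. of_nat ((j - 0) choose (j - i)) * (pX * pY ^ gap T i j * desc_poly T i 0))"
      unfolding ins by (subst sum.insert) (auto simp: j)
    also have "(\<Sum>i\<in>T \<inter> {1..m}. of_nat ((j - 0) choose (j - i)) * (pX * pY ^ gap T i j * desc_poly T i 0))
      = pY * (\<Sum>i\<in>T \<inter> {1..<j}. of_nat (j choose i) * (pX * pY ^ gap T i (j - 1) * desc_poly T i 0))"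
      unfolding sum_distrib_left iv
      by (intro sum.cong refl) (use True in \<open>auto simp: ch gap_Suc j mult_ac\<close>)
    also have "pY ^ gap T 0 j = pY * pY ^ gap T 0 (j - 1)" using True by (simp add: j gap_Suc)
    \<comment> \<open>For \<open>j\<close> in \<open>T\<close> the closed form contains the
      polynomial itself with factor \<open>x\<close>; moving it to the left leaves the common factor
      \<open>1 - x\<close>.\<close>
    finally have "desc_poly T j 0 = pX * desc_poly T j 0 + pY * ?rhs" by (simp only: distrib_left add_ac)
    then have "(1 - pX) * desc_poly T j 0 = (1 - pX) * ?rhs" unfolding pY_def by (simp only: left_diff_distrib mult_1 diff_eq_eq add.commute)
    moreover have "1 - pX \<noteq> 0" unfolding pY_def[symmetric] by (simp add: pY_eq)
    ultimately show ?thesis using mult_left_cancel by blast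
  qed
qed

section \<open>Face numbers in terms of the h-vector\<close>

context pointed_labelled_poset
begin

lemma alternating_binomial_inversion:
  assumes "i \<le> j" "j \<le> n"
  shows "(\<Sum>k\<in>{i..j}. int ((n - k) choose (n - j)) * ((- 1) ^ (k - i) * int ((n - i) choose (k - i))))
    = (if i = j then 1 else 0)"
proof -
  have "(\<Sum>k\<in>{i..j}. int ((n - k) choose (n - j)) * ((- 1) ^ (k - i) * int ((n - i) choose (k - i))))
    = (\<Sum>m\<le>j - i. int ((n - i) choose (j - i)) * ((- 1) ^ m * int ((j - i) choose m)))"
  proof (rule sum.reindex_bij_witness[of _ "\<lambda>m. m + i" "\<lambda>k. k - i"])
    fix k assume k: "k \<in> {i..j}"
    have "(n - k) choose (n - j) = (n - k) choose (j - k)"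
    proof -
      have "n - j \<le> n - k" "n - k - (n - j) = j - k" using k assms by auto
      then show ?thesis using binomial_symmetric[of "n - j" "n - k"] by simp
    qed
    moreover have "((n - i) choose (j - i)) * ((j - i) choose (k - i)) = ((n - i) choose (k - i)) * ((n - k) choose (j - k))"
    proof -
      have "k - i \<le> j - i" "j - i \<le> n - i" "n - i - (k - i) = n - k" "j - i - (k - i) = j - k"
        using k assms by auto
      then show ?thesis using choose_mult[of "k - i" "j - i" "n - i"] by simp
    qed
    ultimately show "int ((n - i) choose (j - i)) * ((- 1) ^ (k - i) * int ((j - i) choose (k - i)))
      = int ((n - k) choose (n - j)) * ((- 1) ^ (k - i) * int ((n - i) choose (k - i)))"
      by (simp add: mult_ac flip: of_nat_mult)
  qed (use assms in auto)
  also have "\<dots> = int ((n - i) choose (j - i)) * (\<Sum>m\<le>j - i. (- 1) ^ m * int ((j - i) choose m))"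
    by (simp add: sum_distrib_left)
  also have "\<dots> = (if i = j then 1 else 0)"
    using choose_alternating_sum[of "j - i", where ?'a = int] assms by (auto simp: mult.commute)
  finally show ?thesis .
qed

lemma num_faces_eq:
  assumes "j \<le> n"
  shows "(\<Sum>k\<le>n. int ((n - k) choose (n - j)) * h_entry n k) = int (num_faces j)"
proof -
  have "(\<Sum>k\<le>n. int ((n - k) choose (n - j)) * h_entry n k) = (\<Sum>k\<le>j. int ((n - k) choose (n - j)) * h_entry n k)"
    using assms by (intro sum.mono_neutral_right) (auto simp: binomial_eq_0)
  also have "\<dots> = (\<Sum>k\<le>j. \<Sum>i\<le>j. if i \<le> k then int ((n - k) choose (n - j)) * ((- 1) ^ (k - i) * int ((n - i) choose (k - i))) * int (num_faces i) else 0)"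
  proof (intro sum.cong refl)
    fix k assume k: "k \<in> {..j}"
    have "int ((n - k) choose (n - j)) * h_entry n k
      = (\<Sum>i\<le>k. int ((n - k) choose (n - j)) * ((- 1) ^ (k - i) * int ((n - i) choose (k - i))) * int (num_faces i))"
      by (simp add: h_entry_def sum_distrib_left mult.assoc)
    also have "\<dots> = (\<Sum>i\<le>j. if i \<le> k then int ((n - k) choose (n - j)) * ((- 1) ^ (k - i) * int ((n - i) choose (k - i))) * int (num_faces i) else 0)"
      using k by (intro sum.mono_neutral_cong_left) auto
    finally show "int ((n - k) choose (n - j)) * h_entry n k
      = (\<Sum>i\<le>j. if i \<le> k then int ((n - k) choose (n - j)) * ((- 1) ^ (k - i) * int ((n - i) choose (k - i))) * int (num_faces i) else 0)" .
  qed
  also have "\<dots> = (\<Sum>i\<le>j. (\<Sum>k\<in>{i..j}. int ((n - k) choose (n - j)) * ((- 1) ^ (k - i) * int ((n - i) choose (k - i)))) * int (num_faces i))"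
    unfolding sum_distrib_right
    by (subst sum.swap) (intro sum.cong refl sum.mono_neutral_cong_right, auto)
  also have "\<dots> = (\<Sum>i\<le>j. if i = j then int (num_faces j) else 0)"
    by (intro sum.cong refl) (use assms in \<open>simp add: alternating_binomial_inversion\<close>)
  finally show ?thesis by simp
qed

definition h_comb :: "nat set \<Rightarrow> nat \<Rightarrow> real poly" where
  "h_comb T n = comb T n (\<lambda>k. real_of_int (h_entry n k))"

lemma num_faces_0: "num_faces 0 = 1"
proof -
  have "{y \<in> P. card (N y) = 0} = {z}" using N_eq_empty finite_N z_in N_z by auto
  then show ?thesis by (simp add: num_faces_def)
qed

lemma h_comb_eq:
  assumes "T \<subseteq> {1..n}"
  shows "h_comb T n = pY ^ gap T 0 n + (\<Sum>j\<in>T. of_nat (num_faces j) * (pX * pY ^ gap T j n * desc_poly T j 0))"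
proof -
  let ?h = "\<lambda>k. of_int (h_entry n k) :: real poly"
  have T: "T \<inter> {1..n} = T" using assms by auto
  have cf: "desc_poly T n k = (if k = 0 then pY ^ gap T 0 n else 0)
     + (\<Sum>j\<in>T. of_nat ((n - k) choose (n - j)) * (pX * pY ^ gap T j n * desc_poly T j 0))" if "k \<le> n" for k
    using desc_poly_closed_form[OF that, of T] by (simp only: T)
  have "h_comb T n = (\<Sum>k\<le>n. ?h k * desc_poly T n k)"
    unfolding h_comb_def comb_def by (intro sum.cong refl) (simp add: of_int_poly)
  also have "\<dots> = (\<Sum>k\<le>n. ?h k * (if k = 0 then pY ^ gap T 0 n else 0))
     + (\<Sum>k\<le>n. \<Sum>j\<in>T. ?h k * (of_nat ((n - k) choose (n - j)) * (pX * pY ^ gap T j n * desc_poly T j 0)))"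
    unfolding sum.distrib[symmetric] sum_distrib_left[symmetric] distrib_left[symmetric]
    by (intro sum.cong refl arg_cong2[where f = "(*)"] cf) simp
  also have "(\<Sum>k\<le>n. ?h k * (if k = 0 then pY ^ gap T 0 n else 0)) = (\<Sum>k\<le>n. if k = 0 then ?h 0 * pY ^ gap T 0 n else 0)"
    by (intro sum.cong refl) auto
  also have "\<dots> = pY ^ gap T 0 n" by (simp add: h_entry_def num_faces_0)
  also have "(\<Sum>k\<le>n. \<Sum>j\<in>T. ?h k * (of_nat ((n - k) choose (n - j)) * (pX * pY ^ gap T j n * desc_poly T j 0)))
    = (\<Sum>j\<in>T. of_int (\<Sum>k\<le>n. int ((n - k) choose (n - j)) * h_entry n k) * (pX * pY ^ gap T j n * desc_poly T j 0))"
    by (subst sum.swap) (intro sum.cong refl, simp add: sum_distrib_right sum_distrib_left mult_ac)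
  also have "\<dots> = (\<Sum>j\<in>T. of_nat (num_faces j) * (pX * pY ^ gap T j n * desc_poly T j 0))"
    by (intro sum.cong refl) (use assms in \<open>auto simp: num_faces_eq simp del: of_int_sum\<close>)
  finally show ?thesis .
qed

section \<open>Chain sums by top element\<close>

definition chains_in :: "'a set \<Rightarrow> 'a set set" where
  "chains_in B = {C \<in> K. C \<subseteq> B}"

lemma finite_chains_in: "finite (chains_in B)"
  using finite_K(1) by (simp add: chains_in_def)

lemma rank_strict: "x \<in> P \<Longrightarrow> y \<in> P \<Longrightarrow> x \<sqsubseteq> y \<Longrightarrow> x \<noteq> y \<Longrightarrow> card (N x) < card (N y)"
  using eq_of_card[of x y] by (meson not_le)

definition selected :: "nat set \<Rightarrow> 'a set" where "selected T = {u \<in> P. card (N u) \<in> T}"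

lemma inj_on_rank_chain: "C \<in> K \<Longrightarrow> inj_on (\<lambda>x. card (N x)) C"
proof (rule inj_onI)
  fix x y assume "C \<in> K" "x \<in> C" "y \<in> C" "card (N x) = card (N y)"
  then show "x = y" using rank_strict[of x y] rank_strict[of y x] by (force simp: mem_K)
qed

text \<open>The hypothesis \<open>down\<close> ensures that adding a top from \<open>B\<close> to
  any chain of \<open>S\<close> below it gives a chain in \<open>B\<close>. The weight
  \<open>g\<close> is arbitrary, since the exponent of \<open>1 - x\<close> depends on the ambient
  poset.\<close>

lemma chain_poly_by_top:
  assumes B: "B \<subseteq> P" and down: "\<And>u v. u \<in> B \<Longrightarrow> v \<in> S \<Longrightarrow> v \<sqsubseteq> u \<Longrightarrow> v \<in> B" and "B \<subseteq> S" "S \<subseteq> P"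
  shows "(\<Sum>C\<in>chains_in B. g (card C)) = g 0 + (\<Sum>u\<in>B. \<Sum>C\<in>chains_in {v \<in> S. v \<sqsubseteq> u \<and> v \<noteq> u}. (g (Suc (card C)) :: real poly))"
proof -
  let ?below = "\<lambda>u. {v \<in> S. v \<sqsubseteq> u \<and> v \<noteq> u}"
  have finB: "finite B" using B finite_P finite_subset by blast
  have img: "chains_in B = insert {} (\<Union>u\<in>B. insert u ` chains_in (?below u))"
  proof (intro set_eqI iffI)
    fix C assume C: "C \<in> chains_in B"
    show "C \<in> insert {} (\<Union>u\<in>B. insert u ` chains_in (?below u))"
    proof (cases "C = {}")
      case False
      have fin: "finite C" using C finite_K(2) by (auto simp: chains_in_def)
      have "Max ((\<lambda>x. card (N x)) ` C) \<in> (\<lambda>x. card (N x)) ` C" using fin False by simp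
      then obtain u where u: "u \<in> C" "card (N u) = Max ((\<lambda>x. card (N x)) ` C)" by auto
      have top: "v \<sqsubseteq> u" if v: "v \<in> C" for v
      proof (rule ccontr)
        assume "\<not> v \<sqsubseteq> u"
        then have "u \<sqsubseteq> v" "u \<noteq> v" "u \<in> P" "v \<in> P" using C u v le_refl[of v] by (auto simp: chains_in_def mem_K)
        then have "card (N u) < card (N v)" by (intro rank_strict)
        moreover have "card (N v) \<le> card (N u)" unfolding u(2) using fin v by simp
        ultimately show False by simp
      qed
      have "C = insert u (C - {u})" using u by auto
      moreover have "C - {u} \<in> chains_in (?below u)"
        using C top assms(3) by (auto simp: chains_in_def mem_K)
      moreover have "u \<in> B" using C u by (auto simp: chains_in_def)
      ultimately show ?thesis by blast
    qed simp
  next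
    fix C assume "C \<in> insert {} (\<Union>u\<in>B. insert u ` chains_in (?below u))"
    then consider "C = {}" | u D where "u \<in> B" "D \<in> chains_in (?below u)" "C = insert u D" by blast
    then show "C \<in> chains_in B"
    proof cases
      case 1
      then show ?thesis by (simp add: chains_in_def mem_K)
    next
      case 2
      have "D \<subseteq> B" using 2 down by (auto simp: chains_in_def)
      then show ?thesis using 2 B le_refl by (auto simp: chains_in_def mem_K subset_iff)
    qed
  qed
  have top_unique: "u = u'" if "u \<in> B" "u' \<in> B" "D \<in> chains_in (?below u)" "D' \<in> chains_in (?below u')"
    "insert u D = insert u' D'" for u u' D D'
  proof (rule ccontr)
    assume ne: "u \<noteq> u'"
    then have "u \<in> D'" "u' \<in> D" using that(5) by auto
    then have "u \<sqsubseteq> u'" "u' \<sqsubseteq> u" using that by (auto simp: chains_in_def)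
    then show False using ne le_antisym B that by blast
  qed
  have disj: "insert u ` chains_in (?below u) \<inter> insert u' ` chains_in (?below u') = {}"
    if "u \<in> B" "u' \<in> B" "u \<noteq> u'" for u u'
  proof (rule equals0I)
    fix C assume "C \<in> insert u ` chains_in (?below u) \<inter> insert u' ` chains_in (?below u')"
    then obtain D D' where D: "C = insert u D" "D \<in> chains_in (?below u)" "C = insert u' D'" "D' \<in> chains_in (?below u')"
      by blast
    from D(1,3) have "insert u D = insert u' D'" by simp
    from top_unique[OF that(1,2) D(2,4) this] that(3) show False by simp
  qed
  have notin: "u \<notin> D" if "D \<in> chains_in (?below u)" for u D
    using that by (auto simp: chains_in_def)
  have "(\<Sum>C\<in>chains_in B. g (card C)) = g 0 + (\<Sum>C\<in>(\<Union>u\<in>B. insert u ` chains_in (?below u)). g (card C))"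
    unfolding img by (subst sum.insert) (use finB finite_chains_in in auto)
  also have "(\<Sum>C\<in>(\<Union>u\<in>B. insert u ` chains_in (?below u)). g (card C))
    = (\<Sum>u\<in>B. \<Sum>C\<in>insert u ` chains_in (?below u). g (card C))"
    by (rule sum.UNION_disjoint) (use finB finite_chains_in disj in auto)
  also have "\<dots> = (\<Sum>u\<in>B. \<Sum>C\<in>chains_in (?below u). g (Suc (card C)))"
  proof (rule sum.cong[OF refl])
    fix u
    have "inj_on (insert u) (chains_in (?below u))"
      using notin by (intro inj_onI) (metis insert_ident)
    then have "(\<Sum>C\<in>insert u ` chains_in (?below u). g (card C)) = (\<Sum>C\<in>chains_in (?below u). g (card (insert u C)))"
      by (simp add: sum.reindex)
    also have "\<dots> = (\<Sum>C\<in>chains_in (?below u). g (Suc (card C)))"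
    proof (intro sum.cong refl)
      fix C assume C: "C \<in> chains_in (?below u)"
      then have "finite C" using finite_K(2) by (auto simp: chains_in_def)
      then show "g (card (insert u C)) = g (Suc (card C))" using notin[OF C] by simp
    qed
    finally show "(\<Sum>C\<in>insert u ` chains_in (?below u). g (card C)) = (\<Sum>C\<in>chains_in (?below u). g (Suc (card C)))" .
  qed
  finally show ?thesis .
qed

text \<open>The bound makes the subtraction of natural numbers in the exponents of \<open>pY\<close>
  exact.\<close>

lemma card_chain_selected:
  assumes "C \<in> chains_in {v \<in> selected T. v \<sqsubseteq> u \<and> v \<noteq> u}" "u \<in> P" "0 \<notin> T"
  shows "card C \<le> gap T 0 (card (N u) - 1)"
proof -
  have "inj_on (\<lambda>x. card (N x)) C" using assms(1) inj_on_rank_chain by (auto simp: chains_in_def)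
  moreover have "(\<lambda>x. card (N x)) ` C \<subseteq> T \<inter> {0<..card (N u) - 1}"
  proof
    fix m assume "m \<in> (\<lambda>x. card (N x)) ` C"
    then obtain x where x: "x \<in> C" "m = card (N x)" by blast
    then have x': "x \<in> P" "card (N x) \<in> T" "x \<sqsubseteq> u" "x \<noteq> u" using assms(1) by (auto simp: chains_in_def selected_def)
    then have "card (N x) < card (N u)" using rank_strict assms(2) by blast
    moreover have "m \<noteq> 0" using x(2) x'(2) assms(3) by metis
    ultimately show "m \<in> T \<inter> {0<..card (N u) - 1}" using x x' by auto
  qed
  ultimately show ?thesis unfolding gap_def by (intro card_inj_on_le) auto
qed

text \<open>One splitting serves both the part below a face and the whole selected poset. For a top
  of rank \<open>i\<close>, \<open>gap_split\<close> separates the exponent of \<open>1 - x\<close>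
  into the ranks below \<open>i\<close>, the rank \<open>i\<close> taken by the top itself, and the
  ranks above.\<close>

lemma sum_chains_step:
  assumes B: "B \<subseteq> selected T" and down: "\<And>u v. u \<in> B \<Longrightarrow> v \<in> selected T \<Longrightarrow> v \<sqsubseteq> u \<Longrightarrow> v \<in> B"
    and T: "0 \<notin> T"
    and ranks: "\<And>u. u \<in> B \<Longrightarrow> card (N u) \<le> r"
    and IH: "\<And>u. u \<in> B \<Longrightarrow> (\<Sum>C\<in>chains_in {v \<in> selected T. v \<sqsubseteq> u \<and> v \<noteq> u}.
        pX ^ card C * pY ^ (gap T 0 (card (N u) - 1) - card C)) = desc_poly T (card (N u)) 0"
  shows "(\<Sum>C\<in>chains_in B. pX ^ card C * pY ^ (gap T 0 r - card C))
    = pY ^ gap T 0 r + (\<Sum>i\<in>T \<inter> {1..r}. of_nat (card {u \<in> B. card (N u) = i}) * (pX * pY ^ gap T i r * desc_poly T i 0))"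
proof -
  have BP: "B \<subseteq> P" using B by (auto simp: selected_def)
  have finB: "finite B" using BP finite_P finite_subset by blast
  have rank: "card (N u) \<in> T \<inter> {1..r}" if "u \<in> B" for u
    using that B ranks[OF that] T by (auto simp: selected_def Suc_le_eq intro!: gr0I)
  have "(\<Sum>C\<in>chains_in B. pX ^ card C * pY ^ (gap T 0 r - card C)) = pY ^ gap T 0 r
    + (\<Sum>u\<in>B. \<Sum>C\<in>chains_in {v \<in> selected T. v \<sqsubseteq> u \<and> v \<noteq> u}. pX ^ Suc (card C) * pY ^ (gap T 0 r - Suc (card C)))"
    using chain_poly_by_top[OF BP down B, where g = "\<lambda>m. pX ^ m * pY ^ (gap T 0 r - m)"]
    by (simp add: selected_def del: power_Suc)
  also have "(\<Sum>u\<in>B. \<Sum>C\<in>chains_in {v \<in> selected T. v \<sqsubseteq> u \<and> v \<noteq> u}. pX ^ Suc (card C) * pY ^ (gap T 0 r - Suc (card C)))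
    = (\<Sum>u\<in>B. pX * pY ^ gap T (card (N u)) r * desc_poly T (card (N u)) 0)"
  proof (intro sum.cong refl)
    fix u assume u: "u \<in> B"
    have g: "gap T 0 r = Suc (gap T 0 (card (N u) - 1) + gap T (card (N u)) r)"
      using rank[OF u] by (intro gap_split) auto
    have "(\<Sum>C\<in>chains_in {v \<in> selected T. v \<sqsubseteq> u \<and> v \<noteq> u}. pX ^ Suc (card C) * pY ^ (gap T 0 r - Suc (card C)))
      = (\<Sum>C\<in>chains_in {v \<in> selected T. v \<sqsubseteq> u \<and> v \<noteq> u}. pX * pY ^ gap T (card (N u)) r * (pX ^ card C * pY ^ (gap T 0 (card (N u) - 1) - card C)))"
    proof (intro sum.cong refl)
      fix C assume C: "C \<in> chains_in {v \<in> selected T. v \<sqsubseteq> u \<and> v \<noteq> u}"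
      have le: "card C \<le> gap T 0 (card (N u) - 1)"
        using card_chain_selected[OF C _ T] u BP by blast
      then have "gap T 0 r - Suc (card C) = gap T (card (N u)) r + (gap T 0 (card (N u) - 1) - card C)"
        using g by simp
      then show "pX ^ Suc (card C) * pY ^ (gap T 0 r - Suc (card C))
        = pX * pY ^ gap T (card (N u)) r * (pX ^ card C * pY ^ (gap T 0 (card (N u) - 1) - card C))"
        by (simp only: power_add power_Suc mult_ac)
    qed
    also have "\<dots> = pX * pY ^ gap T (card (N u)) r * desc_poly T (card (N u)) 0"
      by (simp only: sum_distrib_left[symmetric] IH[OF u])
    finally show "(\<Sum>C\<in>chains_in {v \<in> selected T. v \<sqsubseteq> u \<and> v \<noteq> u}. pX ^ Suc (card C) * pY ^ (gap T 0 r - Suc (card C)))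
      = pX * pY ^ gap T (card (N u)) r * desc_poly T (card (N u)) 0" .
  qed
  also have "\<dots> = (\<Sum>i\<in>T \<inter> {1..r}. \<Sum>u\<in>{u \<in> B. card (N u) = i}. pX * pY ^ gap T (card (N u)) r * desc_poly T (card (N u)) 0)"
    by (rule sum.group[symmetric]) (use finB rank in auto)
  also have "\<dots> = (\<Sum>i\<in>T \<inter> {1..r}. of_nat (card {u \<in> B. card (N u) = i}) * (pX * pY ^ gap T i r * desc_poly T i 0))"
    by (intro sum.cong refl) simp
  finally show ?thesis .
qed

text \<open>The faces below \<open>y\<close> form a Boolean lattice, whose rank-selected
  h-polynomial is the restricted Eulerian polynomial; both satisfy
  \<open>desc_poly_0_recursion\<close>.\<close>

lemma sum_chains_below:
  assumes T: "0 \<notin> T" and y: "y \<in> P"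
  shows "(\<Sum>C\<in>chains_in {v \<in> selected T. v \<sqsubseteq> y \<and> v \<noteq> y}. pX ^ card C * pY ^ (gap T 0 (card (N y) - 1) - card C))
    = desc_poly T (card (N y)) 0"
  using y
proof (induction "card (N y)" arbitrary: y rule: less_induct)
  case (less y)
  let ?B = "{v \<in> selected T. v \<sqsubseteq> y \<and> v \<noteq> y}"
  have lt: "card (N u) < card (N y)" if "u \<in> ?B" for u
    using that rank_strict less.prems by (auto simp: selected_def)
  show ?case
  proof (cases "card (N y) = 0")
    case True
    then have "?B = {}" using lt by fastforce
    then have "chains_in ?B = {{}}" by (auto simp: chains_in_def mem_K)
    then show ?thesis using True by (simp add: gap_def)
  next
    case False
    let ?r = "card (N y) - 1"
    have "(\<Sum>C\<in>chains_in ?B. pX ^ card C * pY ^ (gap T 0 ?r - card C))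
      = pY ^ gap T 0 ?r + (\<Sum>i\<in>T \<inter> {1..?r}. of_nat (card {u \<in> ?B. card (N u) = i}) * (pX * pY ^ gap T i ?r * desc_poly T i 0))"
    proof (rule sum_chains_step[OF _ _ T])
      fix u v assume "u \<in> ?B" "v \<in> selected T" "v \<sqsubseteq> u"
      then show "v \<in> ?B"
        using le_trans[of v u y] le_antisym[of u y] less.prems by (auto simp: selected_def)
    next
      fix u assume u: "u \<in> ?B"
      show "card (N u) \<le> ?r" using lt[OF u] by simp
      have "u \<in> P" using u by (simp add: selected_def)
      from less.hyps[OF lt[OF u] this]
      show "(\<Sum>C\<in>chains_in {v \<in> selected T. v \<sqsubseteq> u \<and> v \<noteq> u}. pX ^ card C * pY ^ (gap T 0 (card (N u) - 1) - card C))
        = desc_poly T (card (N u)) 0" .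
    qed auto
    also have "(\<Sum>i\<in>T \<inter> {1..?r}. of_nat (card {u \<in> ?B. card (N u) = i}) * (pX * pY ^ gap T i ?r * desc_poly T i 0))
      = (\<Sum>i\<in>T \<inter> {1..<card (N y)}. of_nat (card (N y) choose i) * (pX * pY ^ gap T i ?r * desc_poly T i 0))"
    proof (intro sum.cong)
      show "T \<inter> {1..?r} = T \<inter> {1..<card (N y)}" using False by auto
      fix i assume i: "i \<in> T \<inter> {1..<card (N y)}"
      then have "{u \<in> ?B. card (N u) = i} = {u \<in> P. u \<sqsubseteq> y \<and> card (N u) = i}"
        by (auto simp: selected_def)
      then show "of_nat (card {u \<in> ?B. card (N u) = i}) * (pX * pY ^ gap T i ?r * desc_poly T i 0)
        = of_nat (card (N y) choose i) * (pX * pY ^ gap T i ?r * desc_poly T i 0)"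
        by (simp add: card_faces_below[OF less.prems])
    qed
    also have "pY ^ gap T 0 ?r + \<dots> = desc_poly T (card (N y)) 0"
      by (rule desc_poly_0_recursion[symmetric]) (use False in simp)
    finally show ?thesis .
  qed
qed

theorem sum_chains_selected:
  assumes g: "graded_of_rank P R n" and T: "T \<subseteq> {1..n}"
  shows "(\<Sum>C\<in>chains_in (selected T). pX ^ card C * pY ^ (card T - card C)) = h_comb T n"
proof -
  have 0: "0 \<notin> T" using T by auto
  have gap: "gap T 0 n = card T" unfolding gap_def using T by (intro arg_cong[where f = card]) auto
  have eq: "{u \<in> selected T. card (N u) = i} = {u \<in> P. card (N u) = i}" if "i \<in> T" for i
    using that by (auto simp: selected_def)
  have "(\<Sum>C\<in>chains_in (selected T). pX ^ card C * pY ^ (gap T 0 n - card C))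
    = pY ^ gap T 0 n + (\<Sum>i\<in>T \<inter> {1..n}. of_nat (card {u \<in> selected T. card (N u) = i}) * (pX * pY ^ gap T i n * desc_poly T i 0))"
  proof (rule sum_chains_step[OF subset_refl _ 0])
    fix u assume u: "u \<in> selected T"
    then have "u \<in> P" by (simp add: selected_def)
    then show "card (N u) \<le> n" by (rule card_N_le[OF g])
    show "(\<Sum>C\<in>chains_in {v \<in> selected T. v \<sqsubseteq> u \<and> v \<noteq> u}.
        pX ^ card C * pY ^ (gap T 0 (card (N u) - 1) - card C)) = desc_poly T (card (N u)) 0"
      by (rule sum_chains_below[OF 0 \<open>u \<in> P\<close>])
  qed
  also have "\<dots> = h_comb T n"
    unfolding h_comb_eq[OF T]
    by (intro arg_cong2[where f = "(+)"] refl sum.cong) (use T eq in \<open>auto simp: num_faces_def\<close>)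
  finally show ?thesis by (simp only: gap)
qed

end

section \<open>Real-rootedness\<close>

lemma sum_face_count:
  assumes "finite K"
  shows "(\<Sum>i\<le>max_face_size K. monom (of_nat (face_count K i)) i * q i) = (\<Sum>F\<in>K. pX ^ card F * q (card F))"
proof -
  have le: "card F \<le> max_face_size K" if "F \<in> K" for F
    unfolding max_face_size_def using assms that by simp
  have "(\<Sum>F\<in>K. pX ^ card F * q (card F)) = (\<Sum>i\<le>max_face_size K. \<Sum>F\<in>{F \<in> K. card F = i}. pX ^ card F * q (card F))"
    by (rule sum.group[symmetric]) (use assms le in auto)
  also have "\<dots> = (\<Sum>i\<le>max_face_size K. of_nat (face_count K i) * (pX ^ i * q i))"
    by (rule sum.cong[OF refl]) (simp add: face_count_def)
  also have "\<dots> = (\<Sum>i\<le>max_face_size K. monom (of_nat (face_count K i)) i * q i)"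
    by (rule sum.cong[OF refl]) (simp add: pX_def monom_power of_nat_poly smult_monom flip: mult.assoc)
  finally show ?thesis by simp
qed

lemma h_poly_eq_sum:
  "finite K \<Longrightarrow> h_poly K = (\<Sum>F\<in>K. pX ^ card F * pY ^ (max_face_size K - card F))"
  using sum_face_count[of K "\<lambda>i. pY ^ (max_face_size K - i)"] by (simp add: h_poly_def pY_eq)

lemma f_poly_eq_sum: "finite K \<Longrightarrow> f_poly K = (\<Sum>F\<in>K. pX ^ card F)"
  using sum_face_count[of K "\<lambda>_. 1"] by (simp add: f_poly_def)

lemma cpoly_pX [simp]: "cpoly pX w = w" and cpoly_pY [simp]: "cpoly pY w = 1 - w"
  by (simp_all add: pX_def pY_eq)

text \<open>The substitution \<open>f(w) = (1 + w)\<^sup>M h(w / (1 + w))\<close>.\<close>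

lemma f_poly_real_rooted:
  assumes fin: "finite K" and h: "real_rooted (h_poly K)" "h_poly K \<noteq> 0"
  shows "real_rooted (f_poly K)"
  unfolding real_rooted_def cpoly_def[symmetric]
proof (intro disjI2 allI impI)
  fix w assume w: "cpoly (f_poly K) w = 0"
  show "w \<in> \<real>"
  proof (cases "1 + w = 0")
    case True
    then have "w = - 1" by (simp add: eq_neg_iff_add_eq_0 add.commute)
    then show ?thesis by simp
  next
    case False
    let ?M = "max_face_size K"
    define u where "u = w / (1 + w)"
    have u1: "(1 + w) * (1 - u) = 1" and uw: "(1 + w) * u = w" using False by (simp_all add: u_def field_simps)
    have "(1 + w) ^ ?M * cpoly (h_poly K) u = (\<Sum>F\<in>K. (1 + w) ^ ?M * (u ^ card F * (1 - u) ^ (?M - card F)))"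
      by (simp add: h_poly_eq_sum[OF fin] sum_distrib_left)
    also have "\<dots> = (\<Sum>F\<in>K. w ^ card F)"
    proof (rule sum.cong[OF refl])
      fix F assume "F \<in> K"
      then have "card F \<le> ?M" unfolding max_face_size_def using fin by simp
      then have "(1 + w) ^ ?M = (1 + w) ^ card F * (1 + w) ^ (?M - card F)"
        by (simp flip: power_add)
      then have "(1 + w) ^ ?M * (u ^ card F * (1 - u) ^ (?M - card F))
        = ((1 + w) * u) ^ card F * ((1 + w) * (1 - u)) ^ (?M - card F)"
        by (simp only: power_mult_distrib mult_ac)
      then show "(1 + w) ^ ?M * (u ^ card F * (1 - u) ^ (?M - card F)) = w ^ card F"
        by (simp only: u1 uw power_one mult_1_right)
    qed
    also have "\<dots> = 0" using w by (simp add: f_poly_eq_sum[OF fin])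
    finally have "cpoly (h_poly K) u = 0" using False by simp
    then have "u \<in> \<real>" using h by (simp add: real_rooted_def cpoly_def)
    moreover have "w = u / (1 - u)" using u1 uw by (metis mult.commute mult_1 nonzero_eq_divide_eq mult_zero_right mult.assoc zero_neq_one)
    ultimately show ?thesis by simp
  qed
qed

text \<open>The identity permutation contributes to the constant term. This makes the polynomial
  nonzero and its leading coefficient positive.\<close>

lemma desc_poly_coeff_0: "coeff (desc_poly T n 0) 0 \<ge> 1"
proof (induction n)
  case (Suc n)
  have "coeff (desc_poly T n 0) 0 \<le> (\<Sum>i\<in>{0..n}. coeff (desc_poly T n i) 0)"
    by (rule member_le_sum) (auto simp: desc_poly_coeff_nonneg)
  then show ?case using Suc by (simp add: desc_poly_Suc coeff_sum)
qed simp

lemma comb_coeff_0: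
  assumes "\<And>k. k \<le> n \<Longrightarrow> 0 \<le> h k"
  shows "h 0 \<le> coeff (comb T n h) 0"
proof -
  have "h 0 * 1 \<le> h 0 * coeff (desc_poly T n 0) 0"
    using assms desc_poly_coeff_0 by (intro mult_left_mono) auto
  also have "\<dots> \<le> (\<Sum>k\<le>n. h k * coeff (desc_poly T n k) 0)"
    by (rule member_le_sum) (auto simp: assms desc_poly_coeff_nonneg)
  finally show ?thesis by (simp add: comb_def coeff_sum)
qed

lemma lead_coeff_pos:
  assumes "\<And>m. 0 \<le> coeff p m" "p \<noteq> (0 :: real poly)"
  shows "lead_coeff p > 0"
  using assms(1)[of "degree p"] assms(2) by (simp add: less_le)

lemma eulerian_poly_real_rooted: "n > 0 \<Longrightarrow> real_rooted (eulerian_poly n T)"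
  by (simp add: eulerian_poly_eq_desc_poly desc_poly_0_eq_comb comb_real_rooted)

lemma eulerian_poly_interlaces_comb:
  assumes "n > 0" and h: "\<And>k. k \<le> n \<Longrightarrow> 0 \<le> h k" and "h 0 > 0"
  shows "interlaces (eulerian_poly n T) (comb T n h)"
proof (rule interlaces_of_upper_half_plane)
  note e = eulerian_poly_eq_desc_poly[OF assms(1), of T]
  show "real_rooted (eulerian_poly n T)" by (rule eulerian_poly_real_rooted[OF assms(1)])
  show "real_rooted (comb T n h)" by (rule comb_real_rooted[OF h])
  show "lead_coeff (eulerian_poly n T) > 0"
    unfolding e
  proof (rule lead_coeff_pos[OF desc_poly_coeff_nonneg])
    show "desc_poly T n 0 \<noteq> 0" using desc_poly_coeff_0[of T n] by auto
  qed
  show "lead_coeff (comb T n h) > 0"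
  proof (rule lead_coeff_pos[OF comb_coeff_nonneg[OF h]])
    show "comb T n h \<noteq> 0" using comb_coeff_0[of n h T] h \<open>h 0 > 0\<close> by auto
  qed
  show "0 \<le> Im (cpoly (comb T n h) w * cnj (cpoly (eulerian_poly n T) w))" if "Im w > 0" for w
    unfolding e by (rule desc_poly_prec_comb[OF h that])
qed

section \<open>Adjoining the minimum and the maximum\<close>

context pointed_labelled_poset
begin

lemma order_complex_rank_selected:
  assumes T: "0 \<notin> T"
  shows "order_complex (rank_selected P R z T) (hat_rel P R)
    = (\<lambda>(C, A). Some ` C \<union> A) ` (chains_in (selected T) \<times> Pow {Some z, None})"
proof -
  have Q: "rank_selected P R z T = Some ` selected T \<union> {Some z, None}"
    by (auto simp: rank_selected_def selected_def rank_of_eq)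
  have zT: "z \<notin> selected T" using T N_z by (simp add: selected_def)
  show ?thesis
  proof (intro set_eqI iffI)
    fix F assume "F \<in> order_complex (rank_selected P R z T) (hat_rel P R)"
    then have F: "F \<subseteq> Some ` selected T \<union> {Some z, None}"
      "\<And>a b. a \<in> F \<Longrightarrow> b \<in> F \<Longrightarrow> (a, b) \<in> hat_rel P R \<or> (b, a) \<in> hat_rel P R"
      by (auto simp: order_complex_def Q Chains_def)
    define C where "C = {x. Some x \<in> F \<and> x \<noteq> z}"
    have "C \<subseteq> selected T" using F(1) by (auto simp: C_def)
    moreover have "x \<sqsubseteq> y \<or> y \<sqsubseteq> x" if "x \<in> C" "y \<in> C" for x y
      using F(2)[of "Some x" "Some y"] that by (auto simp: C_def hat_rel_def)
    ultimately have "C \<in> chains_in (selected T)" by (auto simp: chains_in_def mem_K selected_def)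
    moreover have "F = Some ` C \<union> (F \<inter> {Some z, None})"
      using F(1) by (auto simp: C_def)
    ultimately show "F \<in> (\<lambda>(C, A). Some ` C \<union> A) ` (chains_in (selected T) \<times> Pow {Some z, None})"
      by (intro image_eqI[of _ _ "(C, F \<inter> {Some z, None})"]) auto
  next
    fix F assume "F \<in> (\<lambda>(C, A). Some ` C \<union> A) ` (chains_in (selected T) \<times> Pow {Some z, None})"
    then obtain C A where CA: "C \<in> chains_in (selected T)" "A \<subseteq> {Some z, None}" "F = Some ` C \<union> A" by auto
    have C: "C \<subseteq> P" "\<And>x y. x \<in> C \<Longrightarrow> y \<in> C \<Longrightarrow> x \<sqsubseteq> y \<or> y \<sqsubseteq> x" "C \<subseteq> selected T"
      using CA(1) by (auto simp: chains_in_def mem_K)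
    have FP: "F \<subseteq> insert None (Some ` P)" using CA C(1) z_in by auto
    have some: "x \<sqsubseteq> y \<or> y \<sqsubseteq> x" if "Some x \<in> F" "Some y \<in> F" for x y
    proof -
      have "x \<in> insert z C" "y \<in> insert z C" using that CA(2,3) by auto
      then show ?thesis using C(1,2) z_le z_in by blast
    qed
    have "(a, b) \<in> hat_rel P R \<or> (b, a) \<in> hat_rel P R" if ab: "a \<in> F" "b \<in> F" for a b
    proof (cases a)
      case None
      then show ?thesis using ab(2) FP by (auto simp: hat_rel_def)
    next
      case a: (Some x)
      show ?thesis
      proof (cases b)
        case None
        then show ?thesis using ab(1) FP by (auto simp: hat_rel_def)
      next
        case (Some y)
        then show ?thesis using some[of x y] ab a by (auto simp: hat_rel_def)
      qed
    qed
    moreover have "F \<subseteq> rank_selected P R z T" using CA C(3) by (auto simp: Q)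
    ultimately show "F \<in> order_complex (rank_selected P R z T) (hat_rel P R)"
      by (auto simp: order_complex_def Chains_def)
  qed
qed

text \<open>The minimum and the maximum are comparable with everything, so they are cone points of
  the complex. Each multiplies the weighted chain sum by \<open>x + (1 - x) = 1\<close>, which
  leaves the h-polynomial unchanged.\<close>

lemma
  assumes g: "graded_of_rank P R n" and T: "T \<subseteq> {1..n}"
  defines "\<Delta> \<equiv> order_complex (rank_selected P R z T) (hat_rel P R)"
  shows finite_rank_selected: "finite \<Delta>"
    and h_poly_rank_selected: "h_poly \<Delta> = h_comb T n"
proof -
  have 0: "0 \<notin> T" using T by auto
  have finT: "finite T" using T finite_subset by blast
  let ?S = "chains_in (selected T) \<times> Pow {Some z, None}"
  let ?f = "\<lambda>(C, A). Some ` C \<union> A"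
  have \<Delta>: "\<Delta> = ?f ` ?S" unfolding \<Delta>_def by (rule order_complex_rank_selected[OF 0])
  show fin: "finite \<Delta>" unfolding \<Delta> using finite_chains_in by (intro finite_imageI finite_cartesian_product) auto
  have zC: "z \<notin> C" if "C \<in> chains_in (selected T)" for C
    using that N_z 0 by (auto simp: chains_in_def selected_def)
  have inj: "inj_on ?f ?S"
  proof (rule inj_onI, clarify)
    fix C A C' A' assume C: "C \<in> chains_in (selected T)" "C' \<in> chains_in (selected T)"
      and A: "A \<subseteq> {Some z, None}" "A' \<subseteq> {Some z, None}" and eq: "Some ` C \<union> A = Some ` C' \<union> A'"
    have rec: "{x. Some x \<in> Some ` C \<union> A \<and> x \<noteq> z} = C" "(Some ` C \<union> A) \<inter> {Some z, None} = A"
      if "C \<in> chains_in (selected T)" "A \<subseteq> {Some z, None}" for C A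
      using that(2) zC[OF that(1)] by auto
    have "C = C'" using rec(1)[OF C(1) A(1)] rec(1)[OF C(2) A(2)] unfolding eq by (rule trans[OF sym])
    moreover have "A = A'" using rec(2)[OF C(1) A(1)] rec(2)[OF C(2) A(2)] unfolding eq by (rule trans[OF sym])
    ultimately show "C = C' \<and> A = A'" by simp
  qed
  have card: "card (Some ` C \<union> A) = card C + card A" if "C \<in> chains_in (selected T)" "A \<subseteq> {Some z, None}" for C A
  proof -
    have "finite C" using that(1) finite_K(2) by (auto simp: chains_in_def)
    moreover have "finite A" using that(2) finite_subset by blast
    moreover have "Some ` C \<inter> A = {}" using that(2) zC[OF that(1)] by auto
    ultimately show ?thesis by (simp add: card_Un_disjoint card_image)
  qed
  have cardC: "card C \<le> card T" if "C \<in> chains_in (selected T)" for C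
  proof -
    have "inj_on (\<lambda>x. card (N x)) C" using that inj_on_rank_chain by (auto simp: chains_in_def)
    moreover have "(\<lambda>x. card (N x)) ` C \<subseteq> T" using that by (auto simp: chains_in_def selected_def)
    ultimately show ?thesis using finT by (rule card_inj_on_le)
  qed
  have M: "max_face_size \<Delta> = card T + 2"
    unfolding max_face_size_def
  proof (rule Max_eqI)
    show "finite (card ` \<Delta>)" using fin by simp
    fix m assume "m \<in> card ` \<Delta>"
    then obtain C A where CA: "C \<in> chains_in (selected T)" "A \<subseteq> {Some z, None}" "m = card (Some ` C \<union> A)"
      unfolding \<Delta> by auto
    have "card A \<le> card {Some z, None}" by (rule card_mono[OF _ CA(2)]) simp
    then show "m \<le> card T + 2" using card[OF CA(1,2)] cardC[OF CA(1)] CA(3) by simp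
  next
    \<comment> \<open>The \<open>n + 1\<close> elements of a maximal chain have distinct ranks at
      most \<open>n\<close>, so they occupy every rank and in particular all those in
      \<open>T\<close>.\<close>
    obtain D where D: "D \<in> K" "card D = n + 1"
      by (rule maximal_chain[OF g, of "{}"]) (auto simp: mem_K)
    have iD: "inj_on (\<lambda>x. card (N x)) D" by (rule inj_on_rank_chain[OF D(1)])
    have "(\<lambda>x. card (N x)) ` D = {..n}"
    proof (rule card_subset_eq)
      show "(\<lambda>x. card (N x)) ` D \<subseteq> {..n}" using D(1) card_N_le[OF g] by (auto simp: mem_K)
      show "card ((\<lambda>x. card (N x)) ` D) = card {..n}" using card_image[OF iD] D(2) by simp
    qed simp
    note imD = this
    define C where "C = {u \<in> D. card (N u) \<in> T}"
    have "(\<lambda>x. card (N x)) ` C = (\<lambda>x. card (N x)) ` D \<inter> T" by (auto simp: C_def)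
    then have "(\<lambda>x. card (N x)) ` C = T" using T by (auto simp: imD)
    moreover have "inj_on (\<lambda>x. card (N x)) C" by (rule inj_on_subset[OF iD]) (auto simp: C_def)
    ultimately have cC: "card C = card T" using card_image by metis
    have C: "C \<in> chains_in (selected T)" using D(1) by (auto simp: C_def chains_in_def mem_K selected_def)
    have "card (Some ` C \<union> {Some z, None}) = card T + 2" by (subst card[OF C]) (auto simp: cC)
    moreover have "Some ` C \<union> {Some z, None} \<in> \<Delta>"
      unfolding \<Delta> using C by (intro image_eqI[of _ _ "(C, {Some z, None})"]) auto
    ultimately show "card T + 2 \<in> card ` \<Delta>" by (metis image_eqI)
  qed
  have "h_poly \<Delta> = (\<Sum>(C, A)\<in>?S. pX ^ (card C + card A) * pY ^ (card T + 2 - (card C + card A)))"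
    unfolding h_poly_eq_sum[OF fin] M
    by (subst \<Delta>, subst sum.reindex[OF inj]) (auto simp: card intro!: sum.cong)
  also have "\<dots> = (\<Sum>C\<in>chains_in (selected T). \<Sum>A\<in>Pow {Some z, None}. pX ^ (card C + card A) * pY ^ (card T + 2 - (card C + card A)))"
    by (rule sum.cartesian_product[symmetric])
  also have "\<dots> = (\<Sum>C\<in>chains_in (selected T). pX ^ card C * pY ^ (card T - card C))"
  proof (rule sum.cong[OF refl])
    fix C assume "C \<in> chains_in (selected T)"
    then have e: "card T + 2 = card C + (card T - card C) + 2" using cardC by simp
    define t where "t = card T - card C"
    have P: "Pow {Some z, None} = {{}, {Some z}, {None}, {Some z, None}}"
      by (auto simp: Pow_insert)
    have "(\<Sum>A\<in>Pow {Some z, None}. pX ^ (card C + card A) * pY ^ (card T + 2 - (card C + card A)))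
      = pX ^ card C * pY ^ (t + 2) + pX ^ (card C + 1) * pY ^ (t + 1) + pX ^ (card C + 1) * pY ^ (t + 1) + pX ^ (card C + 2) * pY ^ t"
      unfolding P e by (simp add: t_def add_ac eval_nat_numeral)
    also have "\<dots> = pX ^ card C * pY ^ t * ((pX + pY) * (pX + pY))"
      by (simp add: power_add power2_eq_square algebra_simps)
    also have "pX + pY = 1" by (simp add: pY_def)
    finally show "(\<Sum>A\<in>Pow {Some z, None}. pX ^ (card C + card A) * pY ^ (card T + 2 - (card C + card A)))
      = pX ^ card C * pY ^ (card T - card C)" by (simp add: t_def)
  qed
  also have "\<dots> = h_comb T n" by (rule sum_chains_selected[OF g T])
  finally show "h_poly \<Delta> = h_comb T n" .
qed

theorem rank_selected_interlacing:
  assumes n: "n > 0" and g: "graded_of_rank P R n" and T: "T \<subseteq> {1..n}"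
    and cm: "cohen_macaulay_poset TYPE('k::field) P R"
  shows "real_rooted (chain_poly (rank_selected P R z T) (hat_rel P R))"
    and "interlaces (eulerian_poly n T) (h_poly (order_complex (rank_selected P R z T) (hat_rel P R)))"
proof -
  let ?\<Delta> = "order_complex (rank_selected P R z T) (hat_rel P R)"
  note h = h_poly_rank_selected[OF g T, unfolded h_comb_def]
  have nonneg: "0 \<le> real_of_int (h_entry n k)" if "k \<le> n" for k
    using h_entry_nonneg[OF g cm that] by simp
  have h0: "h_entry n 0 = 1" by (simp add: h_entry_def num_faces_0)
  show "interlaces (eulerian_poly n T) (h_poly ?\<Delta>)"
    unfolding h by (rule eulerian_poly_interlaces_comb[OF n nonneg]) (simp_all add: h0)
  have "h_poly ?\<Delta> \<noteq> 0"
    using comb_coeff_0[of n "\<lambda>k. real_of_int (h_entry n k)" T] nonneg unfolding h by (auto simp: h0)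
  then show "real_rooted (chain_poly (rank_selected P R z T) (hat_rel P R))"
    unfolding chain_poly_def
    by (intro f_poly_real_rooted finite_rank_selected[OF g T]) (auto simp: h intro: comb_real_rooted nonneg)
qed

end

theorem theorem1p2:
  fixes n :: nat
  assumes "n > 0"
  shows "(\<forall>T \<subseteq> {1..n - 1}. real_rooted (eulerian_poly n T)) \<and>
    (\<forall>(P :: 'a set) (r :: 'a rel) (z :: 'a).
       simplicial_poset P r z \<longrightarrow> graded_of_rank P r n \<longrightarrow>
       cohen_macaulay_poset TYPE('k::field) P r \<longrightarrow>
       (\<forall>T \<subseteq> {1..n}.
          real_rooted (chain_poly (rank_selected P r z T) (hat_rel P r)) \<and>
          interlaces (eulerian_poly n T)
            (h_poly (order_complex (rank_selected P r z T) (hat_rel P r)))))"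
proof (intro conjI allI impI)
  show "real_rooted (eulerian_poly n T)" for T
    by (rule eulerian_poly_real_rooted[OF assms])
  fix P :: "'a set" and r z T
  assume sp: "simplicial_poset P r z" and g: "graded_of_rank P r n"
    and cm: "cohen_macaulay_poset TYPE('k) P r" and T: "T \<subseteq> {1..n}"
  obtain N where "pointed_labelled_poset P (\<lambda>x y. (x, y) \<in> r) N z"
    by (rule simplicial_poset_labelled[OF sp])
  then interpret pointed_labelled_poset P "\<lambda>x y. (x, y) \<in> r" N z .
  have R: "R = r" by (simp add: R_def)
  show "real_rooted (chain_poly (rank_selected P r z T) (hat_rel P r))"
    "interlaces (eulerian_poly n T) (h_poly (order_complex (rank_selected P r z T) (hat_rel P r)))"
    using rank_selected_interlacing[OF assms, unfolded R, OF g T cm] by auto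
qed

end
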